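(* Suppose that for every labelled motic Feynman graph $G$ we are given homogeneous polynomials $P_G,C_G$ in the variables $\alpha_e$, $e\in E_G$, of degrees $h_G$ and $h_G+1$ respectively, which respect the equivalence relation on Feynman graphs, take the same values on $G$ and $G\cup\{v\}$ for $v$ an isolated vertex, and satisfy: (1) Partial factorisations: for all motic subgraphs $\gamma\subset G$, $$P_G\equiv_\gamma P_\gamma P_{G/\gamma},\qquad C_G\equiv_\gamma P_\gamma C_{G/\gamma}\ \text{ if }\gamma\text{ is not m.m.},\qquad C_G\equiv_\gamma C_\gamma P_{G/\gamma}\ \text{ if }\gamma\text{ is m.m.};$$ here, for homogeneous polynomials $A,B,C$, the notation $A_G\equiv_\gamma B_\gamma C_{G/\gamma}$ means that $A_G-B_\gamma C_{G/\gamma}$ has degree $>\deg B_\gamma$ in the variables $\alpha_e$, $e\in E_\gamma$ (every monomial occurring has degree $>\deg B_\gamma$ in these variables). (2) Edge contraction: for all $e\in E_G$, $P_G|_{\alpha_e=0}=P_{G/\!\!/e}$ and $C_G|_{\alpha_e=0}=C_{G/\!\!/e}$. (3) Initial conditions: if $G$ has a single edge, then $P_G=\Psi_G$ and $C_G=\Xi_G(q,m)$. If $G$ is a banana graph (a connected graph with two vertices) with all edges massive, then the coefficient of $\prod_{e\in E_G}\alpha_e$ in $C_G$ is $q^2+\sum_{e\in E_G}m_e^2$, where $q$ is the momentum entering one of the two vertices. Then $P_G=\Psi_G$ and $C_G=\Xi_G(q,m)$ for every labelled motic Feynman graph $G$.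
   Context: A Feynman graph $G=(V_G,E_G,E_G^{\mathrm{ext}})$ is a finite graph with vertices $V_G$, internal edges $E_G$ (multiple edges and self-edges, called tadpoles, allowed) and external half-edges $E_G^{\mathrm{ext}}$, each attached to a vertex, such that all vertices carrying external half-edges lie in one connected component. Each internal edge $e$ has a mass $m_e\in\mathbb R$ (massive if $m_e\ne0$); each external half-edge $i$ carries a momentum $q_i\in\mathbb R^d$, generic subject to $\sum_iq_i=0$. 'Labelled' means that edges carry distinct labels. Two graphs are equivalent if they are related by replacing several external half-edges at one vertex by a single one carrying the sum of the momenta. $h_G$ denotes the loop number. A subset $\gamma\subset E_G$ is identified with the edge-subgraph with edges $\gamma$ and vertices the endpoints of edges in $\gamma$. It is mass-momentum spanning (m.m.) in $G$ if it contains all massive edges of $G$, and all vertices carrying external half-edges are vertices of $\gamma$ lying in a single connected component of $\gamma$. If $\gamma$ is m.m. in $G$ it inherits all masses and external half-edges of $G$; otherwise it is regarded as a Feynman graph with all masses zero and no external half-edges. $G/\gamma$ is obtained by removing the edges of $\gamma$ and identifying all vertices in each connected component of $\gamma$, with induced external half-edges and masses. An edge-subgraph $\Gamma\subset G$ is motic if $h_\gamma<h_\Gamma$ for every strict $\gamma\subsetneq\Gamma$ which is m.m. in $\Gamma$; $G$ is motic if it is motic as a subgraph of itself. For an edge $e$, $G/\!\!/e=G/e$ if $e$ is not a tadpole; if $e$ is a tadpole, all polynomials attached to $G/\!\!/e$ are zero by convention. For $G$ connected, $\Psi_G=\sum_{T}\prod_{e\notin T}\alpha_e$ (sum over spanning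 trees) and $\Phi_G(q)=\sum_{T_1\cup T_2}(q^{T_1})^2\prod_{e\notin T_1\cup T_2}\alpha_e$ (sum over spanning forests with exactly two components $T_1,T_2$; $q^{T_1}$ is the total momentum entering $T_1$). If $G$ has components $G_0$ (containing all external momenta)$,G_1,\dots,G_n$, then $\Psi_G=\prod_i\Psi_{G_i}$ and $\Phi_G(q)=\Phi_{G_0}(q)\prod_{i\ge1}\Psi_{G_i}$. Finally $\Xi_G(q,m)=\Phi_G(q)+(\sum_{e}m_e^2\alpha_e)\Psi_G$. The polynomials $P_G,C_G$ have coefficients in $\mathbb R$ (or in any field extension of $\mathbb Q$ containing the kinematic quantities $q_i\cdot q_j$, $m_e^2$). *)

theory Defs
  imports "HOL-Analysis.Analysis" "HOL-Library.Uprod" "HOL-Library.Poly_Mapping"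
begin

section \<open>Feynman graphs\<close>

text \<open>
  Internal edges are named by their labels, and an edge has an unordered pair of end points (equal
  for a tadpole). Values of the record functions outside the carrier sets are irrelevant.
\<close>

record 'd fgraph =
  verts :: "nat set"
  edges :: "nat set"
  ends :: "nat \<Rightarrow> nat uprod"
  mass :: "nat \<Rightarrow> real"
  legs :: "nat set"
  foot :: "nat \<Rightarrow> nat"
  mom :: "nat \<Rightarrow> real ^ 'd"

definition adj :: "('d::finite) fgraph \<Rightarrow> nat set \<Rightarrow> (nat \<times> nat) set" where
  "adj G \<gamma> = {(u, v). \<exists>e\<in>\<gamma>. ends G e = Upair u v}"

definition joined :: "('d::finite) fgraph \<Rightarrow> nat set \<Rightarrow> nat \<Rightarrow> nat \<Rightarrow> bool" where
  "joined G \<gamma> u v \<longleftrightarrow> (u, v) \<in> (adj G \<gamma>)\<^sup>*"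

definition components :: "('d::finite) fgraph \<Rightarrow> nat set set" where
  "components G = verts G // {(u, v). u \<in> verts G \<and> v \<in> verts G \<and> joined G (edges G) u v}"

text \<open>
  The first Betti number. The natural-number subtraction does not truncate, as every finite graph
  has at most (number of edges) + (number of components) vertices.
\<close>

definition loops :: "('d::finite) fgraph \<Rightarrow> nat" where
  "loops G = card (edges G) + card (components G) - card (verts G)"

definition momentum_into :: "('d::finite) fgraph \<Rightarrow> nat set \<Rightarrow> real ^ 'd" where
  "momentum_into G A = (\<Sum>i | i \<in> legs G \<and> foot G i \<in> A. mom G i)"

text \<open>
  Genericity of the momenta: apart from the total momentum, which vanishes, no partial sum of
  external momenta is zero.
\<close>

definition feynman_graph :: "('d::finite) fgraph \<Rightarrow> bool" where
  "feynman_graph G \<longleftrightarrow>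
     finite (verts G) \<and> finite (edges G) \<and> finite (legs G) \<and>
     (\<forall>e\<in>edges G. set_uprod (ends G e) \<subseteq> verts G) \<and>
     foot G ` legs G \<subseteq> verts G \<and>
     (\<forall>i\<in>legs G. \<forall>j\<in>legs G. joined G (edges G) (foot G i) (foot G j)) \<and>
     (\<Sum>i\<in>legs G. mom G i) = 0 \<and>
     (\<forall>I. I \<subset> legs G \<and> I \<noteq> {} \<longrightarrow> (\<Sum>i\<in>I. mom G i) \<noteq> 0)"

definition tadpole :: "('d::finite) fgraph \<Rightarrow> nat \<Rightarrow> bool" where
  "tadpole G e \<longleftrightarrow> (\<exists>v. ends G e = Upair v v)"


subsection \<open>Equivalence\<close>

text \<open>
  Vertices and half-edges carry names only for bookkeeping; labelled graphs are considered up to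
  renaming these, with the edge labels kept fixed.
\<close>

definition same_labelled_graph :: "('d::finite) fgraph \<Rightarrow> 'd fgraph \<Rightarrow> bool" where
  "same_labelled_graph G H \<longleftrightarrow>
     edges H = edges G \<and>
     (\<exists>f g. bij_betw f (verts G) (verts H) \<and> bij_betw g (legs G) (legs H) \<and>
        (\<forall>e\<in>edges G. ends H e = map_uprod f (ends G e) \<and> mass H e = mass G e) \<and>
        (\<forall>i\<in>legs G. foot H (g i) = f (foot G i) \<and> mom H (g i) = mom G i))"

definition merge_legs :: "('d::finite) fgraph \<Rightarrow> nat \<Rightarrow> nat set \<Rightarrow> nat \<Rightarrow> 'd fgraph" where
  "merge_legs G v S j = G\<lparr>legs := insert j (legs G - S), foot := (foot G)(j := v),
     mom := (mom G)(j := (\<Sum>i\<in>S. mom G i))\<rparr>"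

definition legs_merged :: "('d::finite) fgraph \<Rightarrow> 'd fgraph \<Rightarrow> bool" where
  "legs_merged G H \<longleftrightarrow>
     (\<exists>v S j. S \<noteq> {} \<and> S \<subseteq> legs G \<and> (\<forall>i\<in>S. foot G i = v) \<and> j \<notin> legs G - S \<and>
        H = merge_legs G v S j)"

definition feynman_equiv :: "('d::finite) fgraph \<Rightarrow> 'd fgraph \<Rightarrow> bool" where
  "feynman_equiv = equivclp (\<lambda>G H. feynman_graph G \<and> feynman_graph H \<and>
     (same_labelled_graph G H \<or> legs_merged G H))"


subsection \<open>Subgraphs, quotients and motic graphs\<close>

definition touched_verts :: "('d::finite) fgraph \<Rightarrow> nat set \<Rightarrow> nat set" where
  "touched_verts G \<gamma> = (\<Union>e\<in>\<gamma>. set_uprod (ends G e))"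

definition mass_momentum_spanning :: "('d::finite) fgraph \<Rightarrow> nat set \<Rightarrow> bool" where
  "mass_momentum_spanning G \<gamma> \<longleftrightarrow>
     \<gamma> \<subseteq> edges G \<and> (\<forall>e\<in>edges G. mass G e \<noteq> 0 \<longrightarrow> e \<in> \<gamma>) \<and>
     foot G ` legs G \<subseteq> touched_verts G \<gamma> \<and>
     (\<forall>i\<in>legs G. \<forall>j\<in>legs G. joined G \<gamma> (foot G i) (foot G j))"

definition subgraph :: "('d::finite) fgraph \<Rightarrow> nat set \<Rightarrow> 'd fgraph" where
  "subgraph G \<gamma> =
     (if mass_momentum_spanning G \<gamma>
      then G\<lparr>verts := touched_verts G \<gamma>, edges := \<gamma>\<rparr>
      else G\<lparr>verts := touched_verts G \<gamma>, edges := \<gamma>, mass := (\<lambda>_. 0), legs := {}\<rparr>)"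

text \<open>The least vertex of a component of \<open>\<gamma>\<close> names the vertex it is contracted to.\<close>

definition rep :: "('d::finite) fgraph \<Rightarrow> nat set \<Rightarrow> nat \<Rightarrow> nat" where
  "rep G \<gamma> v = (LEAST u. joined G \<gamma> v u)"

definition contraction :: "('d::finite) fgraph \<Rightarrow> nat set \<Rightarrow> 'd fgraph" where
  "contraction G \<gamma> = G\<lparr>verts := rep G \<gamma> ` verts G, edges := edges G - \<gamma>,
     ends := (\<lambda>e. map_uprod (rep G \<gamma>) (ends G e)), foot := (\<lambda>i. rep G \<gamma> (foot G i))\<rparr>"

definition motic :: "('d::finite) fgraph \<Rightarrow> bool" where
  "motic G \<longleftrightarrow>
     (\<forall>\<gamma>. \<gamma> \<subset> edges G \<and> mass_momentum_spanning G \<gamma> \<longrightarrow> loops (subgraph G \<gamma>) < loops G)"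

definition motic_feynman_graph :: "('d::finite) fgraph \<Rightarrow> bool" where
  "motic_feynman_graph G \<longleftrightarrow> feynman_graph G \<and> motic G"

definition motic_subgraph :: "('d::finite) fgraph \<Rightarrow> nat set \<Rightarrow> bool" where
  "motic_subgraph G \<gamma> \<longleftrightarrow> \<gamma> \<subseteq> edges G \<and> motic (subgraph G \<gamma>)"

definition banana :: "('d::finite) fgraph \<Rightarrow> bool" where
  "banana G \<longleftrightarrow> card (verts G) = 2 \<and> card (components G) = 1 \<and> (\<forall>e\<in>edges G. \<not> tadpole G e)"


section \<open>Polynomials in the edge variables\<close>

type_synonym 'k epoly = "(nat \<Rightarrow>\<^sub>0 nat) \<Rightarrow>\<^sub>0 'k"

definition evar :: "nat \<Rightarrow> 'k::comm_ring_1 epoly" where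
  "evar e = Poly_Mapping.single (Poly_Mapping.single e 1) 1"

definition const :: "real \<Rightarrow> 'k::real_field epoly" where
  "const c = Poly_Mapping.single 0 (of_real c)"

text \<open>The exponent vector of the product of the variables in \<open>A\<close>.\<close>

definition product_monomial :: "nat set \<Rightarrow> (nat \<Rightarrow>\<^sub>0 nat)" where
  "product_monomial A = (\<Sum>e\<in>A. Poly_Mapping.single e 1)"

definition degree_in :: "nat set \<Rightarrow> (nat \<Rightarrow>\<^sub>0 nat) \<Rightarrow> nat" where
  "degree_in A m = (\<Sum>e\<in>A. Poly_Mapping.lookup m e)"

definition homogeneous_in :: "nat set \<Rightarrow> nat \<Rightarrow> 'k::comm_ring_1 epoly \<Rightarrow> bool" where
  "homogeneous_in A d p \<longleftrightarrow>
     (\<forall>m\<in>Poly_Mapping.keys p. Poly_Mapping.keys m \<subseteq> A \<and> degree_in A m = d)"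

text \<open>Substitution of 0 for the variable \<open>e\<close> keeps exactly the monomials not involving \<open>e\<close>.\<close>

definition set_zero :: "nat \<Rightarrow> 'k::comm_ring_1 epoly \<Rightarrow> 'k epoly" where
  "set_zero e = Poly_Mapping.mapp (\<lambda>m c. if Poly_Mapping.lookup m e = 0 then c else 0)"

text \<open>
  The relation \<open>A \<equiv>\<^sub>\<gamma> B\<close>. The degree \<open>d\<close> of the factor attached to \<open>\<gamma>\<close> is passed explicitly: that
  factor may be the zero polynomial, which counts with its nominal degree as a homogeneous form.
\<close>

definition agree_to_degree :: "nat set \<Rightarrow> nat \<Rightarrow> 'k::comm_ring_1 epoly \<Rightarrow> 'k epoly \<Rightarrow> bool" where
  "agree_to_degree \<gamma> d A B \<longleftrightarrow> (\<forall>m\<in>Poly_Mapping.keys (A - B). d < degree_in \<gamma> m)"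


section \<open>Symanzik polynomials\<close>

text \<open>
  Edge sets of spanning forests with \<open>k\<close> components: all vertices of the graph are kept, and the
  absence of cycles is expressed by the loop number being 0.
\<close>

definition spanning_forests :: "nat \<Rightarrow> ('d::finite) fgraph \<Rightarrow> nat set set" where
  "spanning_forests k G =
     {F. F \<subseteq> edges G \<and> loops (G\<lparr>edges := F\<rparr>) = 0 \<and> card (components (G\<lparr>edges := F\<rparr>)) = k}"

definition component_graph :: "('d::finite) fgraph \<Rightarrow> nat set \<Rightarrow> 'd fgraph" where
  "component_graph G K = G\<lparr>verts := K, edges := {e \<in> edges G. set_uprod (ends G e) \<subseteq> K},
     legs := {i \<in> legs G. foot G i \<in> K}\<rparr>"

definition Psi_connected :: "('d::finite) fgraph \<Rightarrow> 'k::real_field epoly" where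
  "Psi_connected G = (\<Sum>T\<in>spanning_forests 1 G. \<Prod>e\<in>edges G - T. evar e)"

text \<open>
  The two trees of a 2-forest receive opposite momenta, so it does not matter which one is chosen.
\<close>

definition forest_momentum :: "('d::finite) fgraph \<Rightarrow> nat set \<Rightarrow> real ^ 'd" where
  "forest_momentum G F = momentum_into G (SOME T. T \<in> components (G\<lparr>edges := F\<rparr>))"

definition Phi_connected :: "('d::finite) fgraph \<Rightarrow> 'k::real_field epoly" where
  "Phi_connected G = (\<Sum>F\<in>spanning_forests 2 G.
     const (forest_momentum G F \<bullet> forest_momentum G F) * (\<Prod>e\<in>edges G - F. evar e))"

definition Psi :: "('d::finite) fgraph \<Rightarrow> 'k::real_field epoly" where
  "Psi G = (\<Prod>K\<in>components G. Psi_connected (component_graph G K))"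

definition leg_component :: "('d::finite) fgraph \<Rightarrow> nat set" where
  "leg_component G = (THE K. K \<in> components G \<and> foot G ` legs G \<subseteq> K)"

text \<open>Without external half-edges all momenta vanish, whichever component plays the role of \<open>G\<^sub>0\<close>.\<close>

definition Phi :: "('d::finite) fgraph \<Rightarrow> 'k::real_field epoly" where
  "Phi G = (if legs G = {} then 0
     else Phi_connected (component_graph G (leg_component G)) *
       (\<Prod>K\<in>components G - {leg_component G}. Psi_connected (component_graph G K)))"

definition Xi :: "('d::finite) fgraph \<Rightarrow> 'k::real_field epoly" where
  "Xi G = Phi G + (\<Sum>e\<in>edges G. const ((mass G e)\<^sup>2) * evar e) * Psi G"

end

theory Submission
  imports Defs
begin

text \<open>
  The spanning forest formulas commute with contraction, so by induction on the number of edges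
  \<open>P\<^sub>G - \<Psi>\<^sub>G\<close> and \<open>C\<^sub>G - \<Xi>\<^sub>G\<close> vanish whenever one variable is set to 0: each of their monomials
  contains every edge variable. As the degrees are \<open>h\<^sub>G\<close> and \<open>h\<^sub>G + 1\<close>, a nonzero difference forces all
  edges of \<open>G\<close> to be tadpoles, or, for \<open>C\<^sub>G\<close>, all but one of the components to be single vertices with
  tadpoles and the remaining one to be a banana with tadpoles. Tadpoles are split off by
  factorisation. In a banana one factors out the massive edges (or a single edge if there are none)
  and is left with the initial conditions; only the case of external half-edges detached from the
  banana needs a detour through a larger graph.
\<close>

section \<open>Connectivity\<close>

text \<open>A factorisation over \<gamma> fixes the coefficient of a monomial only up to the nominal
  degree in the edges of \<gamma>, and a monomial containing every variable has degree at least
  |\<gamma>| there. It therefore says something about such a monomial only if |\<gamma>| is at most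
  the loop number of \<gamma> (tadpoles), or, for C and m.m. \<gamma>, at most the loop number plus
  one. Half-edges away from the banana are the hard case because no m.m. subgraph exists then. The
  larger graph used there has one coefficient that can be read in two ways: factorisation turns it
  into the unknown one, edge contraction into one that is already settled. Two choices keep
  contraction manageable. Components are counted on a fixed vertex set, so that subgraphs and
  quotients satisfy plain numerical identities. The momentum of a 2-forest is rewritten without
  choosing one of its trees, since such a choice is not stable under contraction.\<close>

definition wf_graph :: "('d::finite) fgraph \<Rightarrow> bool" where
  "wf_graph G \<longleftrightarrow> finite (verts G) \<and> finite (edges G) \<and>
     (\<forall>e\<in>edges G. set_uprod (ends G e) \<subseteq> verts G)"

text \<open>The number of components of the spanning subgraph with edge set F, each counted by its
  least vertex. Keeping all of \<open>verts G\<close> for every F lets forests, subgraphs and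
  quotients be compared through one function.\<close>

definition ncomp :: "('d::finite) fgraph \<Rightarrow> nat set \<Rightarrow> nat" where
  "ncomp G F = card (rep G F ` verts G)"

lemma feynman_imp_wf: "feynman_graph G \<Longrightarrow> wf_graph G"
  by (auto simp: feynman_graph_def wf_graph_def)

lemma feynmanD:
  assumes "feynman_graph G"
  shows "finite (legs G)" "foot G ` legs G \<subseteq> verts G"
    "i \<in> legs G \<Longrightarrow> j \<in> legs G \<Longrightarrow> joined G (edges G) (foot G i) (foot G j)"
    "(\<Sum>i\<in>legs G. mom G i) = 0"
    "I \<subset> legs G \<Longrightarrow> I \<noteq> {} \<Longrightarrow> (\<Sum>i\<in>I. mom G i) \<noteq> 0"
proof -
  note * = conjunct2[OF conjunct2[OF assms[unfolded feynman_graph_def]]]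
  show "finite (legs G)" using * by (rule conjunct1)
  note * = conjunct2[OF conjunct2[OF *]]
  show "foot G ` legs G \<subseteq> verts G" using * by (rule conjunct1)
  note * = conjunct2[OF *]
  show "i \<in> legs G \<Longrightarrow> j \<in> legs G \<Longrightarrow> joined G (edges G) (foot G i) (foot G j)"
    using conjunct1[OF *] by fast
  note * = conjunct2[OF *]
  show "(\<Sum>i\<in>legs G. mom G i) = 0" using * by (rule conjunct1)
  show "I \<subset> legs G \<Longrightarrow> I \<noteq> {} \<Longrightarrow> (\<Sum>i\<in>I. mom G i) \<noteq> 0"
    by (rule conjunct2[OF *, rule_format], rule conjI)
qed

lemma feynmanI:
  assumes "wf_graph G" "finite (legs G)" "foot G ` legs G \<subseteq> verts G"
    "\<And>i j. i \<in> legs G \<Longrightarrow> j \<in> legs G \<Longrightarrow> joined G (edges G) (foot G i) (foot G j)"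
    "(\<Sum>i\<in>legs G. mom G i) = 0"
    "\<And>I. I \<subset> legs G \<Longrightarrow> I \<noteq> {} \<Longrightarrow> (\<Sum>i\<in>I. mom G i) \<noteq> 0"
  shows "feynman_graph G"
  unfolding feynman_graph_def
proof (intro conjI allI impI ballI)
  show "(\<Sum>i\<in>I. mom G i) \<noteq> 0" if "I \<subset> legs G \<and> I \<noteq> {}" for I
    using assms(6) that by blast
qed (use assms(1) in \<open>simp_all add: wf_graph_def assms(2-5)\<close>)

lemma motic_feynman_wf: "motic_feynman_graph G \<Longrightarrow> wf_graph G"
  by (simp add: motic_feynman_graph_def feynman_imp_wf)

lemma wf_endsE:
  assumes "wf_graph G" "e \<in> edges G"
  obtains x y where "ends G e = Upair x y" "x \<in> verts G" "y \<in> verts G"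
proof -
  obtain x y where xy: "ends G e = Upair x y" by (cases "ends G e") auto
  then show ?thesis using assms that[of x y] by (auto simp: wf_graph_def)
qed

lemma joined_cong:
  assumes "\<And>e. e \<in> F \<Longrightarrow> ends G e = ends H e"
  shows "joined G F = joined H F"
proof -
  have "adj G F = adj H F" using assms by (auto simp: adj_def)
  then show ?thesis by (simp add: joined_def fun_eq_iff)
qed

lemma joined_refl [simp, intro]: "joined G F x x"
  by (simp add: joined_def)

lemma joined_sym: "joined G F x y \<Longrightarrow> joined G F y x"
proof -
  have "ends G e = Upair x y \<Longrightarrow> ends G e = Upair y x" for e x y by simp
  then have "sym (adj G F)" unfolding adj_def sym_def by blast
  then have "sym ((adj G F)\<^sup>*)" by (rule sym_rtrancl)
  then show "joined G F x y \<Longrightarrow> joined G F y x" by (auto simp: joined_def sym_def)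
qed

lemma joined_trans [trans]: "joined G F x y \<Longrightarrow> joined G F y z \<Longrightarrow> joined G F x z"
  by (auto simp: joined_def)

lemma joined_edge: "e \<in> F \<Longrightarrow> ends G e = Upair x y \<Longrightarrow> joined G F x y"
  by (auto simp: joined_def adj_def)

lemma joined_mono: "F \<subseteq> F' \<Longrightarrow> joined G F x y \<Longrightarrow> joined G F' x y"
proof -
  assume "F \<subseteq> F'"
  then have "adj G F \<subseteq> adj G F'" by (auto simp: adj_def)
  then have "(adj G F)\<^sup>* \<subseteq> (adj G F')\<^sup>*" by (rule rtrancl_mono)
  then show "joined G F x y \<Longrightarrow> joined G F' x y" by (auto simp: joined_def)
qed

lemma joined_invariant:
  assumes "joined G F x y" "P x"
    and "\<And>e a b. e \<in> F \<Longrightarrow> ends G e = Upair a b \<Longrightarrow> P a \<Longrightarrow> P b"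
  shows "P y"
  using assms(1) unfolding joined_def
proof (induction rule: rtrancl_induct)
  case base
  then show ?case by (rule assms(2))
next
  case (step y z)
  then show ?case using assms(3) unfolding adj_def by blast
qed

lemma joined_touched:
  assumes "joined G F x y" "x \<noteq> y"
  shows "x \<in> touched_verts G F" "y \<in> touched_verts G F"
proof -
  have *: "b \<in> touched_verts G F" if "joined G F a b" "a \<noteq> b" for a b
  proof -
    have "b = a \<or> b \<in> touched_verts G F"
      using that(1) by (rule joined_invariant) (force simp: touched_verts_def)+
    then show ?thesis using that(2) by auto
  qed
  show "x \<in> touched_verts G F" using *[of y x] assms joined_sym by blast
  show "y \<in> touched_verts G F" using *[of x y] assms by blast
qed

lemma touched_verts_subset: "wf_graph G \<Longrightarrow> F \<subseteq> edges G \<Longrightarrow> touched_verts G F \<subseteq> verts G"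
  by (auto simp: touched_verts_def wf_graph_def)

lemma joined_verts:
  assumes "wf_graph G" "F \<subseteq> edges G" "joined G F x y" "x \<in> verts G"
  shows "y \<in> verts G"
  using joined_touched(2)[OF assms(3)] touched_verts_subset[OF assms(1,2)] assms(4) by blast

lemma joined_rep: "joined G F x (rep G F x)"
  unfolding rep_def by (rule LeastI[of _ x]) simp

lemma rep_eq_iff: "rep G F x = rep G F y \<longleftrightarrow> joined G F x y"
proof
  assume "rep G F x = rep G F y"
  then have "joined G F x (rep G F y)" using joined_rep[of G F x] by simp
  then show "joined G F x y" by (rule joined_trans) (rule joined_sym[OF joined_rep])
next
  assume "joined G F x y"
  then have "joined G F x = joined G F y" 
    using joined_trans joined_sym by (intro ext) blast
  then show "rep G F x = rep G F y" by (simp add: rep_def)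
qed

lemma rep_le: "joined G F x y \<Longrightarrow> rep G F x \<le> y"
  unfolding rep_def by (rule Least_le)

lemma rep_eqI: "joined G F x y \<Longrightarrow> (\<And>z. joined G F x z \<Longrightarrow> y \<le> z) \<Longrightarrow> rep G F x = y"
  unfolding rep_def by (rule Least_equality)

lemma rep_verts: "wf_graph G \<Longrightarrow> F \<subseteq> edges G \<Longrightarrow> x \<in> verts G \<Longrightarrow> rep G F x \<in> verts G"
  by (rule joined_verts[OF _ _ joined_rep])

lemma rep_cong:
  assumes "\<And>e. e \<in> F \<Longrightarrow> ends G e = ends H e"
  shows "rep G F = rep H F"
  using joined_cong[OF assms] by (simp add: rep_def fun_eq_iff)

lemma card_image_same_kernel:
  assumes "\<And>x y. x \<in> A \<Longrightarrow> y \<in> A \<Longrightarrow> f x = f y \<longleftrightarrow> g x = g y"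
  shows "card (f ` A) = card (g ` A)"
proof (rule bij_betw_same_card)
  show "bij_betw (\<lambda>z. g (SOME x. x \<in> A \<and> f x = z)) (f ` A) (g ` A)"
  proof (rule bij_betwI'[where X = "f ` A" and Y = "g ` A"])
    have s: "(SOME x. x \<in> A \<and> f x = f y) \<in> A \<and> f (SOME x. x \<in> A \<and> f x = f y) = f y"
      if "y \<in> A" for y by (rule someI[of _ y]) (simp add: that)
    have t: "g (SOME x. x \<in> A \<and> f x = f y) = g y" if "y \<in> A" for y
      using s[OF that] assms that by blast
    show "(g (SOME x. x \<in> A \<and> f x = u) = g (SOME x. x \<in> A \<and> f x = v)) = (u = v)"
      if "u \<in> f ` A" "v \<in> f ` A" for u v using that t assms by auto
    show "g (SOME x. x \<in> A \<and> f x = u) \<in> g ` A" if "u \<in> f ` A" for u using that t by auto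
    show "\<exists>x\<in>f ` A. v = g (SOME z. z \<in> A \<and> f z = x)" if "v \<in> g ` A" for v using that t by auto
  qed
qed

text \<open>Links the quotient set that defines \<open>components\<close> to an image, so that
  \<open>rep\<close> can serve as f and components are counted by \<open>ncomp\<close>.\<close>

lemma card_quotient_kernel:
  assumes "\<And>x y. x \<in> A \<Longrightarrow> y \<in> A \<Longrightarrow> R x y \<longleftrightarrow> f x = f y"
  shows "card (A // {(x, y). x \<in> A \<and> y \<in> A \<and> R x y}) = card (f ` A)"
proof -
  have "A // {(x, y). x \<in> A \<and> y \<in> A \<and> R x y} = (\<lambda>x. {y \<in> A. R x y}) ` A"
    unfolding quotient_def by auto
  also have "card \<dots> = card (f ` A)"
  proof (rule card_image_same_kernel)
    fix x y assume "x \<in> A" "y \<in> A"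
    then have "R y y" "\<And>z. z \<in> A \<Longrightarrow> R x z \<longleftrightarrow> f x = f z" "\<And>z. z \<in> A \<Longrightarrow> R y z \<longleftrightarrow> f y = f z"
      using assms by auto
    then show "{z \<in> A. R x z} = {z \<in> A. R y z} \<longleftrightarrow> f x = f y"
      using \<open>y \<in> A\<close> unfolding set_eq_iff mem_Collect_eq by metis
  qed
  finally show ?thesis .
qed

lemma card_components: "card (components (G\<lparr>edges := F\<rparr>)) = ncomp G F"
proof -
  have "joined (G\<lparr>edges := F\<rparr>) = joined G"
    by (intro ext) (simp add: joined_cong[of _ "G\<lparr>edges := F\<rparr>" G])
  then show ?thesis
    unfolding components_def ncomp_def
    by (simp add: card_quotient_kernel[where f = "rep G F"] rep_eq_iff)
qed

lemma card_components_full: "card (components G) = ncomp G (edges G)"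
  using card_components[where G = G and F = "edges G"] by simp

lemma loops_eq: "loops G = card (edges G) + ncomp G (edges G) - card (verts G)"
  by (simp add: loops_def card_components_full)

lemma loops_restrict: "loops (G\<lparr>edges := F\<rparr>) = card F + ncomp G F - card (verts G)"
  by (simp add: loops_def card_components)

lemma ncomp_cong:
  assumes "verts G = verts H" "\<And>e. e \<in> F \<Longrightarrow> ends G e = ends H e"
  shows "ncomp G F = ncomp H F"
  using rep_cong[of F G H] assms by (simp add: ncomp_def)

lemma rep_empty [simp]: "rep G {} x = x"
  by (rule rep_eqI) (auto simp: joined_def adj_def)

lemma joined_empty [simp]: "joined G {} x y \<longleftrightarrow> x = y"
  by (auto simp: joined_def adj_def)

lemma ncomp_empty [simp]: "ncomp G {} = card (verts G)"
  by (simp add: ncomp_def)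

text \<open>\<open>rep G F'\<close> factors through \<open>rep G F\<close>, so its image cannot be
  larger.\<close>

lemma ncomp_antimono:
  assumes "wf_graph G" "F \<subseteq> F'"
  shows "ncomp G F' \<le> ncomp G F"
proof -
  have eq: "rep G F' (rep G F x) = rep G F' x" for x
    unfolding rep_eq_iff by (rule joined_sym[OF joined_mono[OF assms(2) joined_rep]])
  have "rep G F' ` verts G = rep G F' ` rep G F ` verts G"
    by (auto simp: image_image eq)
  then show ?thesis unfolding ncomp_def
    using assms(1) by (metis card_image_le finite_imageI wf_graph_def)
qed


subsection \<open>Contraction\<close>

lemma contraction_simps [simp]:
  "verts (contraction G \<gamma>) = rep G \<gamma> ` verts G"
  "edges (contraction G \<gamma>) = edges G - \<gamma>"
  "ends (contraction G \<gamma>) e = map_uprod (rep G \<gamma>) (ends G e)"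
  "mass (contraction G \<gamma>) = mass G"
  "legs (contraction G \<gamma>) = legs G"
  "foot (contraction G \<gamma>) i = rep G \<gamma> (foot G i)"
  "mom (contraction G \<gamma>) = mom G"
  by (simp_all add: contraction_def)

text \<open>A path of the quotient lifts edge by edge; where two consecutive lifted edges do not
  meet, their ends are joined inside \<gamma>. The end b is a priori any number, hence the
  existential quantifier.\<close>

lemma joined_contraction_imp:
  assumes "joined (contraction G \<gamma>) F (rep G \<gamma> x) b"
  shows "\<exists>y. b = rep G \<gamma> y \<and> joined G (F \<union> \<gamma>) x y"
  using assms
proof (rule joined_invariant)
  show "\<exists>y. rep G \<gamma> x = rep G \<gamma> y \<and> joined G (F \<union> \<gamma>) x y" by blast
next
  fix e a b
  assume e: "e \<in> F" "ends (contraction G \<gamma>) e = Upair a b"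
    and "\<exists>y. a = rep G \<gamma> y \<and> joined G (F \<union> \<gamma>) x y"
  then obtain y where y: "a = rep G \<gamma> y" "joined G (F \<union> \<gamma>) x y" by blast
  obtain p q where pq: "ends G e = Upair p q" by (cases "ends G e") auto
  have j: "joined G (F \<union> \<gamma>) p q" using joined_edge[of e "F \<union> \<gamma>"] e pq by blast
  have lift: "joined G (F \<union> \<gamma>) y z" if "rep G \<gamma> y = rep G \<gamma> z" for z
    using that joined_mono[of \<gamma> "F \<union> \<gamma>"] by (auto simp: rep_eq_iff)
  from e pq y consider "rep G \<gamma> y = rep G \<gamma> p" "b = rep G \<gamma> q"
    | "rep G \<gamma> y = rep G \<gamma> q" "b = rep G \<gamma> p"
    by auto
  then show "\<exists>y. b = rep G \<gamma> y \<and> joined G (F \<union> \<gamma>) x y"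
  proof cases
    case 1
    then have "joined G (F \<union> \<gamma>) x q" using joined_trans[OF y(2) joined_trans[OF lift j]] by simp
    with 1 show ?thesis by blast
  next
    case 2
    then have "joined G (F \<union> \<gamma>) x p"
      using joined_trans[OF y(2) joined_trans[OF lift joined_sym[OF j]]] by simp
    with 2 show ?thesis by blast
  qed
qed

lemma joined_contraction:
  "joined (contraction G \<gamma>) F (rep G \<gamma> x) (rep G \<gamma> y) \<longleftrightarrow> joined G (F \<union> \<gamma>) x y"
proof
  assume "joined (contraction G \<gamma>) F (rep G \<gamma> x) (rep G \<gamma> y)"
  then obtain z where z: "rep G \<gamma> y = rep G \<gamma> z" "joined G (F \<union> \<gamma>) x z"
    using joined_contraction_imp by blast
  have "joined G \<gamma> z y" using z(1) rep_eq_iff by metis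
  then show "joined G (F \<union> \<gamma>) x y" by (rule joined_trans[OF z(2) joined_mono[OF sup_ge2]])
next
  assume "joined G (F \<union> \<gamma>) x y"
  then show "joined (contraction G \<gamma>) F (rep G \<gamma> x) (rep G \<gamma> y)"
  proof (rule joined_invariant[where P = "\<lambda>a. joined (contraction G \<gamma>) F (rep G \<gamma> x) (rep G \<gamma> a)"])
    fix e a b
    assume e: "e \<in> F \<union> \<gamma>" "ends G e = Upair a b"
      and a: "joined (contraction G \<gamma>) F (rep G \<gamma> x) (rep G \<gamma> a)"
    have "joined (contraction G \<gamma>) F (rep G \<gamma> a) (rep G \<gamma> b)"
    proof (cases "e \<in> \<gamma>")
      case True
      then have "rep G \<gamma> a = rep G \<gamma> b" using e joined_edge by (metis rep_eq_iff)
      then show ?thesis by simp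
    next
      case False
      then show ?thesis using e by (intro joined_edge[of e]) auto
    qed
    with a show "joined (contraction G \<gamma>) F (rep G \<gamma> x) (rep G \<gamma> b)" by (rule joined_trans)
  qed simp
qed

text \<open>The least vertex of a component of F \<union> \<gamma> is also the least vertex of its
  own \<gamma>-component. Naming contracted vertices by least elements thus makes names in a
  quotient literally equal to those obtained by contracting the union, not merely
  isomorphic.\<close>

lemma rep_contraction: "rep (contraction G \<gamma>) F (rep G \<gamma> x) = rep G (F \<union> \<gamma>) x"
proof (rule rep_eqI)
  have "rep G \<gamma> (rep G (F \<union> \<gamma>) x) \<le> rep G (F \<union> \<gamma>) x" by (simp add: rep_le)
  moreover have "joined G (F \<union> \<gamma>) x (rep G \<gamma> (rep G (F \<union> \<gamma>) x))"
    by (rule joined_trans[OF joined_rep joined_mono[OF sup_ge2 joined_rep]])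
  then have "rep G (F \<union> \<gamma>) x \<le> rep G \<gamma> (rep G (F \<union> \<gamma>) x)" by (rule rep_le)
  ultimately have "rep G (F \<union> \<gamma>) x = rep G \<gamma> (rep G (F \<union> \<gamma>) x)" by simp
  then show "joined (contraction G \<gamma>) F (rep G \<gamma> x) (rep G (F \<union> \<gamma>) x)"
    using joined_contraction[of G \<gamma> F x "rep G (F \<union> \<gamma>) x"] joined_rep by simp
next
  fix z assume "joined (contraction G \<gamma>) F (rep G \<gamma> x) z"
  then obtain y where y: "z = rep G \<gamma> y" "joined G (F \<union> \<gamma>) x y"
    using joined_contraction_imp by blast
  have "joined G (F \<union> \<gamma>) x z"
    unfolding y(1) by (rule joined_trans[OF y(2) joined_mono[OF sup_ge2 joined_rep]])
  then show "rep G (F \<union> \<gamma>) x \<le> z" by (rule rep_le)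
qed

lemma ncomp_contraction: "ncomp (contraction G \<gamma>) F = ncomp G (F \<union> \<gamma>)"
  by (simp add: ncomp_def image_image rep_contraction)

lemma card_verts_contraction: "card (verts (contraction G \<gamma>)) = ncomp G \<gamma>"
  by (simp add: ncomp_def)

lemma touched_contraction:
  "touched_verts (contraction G \<gamma>) F = rep G \<gamma> ` touched_verts G F"
proof -
  have "set_uprod (map_uprod f p) = f ` set_uprod p" for f :: "nat \<Rightarrow> nat" and p
    by (cases p) auto
  then show ?thesis by (auto simp: touched_verts_def)
qed

lemma wf_contraction: "wf_graph G \<Longrightarrow> wf_graph (contraction G \<gamma>)"
proof -
  have "set_uprod (map_uprod f p) = f ` set_uprod p" for f :: "nat \<Rightarrow> nat" and p
    by (cases p) auto
  then show "wf_graph G \<Longrightarrow> wf_graph (contraction G \<gamma>)"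
    unfolding wf_graph_def contraction_simps by (metis Diff_iff finite_Diff finite_imageI image_mono)
qed

lemma rep_single:
  assumes "ends G e = Upair a b"
  shows "rep G {e} x = (if x = a \<or> x = b then min a b else x)"
proof -
  have j: "joined G {e} x z \<longleftrightarrow> x = z \<or> (x \<in> {a, b} \<and> z \<in> {a, b})" for z
  proof
    assume "joined G {e} x z"
    then show "x = z \<or> (x \<in> {a, b} \<and> z \<in> {a, b})"
      by (rule joined_invariant) (use assms in auto)
  next
    have "joined G {e} a b" using joined_edge assms by blast
    then show "x = z \<or> (x \<in> {a, b} \<and> z \<in> {a, b}) \<Longrightarrow> joined G {e} x z"
      using joined_sym by auto
  qed
  show ?thesis by (rule rep_eqI) (auto simp: j)
qed

lemma ncomp_single:
  assumes "wf_graph G" "e \<in> edges G"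
  shows "ncomp G {e} = (if tadpole G e then card (verts G) else card (verts G) - 1)"
proof -
  obtain a b where ab: "ends G e = Upair a b" "a \<in> verts G" "b \<in> verts G"
    using assms by (rule wf_endsE)
  \<comment> \<open>The larger end point takes the name of the smaller one and is the only vertex
    lost.\<close>
  have "rep G {e} ` verts G = (if a = b then verts G else verts G - {max a b})"
  proof (cases "a = b")
    case True
    then have "rep G {e} = (\<lambda>x. x)" by (intro ext) (simp add: rep_single[OF ab(1)])
    then show ?thesis using True by simp
  next
    case False
    have "max a b \<notin> rep G {e} ` verts G" using False by (auto simp: rep_single[OF ab(1)] min_def max_def)
    moreover have "rep G {e} ` verts G \<subseteq> verts G" using ab by (auto simp: rep_single[OF ab(1)] min_def)
    moreover have "x \<in> rep G {e} ` verts G" if "x \<in> verts G" "x \<noteq> max a b" for x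
    proof (rule image_eqI)
      show "x = rep G {e} x" using that False by (auto simp: rep_single[OF ab(1)] min_def max_def)
    qed fact
    ultimately have "rep G {e} ` verts G = verts G - {max a b}" by blast
    then show ?thesis using False by simp
  qed
  moreover have "max a b \<in> verts G" using ab by (simp add: max_def)
  moreover have "tadpole G e \<longleftrightarrow> a = b" using ab by (auto simp: tadpole_def)
  ultimately show ?thesis
    using assms by (auto simp: ncomp_def wf_graph_def)
qed

lemma tadpole_contraction:
  assumes "ends G e = Upair a b"
  shows "tadpole (contraction G F) e \<longleftrightarrow> joined G F a b"
  using assms by (auto simp: tadpole_def rep_eq_iff[symmetric])

text \<open>Adding e to F is contracting the single edge e in G/F, where e is a tadpole exactly if F
  already joins its ends.\<close>

lemma ncomp_insert:
  assumes "wf_graph G" "F \<subseteq> edges G" "e \<in> edges G - F" "ends G e = Upair a b"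
  shows "ncomp G F = ncomp G (insert e F) + (if joined G F a b then 0 else 1)"
proof -
  have "ncomp G (insert e F) = ncomp (contraction G F) {e}"
    by (simp add: ncomp_contraction insert_commute)
  also have "\<dots> = (if joined G F a b then ncomp G F else ncomp G F - 1)"
    using ncomp_single[OF wf_contraction[OF assms(1)], of e F] assms
    by (simp add: tadpole_contraction[OF assms(4)] card_verts_contraction del: contraction_simps(1))
  finally have *: "ncomp G (insert e F) = (if joined G F a b then ncomp G F else ncomp G F - 1)" .
  \<comment> \<open>\<open>ncomp G F\<close> is positive, so the subtraction of 1 does not
    truncate.\<close>
  have "a \<in> verts G" using assms by (auto simp: wf_graph_def)
  then have "ncomp G F \<noteq> 0" using assms(1) by (auto simp: ncomp_def wf_graph_def)
  then show ?thesis using * by auto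
qed

lemma ncomp_insert_le:
  assumes "wf_graph G" "F \<subseteq> edges G" "e \<in> edges G"
  shows "ncomp G F \<le> ncomp G (insert e F) + 1"
proof (cases "e \<in> F")
  case True
  then show ?thesis by (simp add: insert_absorb)
next
  case False
  obtain a b where "ends G e = Upair a b" by (cases "ends G e") auto
  then show ?thesis using ncomp_insert[OF assms(1,2), of e a b] assms(3) False by auto
qed

text \<open>An additional edge merges at most two components. Up to the constant
  \<open>card (verts G)\<close> the quantity compared is the loop number of the spanning subgraph
  F.\<close>

lemma corank_mono:
  assumes "wf_graph G" "F \<subseteq> F'" "F' \<subseteq> edges G"
  shows "card F + ncomp G F \<le> card F' + ncomp G F'"
proof -
  have fin: "finite F'" using assms finite_subset by (auto simp: wf_graph_def)
  have "D \<subseteq> edges G - F \<Longrightarrow> card F + ncomp G F \<le> card (F \<union> D) + ncomp G (F \<union> D)"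
    if "finite D" for D
    using that
  proof (induction D rule: finite_induct)
    case (insert e D)
    have fin': "finite (F \<union> D)" using insert fin assms finite_subset by blast
    have "ncomp G (F \<union> D) \<le> ncomp G (insert e (F \<union> D)) + 1"
      using insert.prems assms by (intro ncomp_insert_le) auto
    moreover have "card (insert e (F \<union> D)) = card (F \<union> D) + 1"
      using insert fin' by auto
    ultimately show ?case using insert by simp
  qed simp
  from this[of "F' - F"] show ?thesis
    using assms fin by (simp add: Un_absorb1 Diff_mono)
qed

text \<open>Monotonicity starting from the empty edge set. It ensures that the natural-number
  subtraction in \<open>loops\<close> loses nothing.\<close>

lemma card_verts_le:
  "wf_graph G \<Longrightarrow> F \<subseteq> edges G \<Longrightarrow> card (verts G) \<le> card F + ncomp G F"
  using corank_mono[of G "{}" F] by simp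

lemma ncomp_le_card_verts: "wf_graph G \<Longrightarrow> ncomp G F \<le> card (verts G)"
  using ncomp_antimono[of G "{}" F] by simp

subsection \<open>Subgraphs\<close>

lemma subgraph_simps [simp]:
  "verts (subgraph G \<gamma>) = touched_verts G \<gamma>"
  "edges (subgraph G \<gamma>) = \<gamma>"
  "ends (subgraph G \<gamma>) = ends G"
  "foot (subgraph G \<gamma>) = foot G"
  "mom (subgraph G \<gamma>) = mom G"
  by (simp_all add: subgraph_def)

lemma subgraph_mm [simp]:
  "mass_momentum_spanning G \<gamma> \<Longrightarrow> mass (subgraph G \<gamma>) = mass G"
  "mass_momentum_spanning G \<gamma> \<Longrightarrow> legs (subgraph G \<gamma>) = legs G"
  "\<not> mass_momentum_spanning G \<gamma> \<Longrightarrow> mass (subgraph G \<gamma>) = (\<lambda>_. 0)"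
  "\<not> mass_momentum_spanning G \<gamma> \<Longrightarrow> legs (subgraph G \<gamma>) = {}"
  by (simp_all add: subgraph_def)

lemma joined_subgraph [simp]: "joined (subgraph G \<gamma>) = joined G"
  by (intro ext) (simp add: joined_cong[of _ "subgraph G \<gamma>" G])

lemma rep_subgraph [simp]: "rep (subgraph G \<gamma>) = rep G"
  by (intro ext) (simp add: rep_cong[of _ "subgraph G \<gamma>" G])

lemma touched_subgraph [simp]: "touched_verts (subgraph G \<gamma>) = touched_verts G"
  by (intro ext) (simp add: touched_verts_def)

lemma wf_subgraph: "wf_graph G \<Longrightarrow> \<gamma> \<subseteq> edges G \<Longrightarrow> wf_graph (subgraph G \<gamma>)"
  using touched_verts_subset[of G \<gamma>] finite_subset
  by (auto simp: wf_graph_def touched_verts_def)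

text \<open>Vertices not met by \<gamma> are components of their own for every F \<subseteq>
  \<gamma>; they make up the whole difference between the two counts.\<close>

lemma ncomp_subgraph:
  assumes "wf_graph G" "\<gamma> \<subseteq> edges G" "F \<subseteq> \<gamma>"
  shows "ncomp (subgraph G \<gamma>) F + (card (verts G) - card (touched_verts G \<gamma>)) = ncomp G F"
proof -
  let ?T = "touched_verts G \<gamma>"
  have TV: "?T \<subseteq> verts G" using assms touched_verts_subset by blast
  have fin: "finite (verts G)" using assms by (simp add: wf_graph_def)
  have TF: "touched_verts G F \<subseteq> ?T" using assms(3) by (auto simp: touched_verts_def)
  have outside: "rep G F x = x" if "x \<notin> ?T" for x
  proof (rule rep_eqI)
    show "x \<le> z" if "joined G F x z" for z
      using joined_touched(1)[OF that] TF \<open>x \<notin> ?T\<close> by (cases "x = z") auto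
  qed simp
  have inside: "rep G F x \<in> ?T" if "x \<in> ?T" for x
  proof (cases "x = rep G F x")
    case True
    then show ?thesis using that by metis
  next
    case False
    then show ?thesis using joined_touched(2)[OF joined_rep[of G F x]] TF by blast
  qed
  have "verts G = ?T \<union> (verts G - ?T)" using TV by auto
  then have "rep G F ` verts G = rep G F ` (?T \<union> (verts G - ?T))" by simp
  also have "\<dots> = rep G F ` ?T \<union> rep G F ` (verts G - ?T)" by (rule image_Un)
  also have "rep G F ` (verts G - ?T) = verts G - ?T" using outside by force
  finally have "ncomp G F = card (rep G F ` ?T \<union> (verts G - ?T))" by (simp add: ncomp_def)
  also have "\<dots> = card (rep G F ` ?T) + card (verts G - ?T)"
    by (rule card_Un_disjoint) (use inside fin TV finite_subset in blast)+
  also have "card (verts G - ?T) = card (verts G) - card ?T"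
    by (rule card_Diff_subset) (use fin TV finite_subset in auto)
  finally show ?thesis by (simp add: ncomp_def)
qed

text \<open>An isolated vertex adds one vertex and one component, so the loop number of \<gamma> may
  be computed on all vertices of G.\<close>

lemma loops_subgraph:
  assumes "wf_graph G" "\<gamma> \<subseteq> edges G"
  shows "loops (subgraph G \<gamma>) = card \<gamma> + ncomp G \<gamma> - card (verts G)"
proof -
  have "card (touched_verts G \<gamma>) \<le> card (verts G)"
    using touched_verts_subset[OF assms] assms(1) by (intro card_mono) (auto simp: wf_graph_def)
  then show ?thesis using ncomp_subgraph[OF assms order_refl] by (simp add: loops_eq)
qed

section \<open>Motic graphs, their quotients and their subgraphs\<close>

lemma mm_mono:
  assumes "mass_momentum_spanning G \<delta>" "\<delta> \<subseteq> \<gamma>" "\<gamma> \<subseteq> edges G"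
  shows "mass_momentum_spanning G \<gamma>"
proof -
  have T: "touched_verts G \<delta> \<subseteq> touched_verts G \<gamma>" using assms(2) by (auto simp: touched_verts_def)
  show ?thesis
    unfolding mass_momentum_spanning_def
  proof (intro conjI ballI impI)
    show "foot G ` legs G \<subseteq> touched_verts G \<gamma>"
      using T assms(1) by (auto simp: mass_momentum_spanning_def)
    show "joined G \<gamma> (foot G i) (foot G j)" if "i \<in> legs G" "j \<in> legs G" for i j
      by (rule joined_mono[OF assms(2)]) (use assms(1) that in \<open>simp add: mass_momentum_spanning_def\<close>)
  qed (use assms in \<open>auto simp: mass_momentum_spanning_def\<close>)
qed

text \<open>A strict m.m. subset misses some edge f; the complement of f is then m.m. as well and
  has at least as many loops, so complements of single edges suffice. For these the loop number
  drops exactly if f is not a bridge.\<close>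

lemma motic_iff:
  assumes wf: "wf_graph G"
  shows "motic G \<longleftrightarrow> (\<forall>f\<in>edges G. mass_momentum_spanning G (edges G - {f}) \<longrightarrow>
    ncomp G (edges G - {f}) = ncomp G (edges G))"
proof -
  have fin: "finite (edges G)" using wf by (simp add: wf_graph_def)
  have step: "loops (subgraph G (edges G - {f})) < loops G \<longleftrightarrow> ncomp G (edges G - {f}) = ncomp G (edges G)"
    if f: "f \<in> edges G" for f
  proof -
    have "ncomp G (edges G) \<le> ncomp G (edges G - {f})" using wf by (intro ncomp_antimono) auto
    moreover have "card (edges G) = Suc (card (edges G - {f}))"
      using fin f by (metis card_Suc_Diff1)
    moreover have "card (verts G) \<le> card (edges G - {f}) + ncomp G (edges G - {f})"
      using wf by (intro card_verts_le) auto
    moreover have "ncomp G (edges G - {f}) \<le> ncomp G (insert f (edges G - {f})) + 1"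
      using wf f by (intro ncomp_insert_le) auto
    ultimately show ?thesis
      using loops_subgraph[OF wf, of "edges G - {f}"] f by (auto simp: loops_eq insert_absorb)
  qed
  show ?thesis
  proof
    assume "motic G"
    then show "\<forall>f\<in>edges G. mass_momentum_spanning G (edges G - {f}) \<longrightarrow>
      ncomp G (edges G - {f}) = ncomp G (edges G)"
      using step unfolding motic_def by blast
  next
    assume *: "\<forall>f\<in>edges G. mass_momentum_spanning G (edges G - {f}) \<longrightarrow>
      ncomp G (edges G - {f}) = ncomp G (edges G)"
    show "motic G" unfolding motic_def
    proof (intro allI impI)
      fix \<gamma> assume \<gamma>: "\<gamma> \<subset> edges G \<and> mass_momentum_spanning G \<gamma>"
      then obtain f where f: "f \<in> edges G" "f \<notin> \<gamma>" by auto
      then have sub: "\<gamma> \<subseteq> edges G - {f}" using \<gamma> by auto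
      have "mass_momentum_spanning G (edges G - {f})"
        using mm_mono[OF conjunct2[OF \<gamma>] sub] by auto
      then have "loops (subgraph G (edges G - {f})) < loops G" using step f * by blast
      moreover have "card \<gamma> + ncomp G \<gamma> \<le> card (edges G - {f}) + ncomp G (edges G - {f})"
        by (rule corank_mono[OF wf sub]) auto
      ultimately show "loops (subgraph G \<gamma>) < loops G"
        using loops_subgraph[OF wf, of "edges G - {f}"] loops_subgraph[OF wf, of \<gamma>] \<gamma>
        by (simp add: psubset_imp_subset)
    qed
  qed
qed

lemma mm_contraction:
  assumes "wf_graph G" "\<gamma> \<subseteq> edges G" "mass_momentum_spanning (contraction G \<gamma>) \<delta>"
  shows "mass_momentum_spanning G (\<delta> \<union> \<gamma>)"
  unfolding mass_momentum_spanning_def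
proof (intro conjI ballI impI)
  note mm = assms(3)[unfolded mass_momentum_spanning_def]
  show "\<delta> \<union> \<gamma> \<subseteq> edges G" using conjunct1[OF mm] assms(2) by auto
  show "e \<in> \<delta> \<union> \<gamma>" if "e \<in> edges G" "mass G e \<noteq> 0" for e
    using conjunct1[OF conjunct2[OF mm]] that by auto
  show "foot G ` legs G \<subseteq> touched_verts G (\<delta> \<union> \<gamma>)"
  proof
    fix v assume "v \<in> foot G ` legs G"
    then obtain i where i: "i \<in> legs G" "v = foot G i" by auto
    then have "rep G \<gamma> v \<in> rep G \<gamma> ` touched_verts G \<delta>"
      using conjunct1[OF conjunct2[OF conjunct2[OF mm]]] by (simp add: touched_contraction image_subset_iff)
    then obtain x where x: "x \<in> touched_verts G \<delta>" "joined G \<gamma> v x" by (auto simp: rep_eq_iff)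
    \<comment> \<open>Either v is the vertex x touched by \<delta>, or \<gamma> joins v to a
      different vertex and hence touches v.\<close>
    show "v \<in> touched_verts G (\<delta> \<union> \<gamma>)"
    proof (cases "v = x")
      case True
      then show ?thesis using x by (auto simp: touched_verts_def)
    next
      case False
      then show ?thesis using joined_touched(1)[OF x(2)] by (auto simp: touched_verts_def)
    qed
  qed
  show "joined G (\<delta> \<union> \<gamma>) (foot G i) (foot G j)" if "i \<in> legs G" "j \<in> legs G" for i j
    using conjunct2[OF conjunct2[OF conjunct2[OF mm]]] that by (simp add: joined_contraction)
qed

lemma feynman_contraction:
  assumes "feynman_graph G" "\<gamma> \<subseteq> edges G"
  shows "feynman_graph (contraction G \<gamma>)"
proof -
  note F = feynmanD[OF assms(1)]
  have eq: "edges G - \<gamma> \<union> \<gamma> = edges G" using assms(2) by auto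
  show ?thesis
  proof (rule feynmanI)
    show "wf_graph (contraction G \<gamma>)" using assms feynman_imp_wf wf_contraction by blast
    show "foot (contraction G \<gamma>) ` legs (contraction G \<gamma>) \<subseteq> verts (contraction G \<gamma>)"
      using F(2) by auto
    show "joined (contraction G \<gamma>) (edges (contraction G \<gamma>))
        (foot (contraction G \<gamma>) i) (foot (contraction G \<gamma>) j)"
      if "i \<in> legs (contraction G \<gamma>)" "j \<in> legs (contraction G \<gamma>)" for i j
      using F(3)[of i j] that 
      unfolding contraction_simps joined_contraction eq by simp
  qed (use F in simp_all)
qed

text \<open>If the complement of f is m.m. in G/\<gamma>, adding \<gamma> back makes it m.m. in G,
  so f is no bridge of G; component counts of the quotient are those of G with \<gamma> included, so
  f is no bridge there either. As \<gamma> may be any set of edges, the inductions can contract an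
  arbitrary edge.\<close>

lemma motic_contraction:
  assumes "motic_feynman_graph G" "\<gamma> \<subseteq> edges G"
  shows "motic_feynman_graph (contraction G \<gamma>)"
proof -
  have F: "feynman_graph G" and M: "motic G" using assms by (auto simp: motic_feynman_graph_def)
  have wf: "wf_graph G" using F by (rule feynman_imp_wf)
  have "motic (contraction G \<gamma>)"
    unfolding motic_iff[OF wf_contraction[OF wf]]
  proof (intro ballI impI)
    fix f assume f: "f \<in> edges (contraction G \<gamma>)"
      and mm: "mass_momentum_spanning (contraction G \<gamma>) (edges (contraction G \<gamma>) - {f})"
    have eq: "edges (contraction G \<gamma>) - {f} \<union> \<gamma> = edges G - {f}"
      "edges (contraction G \<gamma>) \<union> \<gamma> = edges G" using assms(2) f by auto
    have "mass_momentum_spanning G (edges G - {f})"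
      using mm_contraction[OF wf assms(2) mm] by (simp only: eq)
    then show "ncomp (contraction G \<gamma>) (edges (contraction G \<gamma>) - {f}) =
        ncomp (contraction G \<gamma>) (edges (contraction G \<gamma>))"
      unfolding ncomp_contraction eq using M f unfolding motic_iff[OF wf] by auto
  qed
  then show ?thesis using feynman_contraction[OF F assms(2)] by (simp add: motic_feynman_graph_def)
qed

lemma feynman_subgraph:
  assumes "feynman_graph G" "\<gamma> \<subseteq> edges G"
  shows "feynman_graph (subgraph G \<gamma>)"
proof (rule feynmanI)
  note F = feynmanD[OF assms(1)]
  show "wf_graph (subgraph G \<gamma>)" using assms feynman_imp_wf wf_subgraph by blast
  show "finite (legs (subgraph G \<gamma>))" using F(1) by (simp add: subgraph_def)
  show "foot (subgraph G \<gamma>) ` legs (subgraph G \<gamma>) \<subseteq> verts (subgraph G \<gamma>)"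
    by (simp add: subgraph_def mass_momentum_spanning_def)
  show "joined (subgraph G \<gamma>) (edges (subgraph G \<gamma>)) (foot (subgraph G \<gamma>) i) (foot (subgraph G \<gamma>) j)"
    if "i \<in> legs (subgraph G \<gamma>)" "j \<in> legs (subgraph G \<gamma>)" for i j
  proof (cases "mass_momentum_spanning G \<gamma>")
    case True
    then show ?thesis using that by (simp add: mass_momentum_spanning_def)
  qed (use that in simp)
  show "(\<Sum>i\<in>legs (subgraph G \<gamma>). mom (subgraph G \<gamma>) i) = 0"
    using F(4) by (simp add: subgraph_def)
  show "(\<Sum>i\<in>I. mom (subgraph G \<gamma>) i) \<noteq> 0" if "I \<subset> legs (subgraph G \<gamma>)" "I \<noteq> {}" for I
    using F(5)[of I] that by (cases "mass_momentum_spanning G \<gamma>") auto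
qed

lemma motic_subgraph_iff:
  assumes "feynman_graph G" "\<gamma> \<subseteq> edges G"
  shows "motic_subgraph G \<gamma> \<longleftrightarrow> motic_feynman_graph (subgraph G \<gamma>)"
  using assms feynman_subgraph[OF assms] by (simp add: motic_subgraph_def motic_feynman_graph_def)

text \<open>The criterion on single edges with components counted in the ambient graph: the vertices
  outside \<gamma> contribute equally to both sides.\<close>

lemma motic_subgraphI:
  assumes "wf_graph G" "\<gamma> \<subseteq> edges G"
    and "\<And>f. f \<in> \<gamma> \<Longrightarrow> mass_momentum_spanning (subgraph G \<gamma>) (\<gamma> - {f}) \<Longrightarrow> ncomp G (\<gamma> - {f}) = ncomp G \<gamma>"
  shows "motic_subgraph G \<gamma>"
  unfolding motic_subgraph_def motic_iff[OF wf_subgraph[OF assms(1,2)]]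
proof (intro conjI ballI impI)
  fix f assume "f \<in> edges (subgraph G \<gamma>)"
    "mass_momentum_spanning (subgraph G \<gamma>) (edges (subgraph G \<gamma>) - {f})"
  then have "ncomp G (\<gamma> - {f}) = ncomp G \<gamma>" using assms(3) by simp
  then show "ncomp (subgraph G \<gamma>) (edges (subgraph G \<gamma>) - {f}) = ncomp (subgraph G \<gamma>) (edges (subgraph G \<gamma>))"
    using ncomp_subgraph[OF assms(1,2) order_refl] ncomp_subgraph[OF assms(1,2), of "\<gamma> - {f}"] by simp
qed (use assms in simp)


section \<open>Symanzik polynomials as sums over all spanning forests\<close>

subsection \<open>Monomials\<close>

lemma lookup_product_monomial:
  "finite A \<Longrightarrow> Poly_Mapping.lookup (product_monomial A) e = (if e \<in> A then 1 else 0)"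
  by (simp add: product_monomial_def Poly_Mapping.lookup_sum lookup_single when_def)

lemma product_monomial_insert:
  "finite A \<Longrightarrow> e \<notin> A \<Longrightarrow> product_monomial (insert e A) = Poly_Mapping.single e 1 + product_monomial A"
  by (simp add: product_monomial_def)

lemma product_monomial_empty [simp]: "product_monomial {} = 0"
  by (simp add: product_monomial_def)

lemma product_monomial_remove:
  "finite A \<Longrightarrow> e \<in> A \<Longrightarrow> product_monomial A = Poly_Mapping.single e 1 + product_monomial (A - {e})"
  using product_monomial_insert[of "A - {e}" e] by (simp add: insert_absorb)

lemma product_monomial_Un:
  "finite A \<Longrightarrow> finite B \<Longrightarrow> A \<inter> B = {} \<Longrightarrow>
    product_monomial (A \<union> B) = product_monomial A + product_monomial B"
  by (simp add: product_monomial_def sum.union_disjoint)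

lemma prod_evar:
  "finite A \<Longrightarrow> (\<Prod>e\<in>A. evar e) = (Poly_Mapping.single (product_monomial A) 1 :: 'k::comm_ring_1 epoly)"
  by (induction A rule: finite_induct) (simp_all add: evar_def mult_single product_monomial_insert)

lemma const_mult_single:
  "const c * Poly_Mapping.single m x = (Poly_Mapping.single m (of_real c * x) :: 'k::real_field epoly)"
  by (simp add: const_def mult_single)

lemma degree_in_add: "degree_in A (m + n) = degree_in A m + degree_in A n"
  by (simp add: degree_in_def lookup_add sum.distrib)

lemma degree_in_single:
  "finite A \<Longrightarrow> degree_in A (Poly_Mapping.single e k) = (if e \<in> A then k else 0)"
  by (simp add: degree_in_def lookup_single when_def)

lemma degree_in_product_monomial:
  "finite A \<Longrightarrow> finite B \<Longrightarrow> degree_in A (product_monomial B) = card (A \<inter> B)"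
  by (simp add: degree_in_def lookup_product_monomial sum.If_cases Int_def)

text \<open>Every use of the factorisation hypotheses goes through this comparison of a single
  coefficient.\<close>

lemma agreeD:
  "agree_to_degree \<gamma> d A B \<Longrightarrow> degree_in \<gamma> m \<le> d \<Longrightarrow> Poly_Mapping.lookup A m = Poly_Mapping.lookup B m"
  unfolding agree_to_degree_def by (metis in_keys_iff leD lookup_minus right_minus_eq)

lemma lookup_set_zero:
  "Poly_Mapping.lookup (set_zero e p) m = (if Poly_Mapping.lookup m e = 0 then Poly_Mapping.lookup p m else 0)"
  by (simp add: set_zero_def lookup_mapp when_def in_keys_iff)

lemma set_zero_sum: "set_zero e (\<Sum>i\<in>A. p i) = (\<Sum>i\<in>A. set_zero e (p i))"
  by (rule poly_mapping_eqI) (simp add: lookup_set_zero Poly_Mapping.lookup_sum)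

lemma set_zero_add: "set_zero e (p + q) = set_zero e p + set_zero e q"
  by (rule poly_mapping_eqI) (simp add: lookup_set_zero lookup_add)

lemma set_zero_single:
  "set_zero e (Poly_Mapping.single m c) = (if Poly_Mapping.lookup m e = 0 then Poly_Mapping.single m c else 0)"
  by (rule poly_mapping_eqI) (auto simp: lookup_set_zero lookup_single when_def)

lemma lookup_single_mult:
  fixes p :: "'k::comm_ring_1 epoly"
  shows "Poly_Mapping.lookup (Poly_Mapping.single a c * p) (a + m) = c * Poly_Mapping.lookup p m"
proof -
  have p: "p = (\<Sum>n\<in>Poly_Mapping.keys p. Poly_Mapping.single n (Poly_Mapping.lookup p n))"
    by (rule poly_mapping_eqI)
      (simp add: Poly_Mapping.lookup_sum lookup_single when_def in_keys_iff sum.delta)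
  have "Poly_Mapping.lookup (Poly_Mapping.single a c * p) (a + m) =
      (\<Sum>n\<in>Poly_Mapping.keys p. c * Poly_Mapping.lookup p n when n = m)"
    by (subst p) (simp add: sum_distrib_left mult_single Poly_Mapping.lookup_sum lookup_single)
  also have "\<dots> = c * Poly_Mapping.lookup p m"
    by (simp add: when_def in_keys_iff sum.delta)
  finally show ?thesis .
qed

text \<open>Every monomial of the product is divisible by the monomial a.\<close>

lemma lookup_single_mult_eq_0:
  fixes p :: "'k::comm_ring_1 epoly"
  assumes "Poly_Mapping.lookup m e < Poly_Mapping.lookup a e"
  shows "Poly_Mapping.lookup (Poly_Mapping.single a c * p) m = 0"
proof (rule ccontr)
  assume "Poly_Mapping.lookup (Poly_Mapping.single a c * p) m \<noteq> 0"
  then have "m \<in> Poly_Mapping.keys (Poly_Mapping.single a c * p)" by (simp add: in_keys_iff)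
  then obtain n where "m = a + n" using keys_mult[of "Poly_Mapping.single a c" p]
    by (auto split: if_splits)
  then show False using assms by (simp add: lookup_add)
qed


subsection \<open>Momentum weight of a forest\<close>

text \<open>
  For a spanning forest with one component more than the graph this is the square of the momentum
  through the additional cut: it vanishes if the cut does not separate external half-edges, and
  otherwise the two separated parts carry opposite momenta.
\<close>

definition momentum_weight :: "('d::finite) fgraph \<Rightarrow> nat set \<Rightarrow> real" where
  "momentum_weight G F = (\<Sum>i\<in>legs G. \<Sum>j\<in>legs G.
     if joined G F (foot G i) (foot G j) then mom G i \<bullet> mom G j else 0) / 2"

text \<open>This is what the pairwise formula is made for: it chooses no tree and refers only to
  \<open>joined\<close>, which contraction respects.\<close>

lemma momentum_weight_contraction:
  "momentum_weight (contraction G \<gamma>) F = momentum_weight G (F \<union> \<gamma>)"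
  by (simp add: momentum_weight_def joined_contraction cong: if_cong)

text \<open>Pairs on the A side contribute the square of the momentum into A, pairs on the other
  side the square of its negative by momentum conservation. The two equal contributions cancel the
  division by 2.\<close>

lemma momentum_weight_bipartition:
  assumes "finite (legs G)" "(\<Sum>i\<in>legs G. mom G i) = 0"
    and "\<And>i j. i \<in> legs G \<Longrightarrow> j \<in> legs G \<Longrightarrow>
      joined G F (foot G i) (foot G j) \<longleftrightarrow> (foot G i \<in> A \<longleftrightarrow> foot G j \<in> A)"
  shows "momentum_weight G F = momentum_into G A \<bullet> momentum_into G A"
proof -
  define I where "I = {i \<in> legs G. foot G i \<in> A}"
  define J where "J = {i \<in> legs G. foot G i \<notin> A}"
  have L: "legs G = I \<union> J" "I \<inter> J = {}" "finite I" "finite J"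
    using assms(1) by (auto simp: I_def J_def)
  have IJ: "sum (mom G) J = - sum (mom G) I"
    using assms(2) unfolding L(1) sum.union_disjoint[OF L(3,4,2)]
    by (simp add: eq_neg_iff_add_eq_0 add.commute)
  have inI: "(\<Sum>j\<in>legs G. if joined G F (foot G i) (foot G j) then mom G i \<bullet> mom G j else 0) = mom G i \<bullet> sum (mom G) I"
    if "i \<in> I" for i
  proof -
    have "(\<Sum>j\<in>legs G. if joined G F (foot G i) (foot G j) then mom G i \<bullet> mom G j else 0) =
        (\<Sum>j\<in>legs G. if foot G j \<in> A then mom G i \<bullet> mom G j else 0)"
      using assms(3) that by (intro sum.cong) (auto simp: I_def)
    then show ?thesis using assms(1) by (simp add: I_def inner_sum_right flip: sum.inter_filter)
  qed
  have inJ: "(\<Sum>j\<in>legs G. if joined G F (foot G i) (foot G j) then mom G i \<bullet> mom G j else 0) = mom G i \<bullet> sum (mom G) J"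
    if "i \<in> J" for i
  proof -
    have "(\<Sum>j\<in>legs G. if joined G F (foot G i) (foot G j) then mom G i \<bullet> mom G j else 0) =
        (\<Sum>j\<in>legs G. if foot G j \<notin> A then mom G i \<bullet> mom G j else 0)"
      using assms(3) that by (intro sum.cong) (auto simp: J_def)
    then show ?thesis using assms(1) by (simp add: J_def inner_sum_right flip: sum.inter_filter)
  qed
  have "2 * momentum_weight G F = (\<Sum>i\<in>I \<union> J. \<Sum>j\<in>legs G.
      if joined G F (foot G i) (foot G j) then mom G i \<bullet> mom G j else 0)"
    by (simp add: momentum_weight_def L(1)[symmetric])
  also have "\<dots> = sum (mom G) I \<bullet> sum (mom G) I + sum (mom G) J \<bullet> sum (mom G) J"
    by (simp add: sum.union_disjoint[OF L(3,4,2)] inI inJ inner_sum_left)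
  also have "\<dots> = 2 * (sum (mom G) I \<bullet> sum (mom G) I)" by (simp add: IJ)
  finally show ?thesis by (simp add: momentum_into_def I_def)
qed

text \<open>The bipartition with one side empty, through which no momentum flows.\<close>

lemma momentum_weight_joined:
  assumes "finite (legs G)" "(\<Sum>i\<in>legs G. mom G i) = 0"
    and "\<And>i j. i \<in> legs G \<Longrightarrow> j \<in> legs G \<Longrightarrow> joined G F (foot G i) (foot G j)"
  shows "momentum_weight G F = 0"
  using momentum_weight_bipartition[of G F "{}"] assms by (simp add: momentum_into_def)


subsection \<open>Spanning forests\<close>

text \<open>Acyclicity becomes an equation between cardinalities, as the subtraction in
  \<open>loops\<close> cannot truncate.\<close>

lemma spanning_forests_iff:
  assumes "wf_graph G"
  shows "F \<in> spanning_forests k G \<longleftrightarrow>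
    F \<subseteq> edges G \<and> card F + ncomp G F = card (verts G) \<and> ncomp G F = k"
  using card_verts_le[OF assms, of F]
  by (auto simp: spanning_forests_def loops_restrict card_components)

lemma finite_spanning_forests: "wf_graph G \<Longrightarrow> finite (spanning_forests k G)"
  by (rule finite_subset[of _ "Pow (edges G)"]) (auto simp: spanning_forests_def wf_graph_def)

section \<open>Connected components and the forests inside them\<close>

lemma components_iff:
  "K \<in> components G \<longleftrightarrow> (\<exists>x\<in>verts G. K = {y \<in> verts G. joined G (edges G) x y})"
  unfolding components_def quotient_def by auto

lemma component_graph_simps [simp]:
  "verts (component_graph G K) = K"
  "edges (component_graph G K) = {e \<in> edges G. set_uprod (ends G e) \<subseteq> K}"
  "ends (component_graph G K) = ends G"
  "mass (component_graph G K) = mass G"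
  "legs (component_graph G K) = {i \<in> legs G. foot G i \<in> K}"
  "foot (component_graph G K) = foot G"
  "mom (component_graph G K) = mom G"
  by (simp_all add: component_graph_def)

lemma finite_components: "wf_graph G \<Longrightarrow> finite (components G)"
  by (rule finite_subset[of _ "Pow (verts G)"]) (auto simp: components_iff wf_graph_def)

lemma component_subset: "K \<in> components G \<Longrightarrow> K \<subseteq> verts G"
  by (auto simp: components_iff)

lemma component_joined:
  assumes "K \<in> components G" "x \<in> K" "y \<in> verts G"
  shows "y \<in> K \<longleftrightarrow> joined G (edges G) x y"
proof -
  obtain z where z: "K = {y \<in> verts G. joined G (edges G) z y}"
    using assms(1) by (auto simp: components_iff)
  have "joined G (edges G) z x" using z assms(2) by auto
  then have "rep G (edges G) z = rep G (edges G) x" by (simp add: rep_eq_iff)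
  then show ?thesis using z assms(3) by (simp flip: rep_eq_iff)
qed

lemma component_closed:
  assumes "wf_graph G" "K \<in> components G" "x \<in> K" "joined G (edges G) x y"
  shows "y \<in> K"
proof -
  have "y \<in> verts G"
    using joined_verts[OF assms(1) order_refl assms(4)] component_subset[OF assms(2)] assms(3) by blast
  then show ?thesis using component_joined[OF assms(2,3)] assms(4) by blast
qed

lemma components_cover: "x \<in> verts G \<Longrightarrow> \<exists>K\<in>components G. x \<in> K"
  by (intro bexI[of _ "{y \<in> verts G. joined G (edges G) x y}"]) (auto simp: components_iff)

lemma components_disjoint:
  assumes "K \<in> components G" "L \<in> components G" "x \<in> K" "x \<in> L"
  shows "K = L"
proof (rule set_eqI)
  fix y
  show "y \<in> K \<longleftrightarrow> y \<in> L"
    using component_joined[OF assms(1,3), of y] component_joined[OF assms(2,4), of y]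
      component_subset[OF assms(1)] component_subset[OF assms(2)] by blast
qed

lemma component_nonempty: "K \<in> components G \<Longrightarrow> K \<noteq> {}"
  by (auto simp: components_iff)

lemma wf_component_graph:
  "wf_graph G \<Longrightarrow> K \<in> components G \<Longrightarrow> wf_graph (component_graph G K)"
  using component_subset[of K G] finite_subset by (auto simp: wf_graph_def)

lemma edge_in_component:
  assumes "wf_graph G" "e \<in> edges G"
  shows "\<exists>K\<in>components G. set_uprod (ends G e) \<subseteq> K"
proof -
  obtain x y where xy: "ends G e = Upair x y" "x \<in> verts G" "y \<in> verts G"
    using assms by (rule wf_endsE)
  obtain K where K: "K \<in> components G" "x \<in> K" using components_cover[OF xy(2)] by blast
  then have "y \<in> K"
    using component_closed[OF assms(1) K] joined_edge[OF assms(2) xy(1)] by blast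
  then show ?thesis using K xy by auto
qed

text \<open>A path starting in K never leaves K, so only the edges of F inside K matter.\<close>

lemma joined_component_graph:
  assumes "wf_graph G" "K \<in> components G" "F \<subseteq> edges G" "x \<in> K"
  shows "joined (component_graph G K) (F \<inter> edges (component_graph G K)) x y \<longleftrightarrow> joined G F x y"
proof
  assume "joined (component_graph G K) (F \<inter> edges (component_graph G K)) x y"
  then have "joined G (F \<inter> edges (component_graph G K)) x y"
    using joined_cong[of "F \<inter> edges (component_graph G K)" "component_graph G K" G] by simp
  then show "joined G F x y" by (rule joined_mono[OF Int_lower1])
next
  assume "joined G F x y"
  then have "y \<in> K \<and> joined (component_graph G K) (F \<inter> edges (component_graph G K)) x y"
  proof (rule joined_invariant[where P = "\<lambda>y. y \<in> K \<and> joined (component_graph G K) (F \<inter> edges (component_graph G K)) x y"])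
    fix e a b
    assume e: "e \<in> F" "ends G e = Upair a b"
      and a: "a \<in> K \<and> joined (component_graph G K) (F \<inter> edges (component_graph G K)) x a"
    have b: "b \<in> K"
      using component_closed[OF assms(1,2) conjunct1[OF a]] joined_edge[OF subsetD[OF assms(3) e(1)] e(2)] .
    then have "e \<in> F \<inter> edges (component_graph G K)" using e a assms(3) by auto
    then have "joined (component_graph G K) (F \<inter> edges (component_graph G K)) a b"
      by (rule joined_edge) (simp add: e)
    with a b show "b \<in> K \<and> joined (component_graph G K) (F \<inter> edges (component_graph G K)) x b"
      using joined_trans by blast
  qed (use assms(4) in simp)
  then show "joined (component_graph G K) (F \<inter> edges (component_graph G K)) x y" by blast
qed

lemma rep_component_graph:
  assumes "wf_graph G" "K \<in> components G" "F \<subseteq> edges G" "x \<in> K"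
  shows "rep (component_graph G K) (F \<inter> edges (component_graph G K)) x = rep G F x"
  unfolding rep_def joined_component_graph[OF assms] ..

lemma sum_components:
  fixes f :: "'a \<Rightarrow> nat"
  assumes "wf_graph G"
  shows "card (verts G) = (\<Sum>K\<in>components G. card K)"
    and "F \<subseteq> edges G \<Longrightarrow> card F = (\<Sum>K\<in>components G. card (F \<inter> edges (component_graph G K)))"
    and "F \<subseteq> edges G \<Longrightarrow>
      ncomp G F = (\<Sum>K\<in>components G. ncomp (component_graph G K) (F \<inter> edges (component_graph G K)))"
proof -
  have fin: "finite (components G)" "finite (verts G)" "finite (edges G)"
    using assms finite_components by (auto simp: wf_graph_def)
  have V: "verts G = (\<Union>K\<in>components G. K)"
  proof (intro equalityI subsetI)
    fix x assume "x \<in> verts G"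
    then show "x \<in> (\<Union>K\<in>components G. K)" using components_cover[of x G] by simp
  next
    fix x assume "x \<in> (\<Union>K\<in>components G. K)"
    then show "x \<in> verts G" using component_subset[of _ G] by auto
  qed
  have finK: "finite K" if "K \<in> components G" for K
    using component_subset[OF that] fin finite_subset by blast
  show "card (verts G) = (\<Sum>K\<in>components G. card K)"
    unfolding V using fin finK components_disjoint by (intro card_UN_disjoint) blast+
  {
    assume F: "F \<subseteq> edges G"
    have "F = (\<Union>K\<in>components G. F \<inter> edges (component_graph G K))"
      using edge_in_component[OF assms] F by auto
    also have "card \<dots> = (\<Sum>K\<in>components G. card (F \<inter> edges (component_graph G K)))"
    proof (rule card_UN_disjoint)
      show "\<forall>K\<in>components G. \<forall>L\<in>components G. K \<noteq> L \<longrightarrow>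
          F \<inter> edges (component_graph G K) \<inter> (F \<inter> edges (component_graph G L)) = {}"
      proof (intro ballI impI equals0I)
        fix K L e
        assume KL: "K \<in> components G" "L \<in> components G" "K \<noteq> L"
          and "e \<in> F \<inter> edges (component_graph G K) \<inter> (F \<inter> edges (component_graph G L))"
        then have e: "set_uprod (ends G e) \<subseteq> K" "set_uprod (ends G e) \<subseteq> L" by auto
        obtain a b where "ends G e = Upair a b" by (cases "ends G e") auto
        then show False using e components_disjoint[OF KL(1,2), of a] KL(3) by auto
      qed
    qed (use fin F finite_subset in auto)
    finally show "card F = (\<Sum>K\<in>components G. card (F \<inter> edges (component_graph G K)))" .
    have "ncomp G F = card (\<Union>K\<in>components G. rep G F ` K)"
      unfolding ncomp_def V image_UN ..
    also have "\<dots> = (\<Sum>K\<in>components G. card (rep G F ` K))"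
    proof (rule card_UN_disjoint)
      \<comment> \<open>Representatives stay in the component of their vertex, which makes the
        images for different components disjoint.\<close>
      have sub: "rep G F ` K \<subseteq> K" if "K \<in> components G" for K
        using component_closed[OF assms that _ joined_mono[OF F joined_rep]] by auto
      show "\<forall>K\<in>components G. \<forall>L\<in>components G. K \<noteq> L \<longrightarrow> rep G F ` K \<inter> rep G F ` L = {}"
      proof (intro ballI impI equals0I)
        fix K L x
        assume KL: "K \<in> components G" "L \<in> components G" "K \<noteq> L"
          and "x \<in> rep G F ` K \<inter> rep G F ` L"
        then have "x \<in> K" "x \<in> L" using sub by blast+
        then show False using components_disjoint[OF KL(1,2)] KL(3) by blast
      qed
    qed (use fin finK in auto)
    also have "\<dots> = (\<Sum>K\<in>components G. ncomp (component_graph G K) (F \<inter> edges (component_graph G K)))"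
      unfolding ncomp_def using rep_component_graph[OF assms _ F] by (intro sum.cong) auto
    finally show "ncomp G F = (\<Sum>K\<in>components G. ncomp (component_graph G K) (F \<inter> edges (component_graph G K)))" .
  }
qed

text \<open>Distributivity: choosing one set from \<open>S K\<close> in every block is the same as
  choosing their union F, recovered by intersecting with the blocks, and E - F splits into the
  complements taken block by block.\<close>

lemma prod_sum_partition:
  fixes c :: "'i \<Rightarrow> 'e set \<Rightarrow> 'a::comm_semiring_1" and f :: "'e \<Rightarrow> 'a"
  assumes "finite I" and finA: "\<And>K. K \<in> I \<Longrightarrow> finite (A K)"
    and disj: "\<And>K L. K \<in> I \<Longrightarrow> L \<in> I \<Longrightarrow> K \<noteq> L \<Longrightarrow> A K \<inter> A L = {}"
    and S: "\<And>K. K \<in> I \<Longrightarrow> S K \<subseteq> Pow (A K)"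
    and E: "E = (\<Union>K\<in>I. A K)"
  shows "(\<Prod>K\<in>I. \<Sum>T\<in>S K. c K T * (\<Prod>e\<in>A K - T. f e)) =
    (\<Sum>F | F \<subseteq> E \<and> (\<forall>K\<in>I. F \<inter> A K \<in> S K). (\<Prod>K\<in>I. c K (F \<inter> A K)) * (\<Prod>e\<in>E - F. f e))"
proof -
  have "finite (S K)" if "K \<in> I" for K using S[OF that] finA[OF that] finite_subset by blast
  then have "(\<Prod>K\<in>I. \<Sum>T\<in>S K. c K T * (\<Prod>e\<in>A K - T. f e)) =
      (\<Sum>t\<in>PiE I S. \<Prod>K\<in>I. c K (t K) * (\<Prod>e\<in>A K - t K. f e))"
    by (intro prod_sum_PiE assms)
  also have "\<dots> = (\<Sum>F | F \<subseteq> E \<and> (\<forall>K\<in>I. F \<inter> A K \<in> S K).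
      (\<Prod>K\<in>I. c K (F \<inter> A K)) * (\<Prod>e\<in>E - F. f e))"
  proof (rule sum.reindex_bij_witness)
    fix F assume F: "F \<in> {F. F \<subseteq> E \<and> (\<forall>K\<in>I. F \<inter> A K \<in> S K)}"
    show "(\<lambda>K\<in>I. F \<inter> A K) \<in> PiE I S" using F by auto
    show "(\<Union>K\<in>I. (\<lambda>K\<in>I. F \<inter> A K) K) = F" using F E by auto
  next
    fix t assume t: "t \<in> PiE I S"
    have sub: "t K \<subseteq> A K" if "K \<in> I" for K using t S[OF that] that by (auto simp: PiE_def Pi_def)
    have cap: "(\<Union>L\<in>I. t L) \<inter> A K = t K" if "K \<in> I" for K
      using sub disj that by blast
    show "(\<Union>K\<in>I. t K) \<in> {F. F \<subseteq> E \<and> (\<forall>K\<in>I. F \<inter> A K \<in> S K)}"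
      using sub cap t E by (auto simp: PiE_def Pi_def)
    show "(\<lambda>K\<in>I. (\<Union>L\<in>I. t L) \<inter> A K) = t"
      using cap t by (auto simp: PiE_def extensional_def restrict_def fun_eq_iff)
    have "E - (\<Union>K\<in>I. t K) = (\<Union>K\<in>I. A K - t K)"
      unfolding E using cap by blast
    then have "(\<Prod>e\<in>E - (\<Union>K\<in>I. t K). f e) = (\<Prod>K\<in>I. \<Prod>e\<in>A K - t K. f e)"
      using assms(1) finA disj by (simp add: prod.UNION_disjoint Diff_Int2 Int_Diff disjoint_iff)
    then show "(\<Prod>K\<in>I. c K ((\<Union>K\<in>I. t K) \<inter> A K)) * (\<Prod>e\<in>E - (\<Union>K\<in>I. t K). f e) =
        (\<Prod>K\<in>I. c K (t K) * (\<Prod>e\<in>A K - t K. f e))"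
      using cap by (simp add: prod.distrib)
  qed
  finally show ?thesis .
qed

text \<open>The number of trees k K may vary with the component because \<open>Phi\<close> asks for
  two trees in the component of the half-edges and for one in each of the others.\<close>

lemma prod_components:
  fixes c :: "nat set \<Rightarrow> nat set \<Rightarrow> 'k::real_field epoly"
  assumes wf: "wf_graph G"
  shows "(\<Prod>K\<in>components G. \<Sum>T\<in>spanning_forests (k K) (component_graph G K).
      c K T * (\<Prod>e\<in>edges (component_graph G K) - T. evar e)) =
    (\<Sum>F | F \<subseteq> edges G \<and> (\<forall>K\<in>components G.
        F \<inter> edges (component_graph G K) \<in> spanning_forests (k K) (component_graph G K)).
      (\<Prod>K\<in>components G. c K (F \<inter> edges (component_graph G K))) * (\<Prod>e\<in>edges G - F. evar e))"
proof (rule prod_sum_partition)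
  show "finite (components G)" using finite_components[OF wf] .
  show "finite (edges (component_graph G K))" if "K \<in> components G" for K
    using wf by (simp add: wf_graph_def)
  show "spanning_forests (k K) (component_graph G K) \<subseteq> Pow (edges (component_graph G K))"
    if "K \<in> components G" for K
    by (auto simp: spanning_forests_def)
  show "edges G = (\<Union>K\<in>components G. edges (component_graph G K))"
    using edge_in_component[OF wf] by auto
  show "edges (component_graph G K) \<inter> edges (component_graph G L) = {}"
    if KL: "K \<in> components G" "L \<in> components G" "K \<noteq> L" for K L
  proof (rule equals0I)
    fix e assume "e \<in> edges (component_graph G K) \<inter> edges (component_graph G L)"
    then have e: "set_uprod (ends G e) \<subseteq> K" "set_uprod (ends G e) \<subseteq> L" by auto
    obtain a b where "ends G e = Upair a b" by (cases "ends G e") auto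
    then show False using e components_disjoint[OF KL(1,2), of a] KL(3) by auto
  qed
qed

text \<open>The number of independent cycles of F is a sum of nonnegative contributions of the
  components, so it vanishes exactly if each contribution does.\<close>

lemma spanning_forests_components:
  assumes wf: "wf_graph G" and F: "F \<subseteq> edges G"
  shows "F \<in> spanning_forests (ncomp G F) G \<longleftrightarrow> (\<forall>K\<in>components G.
    F \<inter> edges (component_graph G K) \<in>
      spanning_forests (ncomp (component_graph G K) (F \<inter> edges (component_graph G K))) (component_graph G K))"
proof -
  define f where "f K = card (F \<inter> edges (component_graph G K)) +
    ncomp (component_graph G K) (F \<inter> edges (component_graph G K))" for K
  have S: "card (verts G) = (\<Sum>K\<in>components G. card K)"
    "card F + ncomp G F = (\<Sum>K\<in>components G. f K)"
    using sum_components[OF wf] F by (simp_all add: f_def sum.distrib)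
  have le: "card K \<le> f K" if "K \<in> components G" for K
    using card_verts_le[OF wf_component_graph[OF wf that], of "F \<inter> edges (component_graph G K)"]
    by (simp add: f_def)
  have "F \<in> spanning_forests (ncomp G F) G \<longleftrightarrow> (\<forall>K\<in>components G. card K = f K)"
  proof
    assume "F \<in> spanning_forests (ncomp G F) G"
    then have "(\<Sum>K\<in>components G. card K) = (\<Sum>K\<in>components G. f K)"
      using S by (simp add: spanning_forests_iff[OF wf])
    then show "\<forall>K\<in>components G. card K = f K"
      using sum_mono_inv[of card "components G" f] le finite_components[OF wf] by simp
  next
    assume "\<forall>K\<in>components G. card K = f K"
    then show "F \<in> spanning_forests (ncomp G F) G"
      using S F by (simp add: spanning_forests_iff[OF wf])
  qed
  also have "\<dots> \<longleftrightarrow> (\<forall>K\<in>components G. F \<inter> edges (component_graph G K) \<in>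
      spanning_forests (ncomp (component_graph G K) (F \<inter> edges (component_graph G K))) (component_graph G K))"
    using spanning_forests_iff[OF wf_component_graph[OF wf]] by (intro ball_cong) (auto simp: f_def)
  finally show ?thesis .
qed

lemma ncomp_component_graph_pos:
  assumes "wf_graph G" "K \<in> components G"
  shows "1 \<le> ncomp (component_graph G K) F"
proof -
  have "finite K" "K \<noteq> {}"
    using assms component_nonempty component_subset[OF assms(2)] finite_subset by (auto simp: wf_graph_def)
  then have "0 < card (rep (component_graph G K) F ` K)" by (simp add: card_gt_0_iff)
  then show ?thesis by (simp add: ncomp_def)
qed

text \<open>Every component of G contains at least one tree of F; a total equal to the number of
  components leaves exactly one for each.\<close>

lemma maximal_forests_components:
  assumes wf: "wf_graph G" and F: "F \<subseteq> edges G"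
  shows "F \<in> spanning_forests (ncomp G (edges G)) G \<longleftrightarrow> (\<forall>K\<in>components G.
    F \<inter> edges (component_graph G K) \<in> spanning_forests 1 (component_graph G K))"
proof -
  let ?n = "\<lambda>K. ncomp (component_graph G K) (F \<inter> edges (component_graph G K))"
  have S: "ncomp G F = (\<Sum>K\<in>components G. ?n K)" using sum_components(3)[OF wf F] .
  have ones: "ncomp G F = ncomp G (edges G) \<longleftrightarrow> (\<forall>K\<in>components G. ?n K = 1)"
  proof
    assume "ncomp G F = ncomp G (edges G)"
    then have "(\<Sum>K\<in>components G. 1) = (\<Sum>K\<in>components G. ?n K)"
      unfolding S[symmetric] by (simp add: card_components_full)
    then show "\<forall>K\<in>components G. ?n K = 1"
      using sum_mono_inv[of "\<lambda>_. 1" "components G" ?n] ncomp_component_graph_pos[OF wf]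
        finite_components[OF wf] by simp
  next
    assume "\<forall>K\<in>components G. ?n K = 1"
    then show "ncomp G F = ncomp G (edges G)" by (simp add: S card_components_full)
  qed
  have "F \<in> spanning_forests (ncomp G (edges G)) G \<longleftrightarrow>
      F \<in> spanning_forests (ncomp G F) G \<and> ncomp G F = ncomp G (edges G)"
    by (auto simp: spanning_forests_iff[OF wf])
  also have "\<dots> \<longleftrightarrow> (\<forall>K\<in>components G.
    F \<inter> edges (component_graph G K) \<in> spanning_forests 1 (component_graph G K))"
    unfolding spanning_forests_components[OF wf F] ones
    using spanning_forests_iff[OF wf_component_graph[OF wf]] by auto
  finally show ?thesis .
qed

text \<open>Replaces the product over components by one sum over forests that restrict to a tree in
  each component. In this form contraction of an edge acts on the index set alone.\<close>

lemma Psi_eq: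
  assumes wf: "wf_graph G"
  shows "Psi G = (\<Sum>F\<in>spanning_forests (ncomp G (edges G)) G.
    Poly_Mapping.single (product_monomial (edges G - F)) (1 :: 'k::real_field))"
proof -
  have "(Psi G :: 'k epoly) = (\<Prod>K\<in>components G. \<Sum>T\<in>spanning_forests 1 (component_graph G K).
      1 * (\<Prod>e\<in>edges (component_graph G K) - T. evar e))"
    by (simp add: Psi_def Psi_connected_def)
  also have "\<dots> = (\<Sum>F | F \<subseteq> edges G \<and> (\<forall>K\<in>components G.
        F \<inter> edges (component_graph G K) \<in> spanning_forests 1 (component_graph G K)).
      (\<Prod>K\<in>components G. 1) * (\<Prod>e\<in>edges G - F. evar e))"
    by (rule prod_components[OF wf])
  also have "{F. F \<subseteq> edges G \<and> (\<forall>K\<in>components G.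
        F \<inter> edges (component_graph G K) \<in> spanning_forests 1 (component_graph G K))} =
      spanning_forests (ncomp G (edges G)) G"
    using maximal_forests_components[OF wf] by (auto simp: spanning_forests_def)
  also have "(\<Sum>F\<in>spanning_forests (ncomp G (edges G)) G.
      (\<Prod>K\<in>components G. 1) * (\<Prod>e\<in>edges G - F. evar e)) =
      (\<Sum>F\<in>spanning_forests (ncomp G (edges G)) G.
        Poly_Mapping.single (product_monomial (edges G - F)) (1 :: 'k))"
    using wf by (intro sum.cong) (auto simp: prod_evar wf_graph_def)
  finally show ?thesis .
qed

lemma leg_component:
  assumes "feynman_graph G" "legs G \<noteq> {}"
  shows "leg_component G \<in> components G" "foot G ` legs G \<subseteq> leg_component G"
proof -
  note F = feynmanD[OF assms(1)]
  obtain i where i: "i \<in> legs G" using assms(2) by blast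
  then obtain K where K: "K \<in> components G" "foot G i \<in> K" using F(2) components_cover by blast
  have sub: "foot G ` legs G \<subseteq> K"
    using component_closed[OF feynman_imp_wf[OF assms(1)] K F(3)[OF i]] by auto
  have "leg_component G = K"
    unfolding leg_component_def
  proof (rule the_equality)
    fix L assume "L \<in> components G \<and> foot G ` legs G \<subseteq> L"
    then show "L = K" using components_disjoint[OF _ K(1) _ K(2)] i by blast
  qed (use K sub in blast)
  then show "leg_component G \<in> components G" "foot G ` legs G \<subseteq> leg_component G"
    using K sub by auto
qed

text \<open>With exactly two trees in K, two vertices of K are joined iff both or neither lie in the
  tree T picked by \<open>SOME\<close>; the bipartition formula therefore applies with A = T,
  whichever tree this is.\<close>

lemma forest_momentum_leg_component:
  assumes G: "feynman_graph G" and F: "F \<subseteq> edges G"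
    and K: "K \<in> components G" "foot G ` legs G \<subseteq> K"
    and two: "ncomp (component_graph G K) (F \<inter> edges (component_graph G K)) = 2"
  shows "momentum_weight G F =
    forest_momentum (component_graph G K) (F \<inter> edges (component_graph G K)) \<bullet>
    forest_momentum (component_graph G K) (F \<inter> edges (component_graph G K))"
proof -
  note D = feynmanD[OF G]
  have wf: "wf_graph G" using G by (rule feynman_imp_wf)
  define H where "H = (component_graph G K)\<lparr>edges := F \<inter> edges (component_graph G K)\<rparr>"
  have jH: "joined H (edges H) x y \<longleftrightarrow> joined G F x y" if "x \<in> K" for x y
    using joined_component_graph[OF wf K(1) F that]
      joined_cong[of "F \<inter> edges (component_graph G K)" H "component_graph G K"] by (simp add: H_def)
  have VH: "verts H = K" by (simp add: H_def)
  have "card (components H) = 2" using two by (simp add: H_def card_components)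
  then obtain A B where AB: "components H = {A, B}" "A \<noteq> B" by (auto simp: card_2_iff)
  define T where "T = (SOME T. T \<in> components H)"
  have T: "T \<in> components H" unfolding T_def by (rule someI[of _ A]) (simp add: AB)
  obtain U where U: "components H = {T, U}" "U \<noteq> T" using T AB by auto
  have "joined G F x y \<longleftrightarrow> (x \<in> T \<longleftrightarrow> y \<in> T)" if xy: "x \<in> K" "y \<in> K" for x y
  proof (cases "x \<in> T")
    case True
    then show ?thesis using component_joined[OF T True, of y] jH xy VH by simp
  next
    case False
    then have x: "x \<in> U" using components_cover[of x H] xy VH U by auto
    have "y \<in> U \<longleftrightarrow> y \<notin> T"
      using components_cover[of y H] components_disjoint[of T H U y] xy VH U by auto
    then show ?thesis using component_joined[of U H x y] x U jH xy VH False by simp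
  qed
  then have "momentum_weight G F = momentum_into G T \<bullet> momentum_into G T"
    using K(2) by (intro momentum_weight_bipartition D(1,4)) auto
  moreover have "momentum_into G T = momentum_into (component_graph G K) T"
    using K(2) by (auto simp: momentum_into_def intro!: sum.cong)
  ultimately show ?thesis by (simp add: forest_momentum_def T_def H_def)
qed

text \<open>The right-hand sum ranges over more forests than the product defining
  \<open>Phi\<close>: the additional cut may lie in a component without half-edges. Such forests
  leave all half-edges joined, so their weight is 0.\<close>

lemma Phi_eq:
  assumes G: "feynman_graph G"
  shows "Phi G = (\<Sum>F\<in>spanning_forests (ncomp G (edges G) + 1) G.
    Poly_Mapping.single (product_monomial (edges G - F)) (of_real (momentum_weight G F) :: 'k::real_field))"
proof (cases "legs G = {}")
  case True
  then show ?thesis by (simp add: Phi_def momentum_weight_def)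
next
  case False
  note D = feynmanD[OF G]
  have wf: "wf_graph G" using G by (rule feynman_imp_wf)
  define L where "L = leg_component G"
  have L: "L \<in> components G" "foot G ` legs G \<subseteq> L"
    using leg_component[OF G False] by (auto simp: L_def)
  let ?cg = "component_graph G"
  let ?n = "\<lambda>F K. ncomp (?cg K) (F \<inter> edges (?cg K))"
  define k :: "nat set \<Rightarrow> nat" where "k K = (if K = L then 2 else 1)" for K
  define c :: "nat set \<Rightarrow> nat set \<Rightarrow> 'k epoly" where
    "c K T = (if K = L then const (forest_momentum (?cg L) T \<bullet> forest_momentum (?cg L) T) else 1)" for K T
  let ?S = "{F. F \<subseteq> edges G \<and> (\<forall>K\<in>components G. F \<inter> edges (?cg K) \<in> spanning_forests (k K) (?cg K))}"
  have "(Phi G :: 'k epoly) = Phi_connected (?cg L) * (\<Prod>K\<in>components G - {L}. Psi_connected (?cg K))"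
    using False by (simp add: Phi_def L_def)
  also have "\<dots> = (\<Prod>K\<in>components G. if K = L then Phi_connected (?cg L) else Psi_connected (?cg K))"
    by (subst prod.remove[OF finite_components[OF wf] L(1)]) (auto intro!: prod.cong arg_cong2[where f = "(*)"])
  also have "\<dots> = (\<Prod>K\<in>components G. \<Sum>T\<in>spanning_forests (k K) (?cg K).
      c K T * (\<Prod>e\<in>edges (?cg K) - T. evar e))"
    by (intro prod.cong) (auto simp: k_def c_def Phi_connected_def Psi_connected_def)
  also have "\<dots> = (\<Sum>F\<in>?S. (\<Prod>K\<in>components G. c K (F \<inter> edges (?cg K))) * (\<Prod>e\<in>edges G - F. evar e))"
    by (rule prod_components[OF wf])
  also have "\<dots> = (\<Sum>F\<in>?S.
      Poly_Mapping.single (product_monomial (edges G - F)) (of_real (momentum_weight G F)))"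
  proof (rule sum.cong)
    fix F assume F: "F \<in> ?S"
    have "ncomp (?cg L) (F \<inter> edges (?cg L)) = 2"
      using F L(1) spanning_forests_iff[OF wf_component_graph[OF wf L(1)]] by (auto simp: k_def)
    then have w: "momentum_weight G F = forest_momentum (?cg L) (F \<inter> edges (?cg L)) \<bullet>
        forest_momentum (?cg L) (F \<inter> edges (?cg L))"
      using F by (intro forest_momentum_leg_component[OF G _ L]) auto
    have "(\<Prod>K\<in>components G. c K (F \<inter> edges (?cg K))) = const (momentum_weight G F)"
      by (subst prod.remove[OF finite_components[OF wf] L(1)]) (simp add: c_def w)
    then show "(\<Prod>K\<in>components G. c K (F \<inter> edges (?cg K))) * (\<Prod>e\<in>edges G - F. evar e) =
        Poly_Mapping.single (product_monomial (edges G - F)) (of_real (momentum_weight G F))"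
      using wf by (simp add: prod_evar const_mult_single wf_graph_def)
  qed simp
  also have "\<dots> = (\<Sum>F\<in>spanning_forests (ncomp G (edges G) + 1) G.
      Poly_Mapping.single (product_monomial (edges G - F)) (of_real (momentum_weight G F)))"
  proof (rule sum.mono_neutral_left)
    show "finite (spanning_forests (ncomp G (edges G) + 1) G)" using finite_spanning_forests[OF wf] .
    have sum_k: "(\<Sum>K\<in>components G. k K) = ncomp G (edges G) + 1"
      by (subst sum.remove[OF finite_components[OF wf] L(1)])
        (simp add: k_def card_components_full[symmetric] card_Suc_Diff1[OF finite_components[OF wf] L(1)]
          del: card_Diff_insert card_Diff_singleton)
    show "?S \<subseteq> spanning_forests (ncomp G (edges G) + 1) G"
    proof
      fix F assume F: "F \<in> ?S"
      then have n: "?n F K = k K" if "K \<in> components G" for K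
        using spanning_forests_iff[OF wf_component_graph[OF wf that]] that by blast
      have "ncomp G F = (\<Sum>K\<in>components G. ?n F K)"
        using sum_components(3)[OF wf] F by blast
      also have "\<dots> = ncomp G (edges G) + 1" using n sum_k by simp
      finally have "ncomp G F = ncomp G (edges G) + 1" .
      moreover have "F \<in> spanning_forests (ncomp G F) G"
        using spanning_forests_components[OF wf, of F] F n by auto
      ultimately show "F \<in> spanning_forests (ncomp G (edges G) + 1) G" by simp
    qed
    show "\<forall>F\<in>spanning_forests (ncomp G (edges G) + 1) G - ?S.
      Poly_Mapping.single (product_monomial (edges G - F)) (of_real (momentum_weight G F) :: 'k) = 0"
    proof
      fix F assume F: "F \<in> spanning_forests (ncomp G (edges G) + 1) G - ?S"
      then have sub: "F \<subseteq> edges G" and nF: "ncomp G F = ncomp G (edges G) + 1"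
        by (auto simp: spanning_forests_iff[OF wf])
      then have forest: "F \<inter> edges (?cg K) \<in> spanning_forests (?n F K) (?cg K)" if "K \<in> components G" for K
        using F spanning_forests_components[OF wf sub] that by auto
      have S: "(\<Sum>K\<in>components G. ?n F K) = ncomp G (edges G) + 1"
        using sum_components(3)[OF wf sub] nF by simp
      \<comment> \<open>If the component of the half-edges were cut, then every component would have
        at least k K trees; the total forces equality and puts F into \<open>?S\<close>.\<close>
      have "?n F L = 1"
      proof (rule ccontr)
        assume "?n F L \<noteq> 1"
        then have L2: "2 \<le> ?n F L" using ncomp_component_graph_pos[OF wf L(1)]
          by (metis Suc_1 Suc_leI le_neq_implies_less One_nat_def)
        have le: "k K \<le> ?n F K" if "K \<in> components G" for K
          using L2 ncomp_component_graph_pos[OF wf that] by (simp add: k_def)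
        have "k K = ?n F K" if "K \<in> components G" for K
          using sum_mono_inv[of k "components G" "?n F" K] le sum_k S that finite_components[OF wf] by simp
        then have "F \<in> ?S" using sub forest by auto
        then show False using F by blast
      qed
      then obtain r where r: "rep (?cg L) (F \<inter> edges (?cg L)) ` L = {r}"
        by (auto simp: ncomp_def card_1_singleton_iff)
      have "joined G F x y" if "x \<in> L" "y \<in> L" for x y
      proof -
        have "rep G F x = r" "rep G F y = r"
          using r rep_component_graph[OF wf L(1) sub] that by auto
        then show ?thesis by (simp flip: rep_eq_iff)
      qed
      then have "momentum_weight G F = 0"
        using L(2) by (intro momentum_weight_joined D(1,4)) auto
      then show "Poly_Mapping.single (product_monomial (edges G - F)) (of_real (momentum_weight G F) :: 'k) = 0"
        by simp
    qed
  qed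
  finally show ?thesis .
qed


subsection \<open>Contraction of an edge\<close>

lemma Xi_eq:
  assumes G: "feynman_graph G"
  shows "Xi G = (\<Sum>F\<in>spanning_forests (ncomp G (edges G) + 1) G.
      Poly_Mapping.single (product_monomial (edges G - F)) (of_real (momentum_weight G F) :: 'k::real_field)) +
    (\<Sum>f\<in>edges G. \<Sum>F\<in>spanning_forests (ncomp G (edges G)) G.
      Poly_Mapping.single (Poly_Mapping.single f 1 + product_monomial (edges G - F)) (of_real ((mass G f)\<^sup>2)))"
  unfolding Xi_def Phi_eq[OF G] Psi_eq[OF feynman_imp_wf[OF G]]
  by (simp add: sum_distrib_left sum_distrib_right evar_def const_mult_single mult_single)
    (rule sum.swap)

text \<open>Deleting a tadpole keeps the components, so \<open>card F + ncomp G F\<close> would drop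
  below the number of vertices.\<close>

lemma spanning_forest_no_tadpole:
  assumes wf: "wf_graph G" and F: "F \<in> spanning_forests k G" and e: "tadpole G e"
  shows "e \<notin> F"
proof
  assume "e \<in> F"
  obtain v where v: "ends G e = Upair v v" using e by (auto simp: tadpole_def)
  have sub: "F \<subseteq> edges G" and card: "card F + ncomp G F = card (verts G)"
    using F by (auto simp: spanning_forests_iff[OF wf])
  have "finite F" using sub wf finite_subset by (auto simp: wf_graph_def)
  then have "card F = Suc (card (F - {e}))" using \<open>e \<in> F\<close> by (metis card_Suc_Diff1)
  moreover have "ncomp G (F - {e}) = ncomp G F"
    using ncomp_insert[OF wf, of "F - {e}" e v v] sub \<open>e \<in> F\<close> v by (auto simp: insert_absorb)
  moreover have "card (verts G) \<le> card (F - {e}) + ncomp G (F - {e})"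
    using sub by (intro card_verts_le[OF wf]) auto
  ultimately show False using card by simp
qed

lemma card_verts_pos:
  assumes "wf_graph G" "e \<in> edges G"
  shows "0 < card (verts G)"
proof -
  obtain a b where "a \<in> verts G" using assms by (metis wf_endsE)
  then show ?thesis using assms(1) by (auto simp: wf_graph_def card_gt_0_iff)
qed

text \<open>Putting e back raises both the size of the forest and the number of vertices by one and
  keeps the number of components.\<close>

lemma spanning_forests_contraction:
  assumes wf: "wf_graph G" and e: "e \<in> edges G" "\<not> tadpole G e"
  shows "F \<in> spanning_forests k (contraction G {e}) \<longleftrightarrow> e \<notin> F \<and> insert e F \<in> spanning_forests k G"
proof -
  have "card (insert e F) = Suc (card F)" if "F \<subseteq> edges G" "e \<notin> F"
    using finite_subset[OF that(1)] that(2) wf by (simp add: wf_graph_def)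
  moreover have "F \<subseteq> edges G - {e} \<longleftrightarrow> F \<subseteq> edges G \<and> e \<notin> F" by auto
  ultimately show ?thesis
    using ncomp_single[OF wf e(1)] e card_verts_pos[OF wf e(1)]
    by (auto simp: spanning_forests_iff[OF wf] spanning_forests_iff[OF wf_contraction[OF wf]]
        ncomp_contraction card_verts_contraction simp del: contraction_simps(1))
qed

lemma spanning_forests_contraction_tadpole:
  assumes wf: "wf_graph G" and e: "e \<in> edges G" "tadpole G e"
  shows "spanning_forests k (contraction G {e}) = spanning_forests k G"
proof (rule set_eqI)
  fix F
  obtain v where v: "ends G e = Upair v v" using e by (auto simp: tadpole_def)
  have "ncomp G (insert e F) = ncomp G F" if "F \<subseteq> edges G - {e}"
    using ncomp_insert[OF wf _ _ v, of F] that e(1) by (simp add: subset_Diff_insert)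
  then show "F \<in> spanning_forests k (contraction G {e}) \<longleftrightarrow> F \<in> spanning_forests k G"
    using ncomp_single[OF wf e(1)] e spanning_forest_no_tadpole[OF wf _ e(2), of F k] subset_Diff_insert[of F "edges G" e "{}"]
    by (auto simp: spanning_forests_iff[OF wf] spanning_forests_iff[OF wf_contraction[OF wf]]
        ncomp_contraction card_verts_contraction simp del: contraction_simps(1))
qed

text \<open>Forests through e are those whose complementary monomial lacks the variable of e, so
  they are what remains when this variable is set to 0.\<close>

lemma sum_spanning_forests_containing:
  fixes h :: "nat set \<Rightarrow> 'a::comm_monoid_add"
  assumes wf: "wf_graph G" and e: "e \<in> edges G"
  shows "(\<Sum>F\<in>spanning_forests k G. if e \<in> F then h F else 0) =
    (if tadpole G e then 0 else \<Sum>F\<in>spanning_forests k (contraction G {e}). h (insert e F))"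
proof (cases "tadpole G e")
  case True
  then show ?thesis using spanning_forest_no_tadpole[OF wf _ True] by (auto intro!: sum.neutral)
next
  case False
  have "(\<Sum>F\<in>spanning_forests k G. if e \<in> F then h F else 0) =
      (\<Sum>F | F \<in> spanning_forests k G \<and> e \<in> F. h F)"
    using finite_spanning_forests[OF wf] by (simp add: sum.inter_filter)
  also have "\<dots> = (\<Sum>F\<in>spanning_forests k (contraction G {e}). h (insert e F))"
    by (rule sum.reindex_bij_witness[of _ "insert e" "\<lambda>F. F - {e}"])
      (auto simp: spanning_forests_contraction[OF wf e False] insert_absorb)
  finally show ?thesis using False by simp
qed

lemma ncomp_contraction_full:
  "e \<in> edges G \<Longrightarrow> ncomp (contraction G {e}) (edges G - {e}) = ncomp G (edges G)"
  by (simp add: ncomp_contraction insert_absorb)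

lemma set_zero_Psi:
  assumes wf: "wf_graph G" and e: "e \<in> edges G"
  shows "set_zero e (Psi G :: 'k::real_field epoly) = (if tadpole G e then 0 else Psi (contraction G {e}))"
proof -
  let ?s = "\<lambda>F. Poly_Mapping.single (product_monomial (edges G - F)) (1 :: 'k)"
  have D: "edges G - {e} - F = edges G - insert e F" for F by auto
  have "finite (edges G)" using wf by (simp add: wf_graph_def)
  then have "set_zero e (Psi G :: 'k epoly) =
      (\<Sum>F\<in>spanning_forests (ncomp G (edges G)) G. if e \<in> F then ?s F else 0)"
    unfolding Psi_eq[OF wf] set_zero_sum set_zero_single
    using e by (intro sum.cong) (auto simp: lookup_product_monomial)
  also have "\<dots> = (if tadpole G e then 0 else Psi (contraction G {e}))"
    unfolding sum_spanning_forests_containing[OF wf e] Psi_eq[OF wf_contraction[OF wf]]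
    using e by (simp add: ncomp_contraction_full D)
  finally show ?thesis .
qed

lemma set_zero_Xi:
  assumes G: "feynman_graph G" and e: "e \<in> edges G"
  shows "set_zero e (Xi G :: 'k::real_field epoly) = (if tadpole G e then 0 else Xi (contraction G {e}))"
proof -
  have wf: "wf_graph G" using G by (rule feynman_imp_wf)
  have fin: "finite (edges G)" using wf by (simp add: wf_graph_def)
  have D: "edges G - {e} - F = edges G - insert e F" for F by auto
  let ?s = "\<lambda>F. Poly_Mapping.single (product_monomial (edges G - F)) (of_real (momentum_weight G F) :: 'k)"
  let ?m = "\<lambda>f F. Poly_Mapping.single (Poly_Mapping.single f 1 + product_monomial (edges G - F))
    (of_real ((mass G f)\<^sup>2) :: 'k)"
  let ?c = "ncomp G (edges G)"
  \<comment> \<open>The mass term of e carries its own variable and vanishes altogether; in the mass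
    terms of the other edges the forests through e survive.\<close>
  have "set_zero e (Xi G :: 'k epoly) =
      (\<Sum>F\<in>spanning_forests (?c + 1) G. if e \<in> F then ?s F else 0) +
      (\<Sum>f\<in>edges G. if f = e then 0 else (\<Sum>F\<in>spanning_forests ?c G. if e \<in> F then ?m f F else 0))"
    unfolding Xi_eq[OF G] set_zero_sum set_zero_single set_zero_add
    using e fin by (intro arg_cong2[where f = "(+)"] sum.cong)
      (auto simp: lookup_product_monomial lookup_add lookup_single when_def intro!: sum.cong sum.neutral)
  also have "(\<Sum>f\<in>edges G. if f = e then 0 else (\<Sum>F\<in>spanning_forests ?c G. if e \<in> F then ?m f F else 0)) =
      (\<Sum>f\<in>edges G - {e}. \<Sum>F\<in>spanning_forests ?c G. if e \<in> F then ?m f F else 0)"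
    by (subst sum.remove[OF fin e]) simp
  also have "(\<Sum>F\<in>spanning_forests (?c + 1) G. if e \<in> F then ?s F else 0) + \<dots> =
      (if tadpole G e then 0 else Xi (contraction G {e}))"
    unfolding sum_spanning_forests_containing[OF wf e]
    using e by (auto simp: Xi_eq[OF feynman_contraction[OF G]] ncomp_contraction_full
        momentum_weight_contraction D)
  finally show ?thesis .
qed

text \<open>With y the variable of the tadpole and m its mass, Xi G = y (Xi (G/e) + m^2 y Psi
  (G/e)), and the second summand contributes nothing linear in y.\<close>

lemma lookup_Xi_tadpole:
  assumes G: "feynman_graph G" and e: "e \<in> edges G" "tadpole G e" and m: "Poly_Mapping.lookup m e = 0"
  shows "Poly_Mapping.lookup (Xi G :: 'k::real_field epoly) (Poly_Mapping.single e 1 + m) =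
    Poly_Mapping.lookup (Xi (contraction G {e})) m"
proof -
  have wf: "wf_graph G" using G by (rule feynman_imp_wf)
  have fin: "finite (edges G)" using wf by (simp add: wf_graph_def)
  have e': "{e} \<subseteq> edges G" using e by simp
  obtain v where v: "ends G e = Upair v v" using e by (auto simp: tadpole_def)
  have pm: "product_monomial (edges G - F) = Poly_Mapping.single e 1 + product_monomial (edges G - {e} - F)"
    if "F \<in> spanning_forests k G" for F k
  proof -
    have "edges G - F - {e} = edges G - {e} - F" by auto
    then show ?thesis
      using product_monomial_remove[of "edges G - F" e] spanning_forest_no_tadpole[OF wf that e(2)] e fin by simp
  qed
  have w: "momentum_weight (contraction G {e}) F = momentum_weight G F" for F
  proof -
    have "joined G (insert e F) x y \<longleftrightarrow> joined G F x y" for x y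
    proof
      assume "joined G (insert e F) x y"
      then show "joined G F x y"
      proof (rule joined_invariant[where P = "joined G F x"])
        fix f a b
        assume f: "f \<in> insert e F" "ends G f = Upair a b" and a: "joined G F x a"
        show "joined G F x b"
        proof (cases "f \<in> F")
          case True
          show ?thesis by (rule joined_trans[OF a joined_edge[OF True f(2)]])
        next
          case False
          then show ?thesis using f v a by auto
        qed
      qed simp
    qed (rule joined_mono, auto)
    then show ?thesis by (simp add: momentum_weight_contraction) (simp add: momentum_weight_def)
  qed
  let ?x = "Poly_Mapping.single e (1::nat)"
  have "(Xi G :: 'k epoly) = Poly_Mapping.single ?x 1 *
      (Xi (contraction G {e}) + Poly_Mapping.single ?x (of_real ((mass G e)\<^sup>2)) * Psi (contraction G {e}))"
    unfolding Xi_eq[OF G] Xi_eq[OF feynman_contraction[OF G e']] Psi_eq[OF wf_contraction[OF wf]]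
    using e by (simp add: ncomp_contraction_full spanning_forests_contraction_tadpole[OF wf e] w
        sum.remove[OF fin e(1)] distrib_left sum_distrib_left mult_single pm ac_simps cong: sum.cong)
  then have "Poly_Mapping.lookup (Xi G :: 'k epoly) (?x + m) =
      Poly_Mapping.lookup (Xi (contraction G {e}) +
        Poly_Mapping.single ?x (of_real ((mass G e)\<^sup>2)) * Psi (contraction G {e})) m"
    by (simp add: lookup_single_mult)
  also have "\<dots> = Poly_Mapping.lookup (Xi (contraction G {e})) m"
    using lookup_single_mult_eq_0[of m e ?x] m by (simp add: lookup_add)
  finally show ?thesis .
qed


subsection \<open>Degrees and extreme coefficients\<close>

lemma lookup_sum_single_neq_0:
  assumes "Poly_Mapping.lookup (\<Sum>i\<in>A. Poly_Mapping.single (g i) (c i)) m \<noteq> 0"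
  shows "\<exists>i\<in>A. m = g i"
proof (rule ccontr)
  assume "\<not> (\<exists>i\<in>A. m = g i)"
  then have "Poly_Mapping.lookup (\<Sum>i\<in>A. Poly_Mapping.single (g i) (c i)) m = 0"
    by (auto simp: Poly_Mapping.lookup_sum lookup_single when_def intro!: sum.neutral)
  then show False using assms by blast
qed

text \<open>Each additional tree costs the forest one edge and gives the complement one variable: j
  = 0 serves \<open>Psi\<close>, j = 1 serves \<open>Phi\<close>.\<close>

lemma degree_forest_monomial:
  assumes wf: "wf_graph G" and F: "F \<in> spanning_forests (ncomp G (edges G) + j) G"
  shows "degree_in (edges G) (product_monomial (edges G - F)) = loops G + j"
proof -
  have fin: "finite (edges G)" using wf by (simp add: wf_graph_def)
  have sub: "F \<subseteq> edges G" and c: "card F + ncomp G F = card (verts G)" "ncomp G F = ncomp G (edges G) + j"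
    using F by (auto simp: spanning_forests_iff[OF wf])
  have "card (edges G - F) = card (edges G) - card F" "card F \<le> card (edges G)"
    using sub fin by (auto simp: card_Diff_subset finite_subset card_mono)
  moreover have "edges G \<inter> (edges G - F) = edges G - F" by auto
  ultimately show ?thesis
    using c fin card_verts_le[OF wf order_refl] by (simp add: degree_in_product_monomial loops_eq)
qed

lemma keys_product_monomial: "finite A \<Longrightarrow> Poly_Mapping.keys (product_monomial A) = A"
  by (auto simp: in_keys_iff lookup_product_monomial split: if_splits)

lemma homogeneous_Psi:
  assumes wf: "wf_graph G"
  shows "homogeneous_in (edges G) (loops G) (Psi G :: 'k::real_field epoly)"
  unfolding homogeneous_in_def
proof
  fix m assume "m \<in> Poly_Mapping.keys (Psi G :: 'k epoly)"
  then have "Poly_Mapping.lookup (Psi G :: 'k epoly) m \<noteq> 0" by (simp add: in_keys_iff)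
  then obtain F where F: "F \<in> spanning_forests (ncomp G (edges G)) G" "m = product_monomial (edges G - F)"
    unfolding Psi_eq[OF wf] by (auto dest!: lookup_sum_single_neq_0)
  then show "Poly_Mapping.keys m \<subseteq> edges G \<and> degree_in (edges G) m = loops G"
    using degree_forest_monomial[OF wf, of F 0] wf by (auto simp: keys_product_monomial wf_graph_def)
qed

lemma homogeneous_Xi:
  assumes G: "feynman_graph G"
  shows "homogeneous_in (edges G) (loops G + 1) (Xi G :: 'k::real_field epoly)"
  unfolding homogeneous_in_def
proof
  have wf: "wf_graph G" using G by (rule feynman_imp_wf)
  have fin: "finite (edges G)" using wf by (simp add: wf_graph_def)
  fix m assume "m \<in> Poly_Mapping.keys (Xi G :: 'k epoly)"
  then have "Poly_Mapping.lookup (Xi G :: 'k epoly) m \<noteq> 0" by (simp add: in_keys_iff)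
  then have "Poly_Mapping.lookup (\<Sum>F\<in>spanning_forests (ncomp G (edges G) + 1) G.
        Poly_Mapping.single (product_monomial (edges G - F)) (of_real (momentum_weight G F) :: 'k)) m \<noteq> 0 \<or>
      Poly_Mapping.lookup (\<Sum>(f, F)\<in>edges G \<times> spanning_forests (ncomp G (edges G)) G.
        Poly_Mapping.single (Poly_Mapping.single f 1 + product_monomial (edges G - F))
          (of_real ((mass G f)\<^sup>2) :: 'k)) m \<noteq> 0"
    unfolding Xi_eq[OF G] lookup_add sum.cartesian_product by auto
  then consider F where "F \<in> spanning_forests (ncomp G (edges G) + 1) G" "m = product_monomial (edges G - F)"
    | f F where "f \<in> edges G" "F \<in> spanning_forests (ncomp G (edges G)) G"
      "m = Poly_Mapping.single f 1 + product_monomial (edges G - F)"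
    unfolding case_prod_beta by (auto dest!: lookup_sum_single_neq_0)
  then show "Poly_Mapping.keys m \<subseteq> edges G \<and> degree_in (edges G) m = loops G + 1"
  proof cases
    case 1
    then show ?thesis
      using degree_forest_monomial[OF wf 1(1)] fin by (auto simp: keys_product_monomial)
  next
    case 2
    have "Poly_Mapping.keys m \<subseteq> {f} \<union> (edges G - F)"
      using keys_add[of "Poly_Mapping.single f (1::nat)" "product_monomial (edges G - F)"] fin 2(3)
      by (simp add: keys_product_monomial)
    then show ?thesis
      using degree_forest_monomial[OF wf, of F 0] fin 2
      by (auto simp: degree_in_add degree_in_single)
  qed
qed

text \<open>The hypothesis on \<open>ncomp\<close> means that all edges are tadpoles: only the empty
  forest is acyclic, and no forest has more trees than there are vertices.\<close>

lemma spanning_forests_discrete: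
  assumes wf: "wf_graph G" and n: "ncomp G (edges G) = card (verts G)"
  shows "spanning_forests (ncomp G (edges G)) G = {{}}" "spanning_forests (ncomp G (edges G) + 1) G = {}"
proof -
  have "finite F" if "F \<subseteq> edges G" for F using that wf finite_subset by (auto simp: wf_graph_def)
  then show "spanning_forests (ncomp G (edges G)) G = {{}}" "spanning_forests (ncomp G (edges G) + 1) G = {}"
    using n by (auto simp: spanning_forests_iff[OF wf])
qed

lemma Psi_discrete:
  assumes "wf_graph G" "ncomp G (edges G) = card (verts G)"
  shows "(Psi G :: 'k::real_field epoly) = Poly_Mapping.single (product_monomial (edges G)) 1"
  unfolding Psi_eq[OF assms(1)] spanning_forests_discrete[OF assms] by simp

text \<open>No cut can separate half-edges that sit at one vertex, so the total momentum 0 is all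
  that any cut sees.\<close>

lemma Xi_eq_0:
  assumes G: "feynman_graph G" and m: "\<And>e. e \<in> edges G \<Longrightarrow> mass G e = 0"
    and feet: "\<And>i j. i \<in> legs G \<Longrightarrow> j \<in> legs G \<Longrightarrow> foot G i = foot G j"
  shows "Xi G = (0 :: 'k::real_field epoly)"
proof -
  have "momentum_weight G F = 0" for F
  proof (rule momentum_weight_joined)
    show "joined G F (foot G i) (foot G j)" if "i \<in> legs G" "j \<in> legs G" for i j
      using feet[OF that] by simp
  qed (use feynmanD[OF G] in auto)
  then show ?thesis by (simp add: Xi_eq[OF G] m)
qed

text \<open>Here the maximal forests are the single non-tadpole edges g, and the only forest with
  one more tree is empty; the latter yields the momentum term. The mass term of f paired with the
  forest g lacks the variable of g unless f = g, so each non-tadpole mass counts once.\<close>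

lemma lookup_Xi_top:
  assumes G: "feynman_graph G" and n: "ncomp G (edges G) + 1 = card (verts G)"
  shows "Poly_Mapping.lookup (Xi G) (product_monomial (edges G)) =
    (of_real (momentum_weight G {} + (\<Sum>e | e \<in> edges G \<and> \<not> tadpole G e. (mass G e)\<^sup>2)) :: 'k::real_field)"
proof -
  have wf: "wf_graph G" using G by (rule feynman_imp_wf)
  have fin: "finite (edges G)" using wf by (simp add: wf_graph_def)
  have finF: "finite F" if "F \<subseteq> edges G" for F using that fin finite_subset by blast
  let ?c = "ncomp G (edges G)"
  have S1: "spanning_forests (?c + 1) G = {{}}"
    using finF n by (auto simp: spanning_forests_iff[OF wf])
  have S0: "spanning_forests ?c G = (\<lambda>e. {e}) ` {e \<in> edges G. \<not> tadpole G e}"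
  proof (intro equalityI subsetI)
    fix F assume "F \<in> spanning_forests ?c G"
    then have F: "F \<subseteq> edges G" "card F = 1" "ncomp G F = ?c"
      using n by (auto simp: spanning_forests_iff[OF wf])
    then obtain e where e: "F = {e}" by (auto simp: card_1_singleton_iff)
    then show "F \<in> (\<lambda>e. {e}) ` {e \<in> edges G. \<not> tadpole G e}"
      using F n ncomp_single[OF wf, of e] by auto
  next
    fix F assume "F \<in> (\<lambda>e. {e}) ` {e \<in> edges G. \<not> tadpole G e}"
    then show "F \<in> spanning_forests ?c G"
      using n ncomp_single[OF wf] by (auto simp: spanning_forests_iff[OF wf])
  qed
  have eq: "Poly_Mapping.single f 1 + product_monomial (edges G - {g}) = product_monomial (edges G) \<longleftrightarrow> f = g"
    if "g \<in> edges G" for f g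
  proof
    assume "Poly_Mapping.single f 1 + product_monomial (edges G - {g}) = product_monomial (edges G)"
    then have "Poly_Mapping.lookup (Poly_Mapping.single f 1 + product_monomial (edges G - {g})) g =
        Poly_Mapping.lookup (product_monomial (edges G)) g" by simp
    then show "f = g" using fin that
      by (simp add: lookup_add lookup_single lookup_product_monomial when_def split: if_splits)
  qed (use product_monomial_remove[OF fin] that in simp)
  have "Poly_Mapping.lookup (\<Sum>f\<in>edges G. \<Sum>F\<in>spanning_forests ?c G.
      Poly_Mapping.single (Poly_Mapping.single f 1 + product_monomial (edges G - F)) (of_real ((mass G f)\<^sup>2) :: 'k))
      (product_monomial (edges G)) =
    (\<Sum>f\<in>edges G. \<Sum>g | g \<in> edges G \<and> \<not> tadpole G g. if g = f then of_real ((mass G f)\<^sup>2) else 0)"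
    unfolding S0 using eq
    by (auto simp: Poly_Mapping.lookup_sum lookup_single when_def sum.reindex intro!: sum.cong)
  also have "\<dots> = (\<Sum>g | g \<in> edges G \<and> \<not> tadpole G g. \<Sum>f\<in>edges G. if g = f then of_real ((mass G f)\<^sup>2) else 0)"
    by (rule sum.swap)
  also have "\<dots> = (\<Sum>g | g \<in> edges G \<and> \<not> tadpole G g. of_real ((mass G g)\<^sup>2))"
    using fin by (intro sum.cong) auto
  finally show ?thesis
    unfolding Xi_eq[OF G] S1 by (simp add: lookup_add)
qed


section \<open>Uniqueness\<close>

text \<open>Quotients and subgraphs that should give back a known graph do so only up to the values
  of the record functions outside the carriers. The identity renaming makes such graphs equivalent,
  so P and C do not distinguish them.\<close>

definition same_on_carriers :: "('d::finite) fgraph \<Rightarrow> 'd fgraph \<Rightarrow> bool" where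
  "same_on_carriers G H \<longleftrightarrow> verts H = verts G \<and> edges H = edges G \<and> legs H = legs G \<and>
     (\<forall>e\<in>edges G. ends H e = ends G e \<and> mass H e = mass G e) \<and>
     (\<forall>i\<in>legs G. foot H i = foot G i \<and> mom H i = mom G i)"

lemma same_on_carriersD:
  assumes "same_on_carriers G H"
  shows "verts H = verts G" "edges H = edges G" "legs H = legs G"
    "e \<in> edges G \<Longrightarrow> ends H e = ends G e" "e \<in> edges G \<Longrightarrow> mass H e = mass G e"
    "i \<in> legs G \<Longrightarrow> foot H i = foot G i" "i \<in> legs G \<Longrightarrow> mom H i = mom G i"
  using assms by (auto simp: same_on_carriers_def)

lemma joined_same_on_carriers:
  "same_on_carriers G H \<Longrightarrow> F \<subseteq> edges G \<Longrightarrow> joined H F = joined G F"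
  by (intro joined_cong) (auto simp: same_on_carriers_def)

lemma mm_same_on_carriers:
  assumes "same_on_carriers G H"
  shows "mass_momentum_spanning H \<gamma> \<longleftrightarrow> mass_momentum_spanning G \<gamma>"
proof (cases "\<gamma> \<subseteq> edges G")
  case True
  note S = same_on_carriersD[OF assms]
  have T: "touched_verts H \<gamma> = touched_verts G \<gamma>" 
    unfolding touched_verts_def using S(4) True by (intro SUP_cong refl) auto
  have foot: "foot H ` legs G = foot G ` legs G" using S(6) by (rule image_cong[OF refl])
  show ?thesis
    unfolding mass_momentum_spanning_def joined_same_on_carriers[OF assms True] T S(2,3) foot
    using S(5,6) by simp
qed (use assms in \<open>simp add: mass_momentum_spanning_def same_on_carriers_def\<close>)

lemma wf_same_on_carriers: "same_on_carriers G H \<Longrightarrow> wf_graph G \<Longrightarrow> wf_graph H"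
  by (simp add: same_on_carriers_def wf_graph_def)

lemma motic_same_on_carriers:
  assumes "same_on_carriers G H" "motic_feynman_graph G"
  shows "motic_feynman_graph H"
proof -
  note S = same_on_carriersD[OF assms(1)]
  have F: "feynman_graph G" and M: "motic G" using assms(2) by (auto simp: motic_feynman_graph_def)
  note D = feynmanD[OF F]
  have wf: "wf_graph G" using F by (rule feynman_imp_wf)
  have wfH: "wf_graph H" using wf_same_on_carriers assms(1) wf by blast
  have momI: "sum (mom H) I = sum (mom G) I" if "I \<subseteq> legs G" for I
    using S(7) that by (intro sum.cong) auto
  have "feynman_graph H"
  proof (rule feynmanI)
    show "joined H (edges H) (foot H i) (foot H j)" if "i \<in> legs H" "j \<in> legs H" for i j
      using D(3)[of i j] that S joined_same_on_carriers[OF assms(1), of "edges G"] by simp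
    show "sum (mom H) I \<noteq> 0" if "I \<subset> legs H" "I \<noteq> {}" for I
      using D(5)[of I] momI[of I] that S(3) by auto
  qed (use wfH D(1,2,4) S momI[of "legs G"] in auto)
  moreover have "ncomp H X = ncomp G X" if "X \<subseteq> edges G" for X
    using that S by (intro ncomp_cong) auto
  then have "motic H"
    using M unfolding motic_iff[OF wf] motic_iff[OF wfH] mm_same_on_carriers[OF assms(1)] S(2) by auto
  ultimately show ?thesis by (simp add: motic_feynman_graph_def)
qed

lemma feynman_equiv_same_on_carriers:
  assumes "same_on_carriers G H" "motic_feynman_graph G"
  shows "feynman_equiv G H"
proof -
  note S = same_on_carriersD[OF assms(1)]
  have id: "map_uprod (\<lambda>x. x) p = p" for p :: "nat uprod" by (cases p) auto
  have "same_labelled_graph G H"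
    unfolding same_labelled_graph_def
    by (intro conjI exI[of _ "\<lambda>x. x"]) (use S id in \<open>auto simp: bij_betw_def\<close>)
  then show ?thesis
    unfolding feynman_equiv_def
    using assms motic_same_on_carriers[OF assms]
    by (intro r_into_equivclp) (simp add: motic_feynman_graph_def)
qed

section \<open>Isolated vertices, extremal monomials and the graphs that they force\<close>

lemma ncomp_add_vertex:
  assumes wf: "wf_graph G" and F: "F \<subseteq> edges G" and v: "v \<notin> verts G"
  shows "ncomp (G\<lparr>verts := insert v (verts G)\<rparr>) F = ncomp G F + 1"
proof -
  have rep: "rep (G\<lparr>verts := insert v (verts G)\<rparr>) F = rep G F" by (rule rep_cong) simp
  have "v \<notin> touched_verts G F" using touched_verts_subset[OF wf F] v by blast
  then have "rep G F v = v" using joined_touched(1)[OF joined_rep, of v G F] by metis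
  moreover have "v \<notin> rep G F ` verts G" using rep_verts[OF wf F] v by auto
  ultimately show ?thesis using wf by (simp add: ncomp_def rep wf_graph_def)
qed

lemma motic_add_vertex:
  assumes G: "motic_feynman_graph G" and v: "v \<notin> verts G"
  shows "motic_feynman_graph (G\<lparr>verts := insert v (verts G)\<rparr>)"
proof -
  let ?H = "G\<lparr>verts := insert v (verts G)\<rparr>"
  have F: "feynman_graph G" and M: "motic G" using G by (auto simp: motic_feynman_graph_def)
  note D = feynmanD[OF F]
  have wf: "wf_graph G" using F by (rule feynman_imp_wf)
  have wfH: "wf_graph ?H" using wf by (auto simp: wf_graph_def)
  have j: "joined ?H X = joined G X" for X by (rule joined_cong) simp
  have t: "touched_verts ?H X = touched_verts G X" for X by (simp add: touched_verts_def)
  have mm: "mass_momentum_spanning ?H X \<longleftrightarrow> mass_momentum_spanning G X" for X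
    by (simp add: mass_momentum_spanning_def j t)
  have "feynman_graph ?H"
  proof (rule feynmanI[OF wfH])
    show "joined ?H (edges ?H) (foot ?H i) (foot ?H j)" if "i \<in> legs ?H" "j \<in> legs ?H" for i j
      using D(3) that by (simp add: j)
    show "(\<Sum>i\<in>I. mom ?H i) \<noteq> 0" if "I \<subset> legs ?H" "I \<noteq> {}" for I
      using D(5)[of I] that by simp
  qed (use D(1,2,4) in auto)
  moreover have "motic ?H"
    using M v unfolding motic_iff[OF wf] motic_iff[OF wfH] mm by (simp add: ncomp_add_vertex[OF wf])
  ultimately show ?thesis by (simp add: motic_feynman_graph_def)
qed

lemma ncomp_eq_1:
  assumes "x \<in> verts G" "\<And>y. y \<in> verts G \<Longrightarrow> joined G F x y"
  shows "ncomp G F = 1"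
proof -
  have "rep G F ` verts G = {rep G F x}" 
  proof (intro equalityI subsetI)
    fix z assume "z \<in> rep G F ` verts G"
    then obtain y where "y \<in> verts G" "z = rep G F y" by blast
    then show "z \<in> {rep G F x}" using assms(2)[of y] rep_eq_iff[of G F x y] by simp
  qed (use assms(1) in simp)
  then show ?thesis by (simp add: ncomp_def)
qed

text \<open>The exponents are all at least 1 and add up to the number of variables.\<close>

lemma product_monomialI:
  assumes "finite E" "Poly_Mapping.keys m \<subseteq> E" "\<And>e. e \<in> E \<Longrightarrow> Poly_Mapping.lookup m e \<noteq> 0"
    and "degree_in E m = card E"
  shows "m = product_monomial E"
proof (rule poly_mapping_eqI)
  fix e
  have "(\<Sum>e\<in>E. 1) = (\<Sum>e\<in>E. Poly_Mapping.lookup m e)" using assms(4) by (simp add: degree_in_def)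
  then have "1 = Poly_Mapping.lookup m e" if "e \<in> E"
    using sum_mono_inv[of "\<lambda>_. 1" E "Poly_Mapping.lookup m" e] assms(1,3) that by (simp add: Suc_le_eq)
  moreover have "Poly_Mapping.lookup m e = 0" if "e \<notin> E" using assms(2) that by (auto simp: in_keys_iff)
  ultimately show "Poly_Mapping.lookup m e = Poly_Mapping.lookup (product_monomial E) e"
    using assms(1) by (auto simp: lookup_product_monomial)
qed

lemma card_le_degree_in:
  assumes "finite E" "\<And>e. e \<in> E \<Longrightarrow> Poly_Mapping.lookup m e \<noteq> 0"
  shows "card E \<le> degree_in E m"
  using sum_mono[of E "\<lambda>_. 1" "Poly_Mapping.lookup m"] assms by (simp add: degree_in_def Suc_le_eq)

lemma lookup_neq_homogeneous:
  assumes "homogeneous_in A d p" "homogeneous_in A d q"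
    and "Poly_Mapping.lookup p m \<noteq> Poly_Mapping.lookup q m"
  shows "Poly_Mapping.keys m \<subseteq> A" "degree_in A m = d"
proof -
  have "m \<in> Poly_Mapping.keys p \<or> m \<in> Poly_Mapping.keys q" using assms(3) by (auto simp: in_keys_iff)
  then show "Poly_Mapping.keys m \<subseteq> A" "degree_in A m = d"
    using assms(1,2) by (auto simp: homogeneous_in_def)
qed

text \<open>Setting the variable of e to 0 preserves the coefficients of all monomials without it,
  so a discrepancy can only sit at a monomial divisible by it.\<close>

lemma lookup_neq_set_zero:
  assumes "set_zero e p = set_zero e q" "Poly_Mapping.lookup p m \<noteq> Poly_Mapping.lookup q m"
  shows "Poly_Mapping.lookup m e \<noteq> 0"
  using arg_cong[OF assms(1), of "\<lambda>p. Poly_Mapping.lookup p m"] assms(2)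
  by (auto simp: lookup_set_zero split: if_splits)

lemma ncomp_subgraph_discrete:
  assumes "wf_graph G" "\<gamma> \<subseteq> edges G" "ncomp G \<gamma> = card (verts G)"
  shows "ncomp (subgraph G \<gamma>) \<gamma> = card (touched_verts G \<gamma>)"
proof -
  have "card (touched_verts G \<gamma>) \<le> card (verts G)"
    using touched_verts_subset[OF assms(1,2)] assms(1) by (intro card_mono) (auto simp: wf_graph_def)
  then show ?thesis using ncomp_subgraph[OF assms(1,2) order_refl] assms(3) by simp
qed

text \<open>A tadpole is never a bridge, whatever masses and half-edges the subgraph
  inherits.\<close>

lemma motic_subgraph_tadpole:
  assumes wf: "wf_graph G" and e: "e \<in> edges G" "tadpole G e"
  shows "motic_subgraph G {e}" "loops (subgraph G {e}) = 1"
proof -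
  show "motic_subgraph G {e}" using e ncomp_single[OF wf e(1)] by (intro motic_subgraphI[OF wf]) auto
  show "loops (subgraph G {e}) = 1" using e ncomp_single[OF wf e(1)] loops_subgraph[OF wf, of "{e}"] by simp
qed

lemma rep_tadpole: "tadpole G e \<Longrightarrow> rep G {e} x = x"
  unfolding tadpole_def using rep_single[of G e _ _ x] by fastforce

lemma map_uprod_rep_tadpole: "tadpole G e \<Longrightarrow> map_uprod (rep G {e}) p = p"
  by (cases p) (simp add: rep_tadpole)

text \<open>The edge e alone already reduces the number of components to that of G, so any other
  edge has its ends joined by e.\<close>

lemma banana_ends:
  assumes wf: "wf_graph G" and n: "ncomp G (edges G) + 1 = card (verts G)"
    and nt: "\<And>f. f \<in> edges G \<Longrightarrow> \<not> tadpole G f"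
    and e: "e \<in> edges G" "ends G e = Upair u v" and f: "f \<in> edges G"
  shows "ends G f = Upair u v"
proof (cases "f = e")
  case False
  obtain a b where ab: "ends G f = Upair a b" by (cases "ends G f") auto
  then have ne: "a \<noteq> b" using nt[OF f] by (auto simp: tadpole_def)
  have "ncomp G {e} + 1 = card (verts G)" using ncomp_single[OF wf e(1)] nt[OF e(1)] n by simp
  moreover have "ncomp G (edges G) \<le> ncomp G (insert f {e})" using e f by (intro ncomp_antimono[OF wf]) auto
  ultimately have "joined G {e} a b"
    using ncomp_insert[OF wf, of "{e}" f a b] e f False ab n by (auto split: if_splits)
  then have "a \<in> {u, v}" "b \<in> {u, v}" using joined_touched[of G "{e}" a b] ne e by (auto simp: touched_verts_def)
  then show ?thesis using ne ab by auto
qed (use e in simp)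

section \<open>The hypotheses on both polynomials, and uniqueness of the first one\<close>

locale motic_recursion =
  fixes P C :: "('d::finite) fgraph \<Rightarrow> 'k::real_field epoly"
  assumes homogeneous_P: "\<And>G. motic_feynman_graph G \<Longrightarrow> homogeneous_in (edges G) (loops G) (P G)"
    and homogeneous_C: "\<And>G. motic_feynman_graph G \<Longrightarrow> homogeneous_in (edges G) (loops G + 1) (C G)"
    and equivalence: "\<And>G H. motic_feynman_graph G \<Longrightarrow> motic_feynman_graph H \<Longrightarrow> feynman_equiv G H \<Longrightarrow>
      P G = P H \<and> C G = C H"
    and isolated_vertex: "\<And>G v. motic_feynman_graph G \<Longrightarrow> v \<notin> verts G \<Longrightarrow>
      P (G\<lparr>verts := insert v (verts G)\<rparr>) = P G \<and> C (G\<lparr>verts := insert v (verts G)\<rparr>) = C G"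
    and factorisation_P: "\<And>G \<gamma>. motic_feynman_graph G \<Longrightarrow> motic_subgraph G \<gamma> \<Longrightarrow>
      agree_to_degree \<gamma> (loops (subgraph G \<gamma>)) (P G) (P (subgraph G \<gamma>) * P (contraction G \<gamma>))"
    and factorisation_C_not_mm: "\<And>G \<gamma>. motic_feynman_graph G \<Longrightarrow> motic_subgraph G \<gamma> \<Longrightarrow>
      \<not> mass_momentum_spanning G \<gamma> \<Longrightarrow>
      agree_to_degree \<gamma> (loops (subgraph G \<gamma>)) (C G) (P (subgraph G \<gamma>) * C (contraction G \<gamma>))"
    and factorisation_C_mm: "\<And>G \<gamma>. motic_feynman_graph G \<Longrightarrow> motic_subgraph G \<gamma> \<Longrightarrow>
      mass_momentum_spanning G \<gamma> \<Longrightarrow>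
      agree_to_degree \<gamma> (loops (subgraph G \<gamma>) + 1) (C G) (C (subgraph G \<gamma>) * P (contraction G \<gamma>))"
    and contraction_P: "\<And>G e. motic_feynman_graph G \<Longrightarrow> e \<in> edges G \<Longrightarrow>
      set_zero e (P G) = (if tadpole G e then 0 else P (contraction G {e}))"
    and contraction_C: "\<And>G e. motic_feynman_graph G \<Longrightarrow> e \<in> edges G \<Longrightarrow>
      set_zero e (C G) = (if tadpole G e then 0 else C (contraction G {e}))"
    and single_edge: "\<And>G. motic_feynman_graph G \<Longrightarrow> card (edges G) = 1 \<Longrightarrow>
      P G = Psi G \<and> C G = Xi G"
    and massive_banana: "\<And>G v. motic_feynman_graph G \<Longrightarrow> banana G \<Longrightarrow> \<forall>e\<in>edges G. mass G e \<noteq> 0 \<Longrightarrow>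
      v \<in> verts G \<Longrightarrow>
      Poly_Mapping.lookup (C G) (product_monomial (edges G)) =
        of_real (momentum_into G {v} \<bullet> momentum_into G {v} + (\<Sum>e\<in>edges G. (mass G e)\<^sup>2))"
begin

lemma same_on_carriers_eq:
  assumes "motic_feynman_graph G" "same_on_carriers G H"
  shows "P H = P G" "C H = C G"
  using equivalence[OF assms(1) motic_same_on_carriers[OF assms(2,1)]
      feynman_equiv_same_on_carriers[OF assms(2,1)]] by auto

lemma isolated_vertices:
  assumes "motic_feynman_graph G" "finite A" "A \<inter> verts G = {}"
  shows "motic_feynman_graph (G\<lparr>verts := A \<union> verts G\<rparr>) \<and> C (G\<lparr>verts := A \<union> verts G\<rparr>) = C G"
  using assms(2,3)
proof (induction A rule: finite_induct)
  case (insert v A)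
  let ?H = "G\<lparr>verts := A \<union> verts G\<rparr>"
  have "motic_feynman_graph ?H" "C ?H = C G" using insert by auto
  then show ?case
    using motic_add_vertex[of ?H v] isolated_vertex[of ?H v] insert by simp
qed (use assms(1) in simp)

text \<open>
  Attaching a tadpole to the graph and contracting it again, the factorisation of the tadpole
  graph forces the constant \<open>P G\<close> to be 1.
\<close>

lemma P_edgeless_nonempty:
  assumes G: "motic_feynman_graph G" and E: "edges G = {}" and V: "verts G \<noteq> {}"
  shows "P G = 1"
proof -
  have F: "feynman_graph G" using G by (simp add: motic_feynman_graph_def)
  note D = feynmanD[OF F]
  have feet: "foot G i = foot G j" if "i \<in> legs G" "j \<in> legs G" for i j
    using D(3)[OF that] E by simp
  obtain v where v: "v \<in> verts G" "\<And>i. i \<in> legs G \<Longrightarrow> foot G i = v"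
  proof (cases "legs G = {}")
    case False
    then obtain j where "j \<in> legs G" by blast
    then show ?thesis using that[of "foot G j"] feet D(2) by blast
  qed (use V that in blast)
  define T where "T = G\<lparr>edges := {0}, ends := \<lambda>_. Upair v v\<rparr>"
  have T: "verts T = verts G" "edges T = {0}" "ends T e = Upair v v" "mass T = mass G" "legs T = legs G"
    "foot T = foot G" "mom T = mom G" for e by (simp_all add: T_def)
  have tp: "tadpole T 0" by (auto simp: tadpole_def T)
  have wf: "wf_graph T" using feynman_imp_wf[OF F] v by (simp add: wf_graph_def T)
  have FT: "feynman_graph T"
  proof (rule feynmanI[OF wf])
    show "joined T (edges T) (foot T i) (foot T j)" if "i \<in> legs T" "j \<in> legs T" for i j
      using feet[of i j] that by (simp add: T)
    show "(\<Sum>i\<in>I. mom T i) \<noteq> 0" if "I \<subset> legs T" "I \<noteq> {}" for I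
      using D(5)[of I] that by (simp add: T)
  qed (use D(1,2,4) in \<open>auto simp: T\<close>)
  have n: "ncomp T {0} = card (verts T)" using ncomp_single[OF wf] tp by (simp add: T)
  have "motic T" unfolding motic_iff[OF wf] using n by (simp add: T)
  then have MT: "motic_feynman_graph T" using FT by (simp add: motic_feynman_graph_def)
  have sub: "motic_subgraph T {0}" "loops (subgraph T {0}) = 1"
    using motic_subgraph_tadpole[OF wf _ tp] by (auto simp: T)
  have MS: "motic_feynman_graph (subgraph T {0})" using sub motic_subgraph_iff[OF FT, of "{0}"] by (simp add: T)
  have PT: "P T = Poly_Mapping.single (Poly_Mapping.single 0 1) 1"
    using single_edge[OF MT] Psi_discrete[OF wf] n by (simp add: T product_monomial_def)
  have PS: "P (subgraph T {0}) = Poly_Mapping.single (Poly_Mapping.single 0 1) 1"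
    using single_edge[OF MS] Psi_discrete[OF wf_subgraph[OF wf], of "{0}"] ncomp_subgraph_discrete[OF wf _ n]
    by (simp add: T product_monomial_def)
  \<comment> \<open>T and its tadpole subgraph both have one edge, so both values are the edge
    variable; its coefficient isolates the constant term of P on the quotient, which agrees with G
    on carriers.\<close>
  have "Poly_Mapping.lookup (P T) (Poly_Mapping.single 0 1) =
      Poly_Mapping.lookup (P (subgraph T {0}) * P (contraction T {0})) (Poly_Mapping.single 0 1)"
    by (rule agreeD[OF factorisation_P[OF MT sub(1)]]) (simp add: sub(2) degree_in_single)
  then have "Poly_Mapping.lookup (P (contraction T {0})) 0 = 1"
    using lookup_single_mult[of "Poly_Mapping.single 0 1" 1 "P (contraction T {0})" 0] by (simp add: PT PS)
  moreover have "same_on_carriers G (contraction T {0})"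
    unfolding same_on_carriers_def using tp by (simp add: T E rep_tadpole)
  then have "P (contraction T {0}) = P G" by (rule same_on_carriers_eq(1)[OF G])
  ultimately have one: "Poly_Mapping.lookup (P G) 0 = 1" by simp
  show ?thesis
  proof (rule poly_mapping_eqI)
    fix m
    show "Poly_Mapping.lookup (P G) m = Poly_Mapping.lookup 1 m"
    proof (cases "m = 0")
      case False
      then have "\<not> Poly_Mapping.keys m \<subseteq> {}" by auto
      then have "m \<notin> Poly_Mapping.keys (P G)"
        using homogeneous_P[OF G] E by (auto simp: homogeneous_in_def)
      then show ?thesis using False by (simp add: in_keys_iff lookup_one when_def)
    qed (simp add: one)
  qed
qed

text \<open>The graph without vertices offers no place for a tadpole and is given an isolated vertex
  before the argument applies.\<close>

lemma P_edgeless: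
  assumes G: "motic_feynman_graph G" and E: "edges G = {}"
  shows "P G = 1"
proof (cases "verts G = {}")
  case True
  let ?H = "G\<lparr>verts := insert 0 (verts G)\<rparr>"
  have "motic_feynman_graph ?H" "P ?H = P G"
    using motic_add_vertex[OF G] isolated_vertex[OF G] True by blast+
  then show ?thesis using P_edgeless_nonempty[of ?H] E by simp
qed (rule P_edgeless_nonempty[OF assms])

lemma P_eq_Psi: "motic_feynman_graph G \<Longrightarrow> P G = Psi G"
proof (induction "card (edges G)" arbitrary: G rule: less_induct)
  case less
  note G = less.prems
  have F: "feynman_graph G" using G by (simp add: motic_feynman_graph_def)
  have wf: "wf_graph G" using G by (rule motic_feynman_wf)
  have fin: "finite (edges G)" using wf by (simp add: wf_graph_def)
  have IH: "P (contraction G {e}) = Psi (contraction G {e})" if e: "e \<in> edges G" for e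
  proof (rule less.hyps)
    show "card (edges (contraction G {e})) < card (edges G)"
      using e fin by (simp add: card_Diff1_less del: card_Diff_insert)
    show "motic_feynman_graph (contraction G {e})" using G e by (intro motic_contraction) auto
  qed
  show ?case
  proof (cases "card (edges G) \<le> 1")
    case True
    show ?thesis
    proof (cases "edges G = {}")
      case True
      then show ?thesis
        using P_edgeless[OF G] Psi_discrete[OF wf] by simp
    next
      case False
      then have "card (edges G) \<noteq> 0" using fin by simp
      then show ?thesis using single_edge[OF G] True by linarith
    qed
  next
    case False
    show ?thesis
    proof (rule poly_mapping_eqI, rule ccontr)
      fix m assume neq: "Poly_Mapping.lookup (P G) m \<noteq> Poly_Mapping.lookup (Psi G) m"
      have pos: "Poly_Mapping.lookup m e \<noteq> 0" if e: "e \<in> edges G" for e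
        by (rule lookup_neq_set_zero[OF _ neq]) (simp add: contraction_P[OF G e] set_zero_Psi[OF wf e] IH[OF e])
      note m = lookup_neq_homogeneous[OF homogeneous_P[OF G] homogeneous_Psi[OF wf] neq]
      \<comment> \<open>The degree of m is at least the number of edges and equals
        \<open>card (edges G) + ncomp G (edges G) - card (verts G)\<close>, while
        \<open>ncomp G (edges G)\<close> is at most \<open>card (verts G)\<close>; so equality holds
        in both places.\<close>
      have n: "ncomp G (edges G) = card (verts G)" and deg: "degree_in (edges G) m = card (edges G)"
        using card_le_degree_in[OF fin pos] ncomp_le_card_verts[OF wf, of "edges G"]
          card_verts_le[OF wf order_refl] m(2) by (auto simp: loops_eq)
      have meq: "m = product_monomial (edges G)" by (rule product_monomialI[OF fin m(1) pos deg])
      obtain e where e: "e \<in> edges G" using False fin by fastforce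
      have ne: "ncomp G {e} = card (verts G)"
        using ncomp_antimono[OF wf, of "{e}" "edges G"] ncomp_le_card_verts[OF wf, of "{e}"] n e by simp
      then have tp: "tadpole G e" using ncomp_single[OF wf e] card_verts_pos[OF wf e] by (auto split: if_splits)
      note sub = motic_subgraph_tadpole[OF wf e tp]
      have MS: "motic_feynman_graph (subgraph G {e})" using sub motic_subgraph_iff[OF F, of "{e}"] e by simp
      have PS: "P (subgraph G {e}) = Poly_Mapping.single (Poly_Mapping.single e 1) 1"
        using single_edge[OF MS] Psi_discrete[OF wf_subgraph[OF wf], of "{e}"] ncomp_subgraph_discrete[OF wf _ ne] e
        by (simp add: product_monomial_def)
      \<comment> \<open>The exponent of e in m is 1, the loop number of the tadpole, so the
        factorisation decides this coefficient.\<close>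
      have "Poly_Mapping.lookup (P G) m = Poly_Mapping.lookup (P (subgraph G {e}) * P (contraction G {e})) m"
        by (rule agreeD[OF factorisation_P[OF G sub(1)]])
          (use e fin in \<open>simp add: sub(2) meq degree_in_product_monomial\<close>)
      also have "\<dots> = Poly_Mapping.lookup (Psi (contraction G {e})) (product_monomial (edges G - {e}))"
        unfolding meq product_monomial_remove[OF fin e] PS IH[OF e] lookup_single_mult by simp
      also have "\<dots> = 1"
        by (subst Psi_discrete[OF wf_contraction[OF wf]])
          (use n ne e in \<open>simp_all add: ncomp_contraction_full card_verts_contraction del: contraction_simps(1)\<close>)
      also have "\<dots> = Poly_Mapping.lookup (Psi G) m" unfolding Psi_discrete[OF wf n] meq by simp
      finally show False using neq by simp
    qed
  qed
qed

section \<open>Uniqueness of the second polynomial\<close>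

lemma C_tadpole_step:
  assumes G: "motic_feynman_graph G" and e: "e \<in> edges G" "tadpole G e" and m: "Poly_Mapping.lookup m e = 0"
    and IH: "Poly_Mapping.lookup (C (contraction G {e})) m = Poly_Mapping.lookup (Xi (contraction G {e})) m"
  shows "Poly_Mapping.lookup (C G) (Poly_Mapping.single e 1 + m) =
    Poly_Mapping.lookup (Xi G) (Poly_Mapping.single e 1 + m)"
proof -
  let ?m = "Poly_Mapping.single e 1 + m"
  have F: "feynman_graph G" using G by (simp add: motic_feynman_graph_def)
  have wf: "wf_graph G" using G by (rule motic_feynman_wf)
  have esub: "{e} \<subseteq> edges G" using e by simp
  have ne: "ncomp G {e} = card (verts G)" using ncomp_single[OF wf e(1)] e by simp
  have deg: "degree_in {e} ?m = 1" using m by (simp add: degree_in_def lookup_add)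
  note sub = motic_subgraph_tadpole[OF wf e]
  have MS: "motic_feynman_graph (subgraph G {e})" using sub motic_subgraph_iff[OF F esub] by simp
  have FS: "feynman_graph (subgraph G {e})" using feynman_subgraph[OF F esub] .
  have wfS: "wf_graph (subgraph G {e})" using FS by (rule feynman_imp_wf)
  have single: "P (subgraph G {e}) = Psi (subgraph G {e})" "C (subgraph G {e}) = Xi (subgraph G {e})"
    using single_edge[OF MS] by auto
  have nS: "ncomp (subgraph G {e}) (edges (subgraph G {e})) = card (verts (subgraph G {e}))"
    using ncomp_subgraph_discrete[OF wf esub ne] by simp
  have XiG: "Poly_Mapping.lookup (Xi G :: 'k epoly) ?m = Poly_Mapping.lookup (Xi (contraction G {e})) m"
    by (rule lookup_Xi_tadpole[OF F e m])
  show ?thesis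
  proof (cases "mass_momentum_spanning G {e}")
    case False
    have PS: "P (subgraph G {e}) = Poly_Mapping.single (Poly_Mapping.single e 1) 1"
      unfolding single Psi_discrete[OF wfS nS] by (simp add: product_monomial_def)
    have "Poly_Mapping.lookup (C G) ?m = Poly_Mapping.lookup (P (subgraph G {e}) * C (contraction G {e})) ?m"
      by (rule agreeD[OF factorisation_C_not_mm[OF G sub(1) False]]) (use sub(2) deg in simp)
    also have "\<dots> = Poly_Mapping.lookup (Xi (contraction G {e})) m"
      unfolding PS lookup_single_mult by (simp add: IH)
    finally show ?thesis unfolding XiG .
  next
    case True
    \<comment> \<open>An m.m. tadpole has C equal to its squared mass times the square of its
      variable, whereas the monomial at hand is linear in that variable: its coefficient in C G is
      0.\<close>
    have CS: "C (subgraph G {e}) =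
        Poly_Mapping.single (Poly_Mapping.single e 1 + Poly_Mapping.single e 1) (of_real ((mass (subgraph G {e}) e)\<^sup>2))"
      unfolding single Xi_eq[OF FS] spanning_forests_discrete[OF wfS nS] by (simp add: product_monomial_def)
    have "Poly_Mapping.lookup (C G) ?m = Poly_Mapping.lookup (C (subgraph G {e}) * P (contraction G {e})) ?m"
      by (rule agreeD[OF factorisation_C_mm[OF G sub(1) True]]) (use sub(2) deg in simp)
    also have "\<dots> = 0"
      unfolding CS by (rule lookup_single_mult_eq_0[of _ e]) (simp add: lookup_add m)
    finally have CG: "Poly_Mapping.lookup (C G) ?m = 0" .
    \<comment> \<open>All massive edges lie in {e} and all half-edges at its vertex, so the quotient
      has neither masses nor separable momenta.\<close>
    have "Xi (contraction G {e}) = (0 :: 'k epoly)"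
    proof (rule Xi_eq_0)
      show "feynman_graph (contraction G {e})" using F esub by (rule feynman_contraction)
      show "mass (contraction G {e}) f = 0" if "f \<in> edges (contraction G {e})" for f
        using True that by (auto simp: mass_momentum_spanning_def)
      show "foot (contraction G {e}) i = foot (contraction G {e}) j"
        if "i \<in> legs (contraction G {e})" "j \<in> legs (contraction G {e})" for i j
        using True that by (simp add: mass_momentum_spanning_def rep_eq_iff)
    qed
    then show ?thesis using CG XiG by simp
  qed
qed

lemma C_banana:
  assumes G: "motic_feynman_graph G" and n: "ncomp G (edges G) + 1 = card (verts G)"
    and nt: "\<And>f. f \<in> edges G \<Longrightarrow> \<not> tadpole G f"
    and feet: "foot G ` legs G \<subseteq> touched_verts G (edges G)"
  shows "Poly_Mapping.lookup (C G) (product_monomial (edges G)) =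
    Poly_Mapping.lookup (Xi G) (product_monomial (edges G))"
proof -
  have F: "feynman_graph G" and M: "motic G" using G by (auto simp: motic_feynman_graph_def)
  note D = feynmanD[OF F]
  have wf: "wf_graph G" using F by (rule feynman_imp_wf)
  have fin: "finite (edges G)" using wf by (simp add: wf_graph_def)
  define A where "A = {e \<in> edges G. mass G e \<noteq> 0}"
  show ?thesis
  proof (cases "A = {} \<and> legs G = {}")
    \<comment> \<open>Without masses and half-edges even the empty set is m.m., and a single edge
      would not be motic. Factorising over the empty set gives 0, since its C is homogeneous of
      degree 1 in no variables.\<close>
    case True
    then have mm: "mass_momentum_spanning G {}" by (auto simp: mass_momentum_spanning_def A_def)
    have sub: "motic_subgraph G {}" by (rule motic_subgraphI[OF wf]) auto
    have "C (subgraph G {}) = 0"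
    proof (rule poly_mapping_eqI)
      fix m
      have "motic_feynman_graph (subgraph G {})" using sub motic_subgraph_iff[OF F, of "{}"] by simp
      then have "homogeneous_in {} (loops (subgraph G {}) + 1) (C (subgraph G {}))"
        using homogeneous_C[of "subgraph G {}"] by simp
      then show "Poly_Mapping.lookup (C (subgraph G {})) m = Poly_Mapping.lookup 0 m"
        by (auto simp: homogeneous_in_def degree_in_def in_keys_iff)
    qed
    then have "Poly_Mapping.lookup (C G) m = 0" for m
      using agreeD[OF factorisation_C_mm[OF G sub mm], of m] by (simp add: degree_in_def)
    moreover have "Xi G = (0 :: 'k epoly)" using True by (intro Xi_eq_0[OF F]) (auto simp: A_def)
    ultimately show ?thesis by simp
  next
    case nontrivial: False
    have "edges G \<noteq> {}" using n by auto
    then obtain e where e: "e \<in> edges G" by blast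
    obtain u v where uv: "ends G e = Upair u v" "u \<in> verts G" "v \<in> verts G" using wf e by (rule wf_endsE)
    have ends: "ends G f = Upair u v" if "f \<in> edges G" for f by (rule banana_ends[OF wf n nt e uv(1) that])
    have "u \<noteq> v" using nt[OF e] uv by (auto simp: tadpole_def)
    define \<gamma> where "\<gamma> = (if A = {} then {e} else A)"
    have \<gamma>: "\<gamma> \<subseteq> edges G" "\<gamma> \<noteq> {}" "A \<subseteq> \<gamma>" using e by (auto simp: \<gamma>_def A_def)
    have fin\<gamma>: "finite \<gamma>" using \<gamma>(1) fin by (rule finite_subset)
    have touched: "touched_verts G X = {u, v}" if "X \<subseteq> edges G" "X \<noteq> {}" for X
    proof -
      have "set_uprod (ends G f) = {u, v}" if "f \<in> X" for f
        using ends[of f] \<open>X \<subseteq> edges G\<close> that by auto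
      then show ?thesis using that(2) by (auto simp: touched_verts_def)
    qed
    have feet_uv: "foot G i \<in> {u, v}" if "i \<in> legs G" for i
      using feet touched[of "edges G"] e that by auto
    obtain g where g: "g \<in> \<gamma>" using \<gamma>(2) by blast
    have "joined G \<gamma> u v" using joined_edge[OF g] ends[of g] g \<gamma>(1) by blast
    then have joined_uv: "joined G \<gamma> x y" if "x \<in> {u, v}" "y \<in> {u, v}" for x y
      using that joined_sym by auto
    have mm: "mass_momentum_spanning G \<gamma>"
      unfolding mass_momentum_spanning_def
    proof (intro conjI ballI impI)
      show "f \<in> \<gamma>" if "f \<in> edges G" "mass G f \<noteq> 0" for f using that \<gamma>(3) by (auto simp: A_def)
      show "foot G ` legs G \<subseteq> touched_verts G \<gamma>" using feet_uv touched[OF \<gamma>(1,2)] by auto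
      show "joined G \<gamma> (foot G i) (foot G j)" if "i \<in> legs G" "j \<in> legs G" for i j
        using joined_uv feet_uv that by blast
    qed (rule \<gamma>(1))
    have n\<gamma>: "ncomp G \<gamma> = ncomp G (edges G)"
    proof (rule antisym)
      have "ncomp G \<gamma> \<le> ncomp G {g}" using g by (intro ncomp_antimono[OF wf]) auto
      also have "\<dots> = ncomp G (edges G)" using ncomp_single[OF wf, of g] nt[of g] g \<gamma>(1) n by auto
      finally show "ncomp G \<gamma> \<le> ncomp G (edges G)" .
      show "ncomp G (edges G) \<le> ncomp G \<gamma>" by (rule ncomp_antimono[OF wf \<gamma>(1)])
    qed
    have sub: "motic_subgraph G \<gamma>"
    proof (rule motic_subgraphI[OF wf \<gamma>(1)])
      fix f assume f: "f \<in> \<gamma>" and mf: "mass_momentum_spanning (subgraph G \<gamma>) (\<gamma> - {f})"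
      \<comment> \<open>Minimality: without massive edges, \<gamma> is a single edge carrying the
        existing half-edges; otherwise every edge of \<gamma> is massive.\<close>
      have False
      proof (cases "A = {}")
        case True
        then have "\<gamma> - {f} = {}" "legs G \<noteq> {}" using f nontrivial by (auto simp: \<gamma>_def)
        then show False using mf mm by (auto simp: mass_momentum_spanning_def touched_verts_def)
      next
        case False
        then have "f \<in> A" using f by (simp add: \<gamma>_def)
        then have "mass (subgraph G \<gamma>) f \<noteq> 0" using mm by (simp add: A_def)
        then show False using mf f by (auto simp: mass_momentum_spanning_def)
      qed
      then show "ncomp G (\<gamma> - {f}) = ncomp G \<gamma>" ..
    qed
    let ?S = "subgraph G \<gamma>"
    have MS: "motic_feynman_graph ?S" using sub motic_subgraph_iff[OF F \<gamma>(1)] by simp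
    have FS: "feynman_graph ?S" using MS by (simp add: motic_feynman_graph_def)
    have vS: "verts ?S = {u, v}" using touched[OF \<gamma>(1,2)] by simp
    have "card {u, v} \<le> card (verts G)" using uv wf by (intro card_mono) (auto simp: wf_graph_def)
    then have nS: "ncomp ?S \<gamma> = 1"
      using ncomp_subgraph[OF wf \<gamma>(1) order_refl] n n\<gamma> touched[OF \<gamma>(1,2)] \<open>u \<noteq> v\<close> by simp
    have ntS: "\<not> tadpole ?S f" if "f \<in> \<gamma>" for f using nt[of f] that \<gamma>(1) by (auto simp: tadpole_def)
    have loops: "loops ?S + 1 = card \<gamma>"
    proof -
      have "card \<gamma> \<noteq> 0" using \<gamma>(2) fin\<gamma> by simp
      then show ?thesis using loops_subgraph[OF wf \<gamma>(1)] n\<gamma> n by simp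
    qed
    have w: "momentum_weight G {} = momentum_into G {u} \<bullet> momentum_into G {u}"
    proof (rule momentum_weight_bipartition[OF D(1,4)])
      show "joined G {} (foot G i) (foot G j) \<longleftrightarrow> (foot G i \<in> {u} \<longleftrightarrow> foot G j \<in> {u})"
        if "i \<in> legs G" "j \<in> legs G" for i j
        using feet_uv[OF that(1)] feet_uv[OF that(2)] \<open>u \<noteq> v\<close> by auto
    qed
    have wS: "momentum_weight ?S {} = momentum_weight G {}" using mm by (simp add: momentum_weight_def cong: if_cong)
    have masses: "(\<Sum>f\<in>\<gamma>. (mass G f)\<^sup>2) = (\<Sum>f\<in>edges G. (mass G f)\<^sup>2)"
      by (rule sum.mono_neutral_left[OF fin \<gamma>(1)]) (use \<gamma>(3) in \<open>auto simp: A_def\<close>)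
    have CS: "Poly_Mapping.lookup (C ?S) (product_monomial \<gamma>) =
        of_real (momentum_weight G {} + (\<Sum>f\<in>edges G. (mass G f)\<^sup>2))"
    proof (cases "A = {}")
      case True
      have "C ?S = Xi ?S" using single_edge[OF MS] True by (simp add: \<gamma>_def)
      moreover have "Poly_Mapping.lookup (Xi ?S :: 'k epoly) (product_monomial (edges ?S)) =
          of_real (momentum_weight ?S {} + (\<Sum>f | f \<in> edges ?S \<and> \<not> tadpole ?S f. (mass ?S f)\<^sup>2))"
        by (rule lookup_Xi_top[OF FS]) (use nS vS \<open>u \<noteq> v\<close> in simp)
      moreover have "{f. f \<in> edges ?S \<and> \<not> tadpole ?S f} = \<gamma>" using ntS by auto
      ultimately show ?thesis unfolding masses[symmetric] using mm by (simp add: wS)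
    next
      case False
      have "banana ?S"
        unfolding banana_def card_components_full vS using nS ntS \<open>u \<noteq> v\<close> by simp
      moreover have "\<forall>f\<in>edges ?S. mass ?S f \<noteq> 0" 
      proof -
        have "\<gamma> = A" using False by (simp add: \<gamma>_def)
        then show ?thesis using mm by (auto simp: A_def)
      qed
      ultimately have "Poly_Mapping.lookup (C ?S) (product_monomial (edges ?S)) =
          of_real (momentum_into ?S {u} \<bullet> momentum_into ?S {u} + (\<Sum>f\<in>edges ?S. (mass ?S f)\<^sup>2))"
        using vS by (intro massive_banana[OF MS]) auto
      moreover have "momentum_into ?S {u} = momentum_into G {u}" using mm by (simp add: momentum_into_def)
      ultimately show ?thesis unfolding masses[symmetric] w using mm by simp
    qed
    have PC: "P (contraction G \<gamma>) = Poly_Mapping.single (product_monomial (edges G - \<gamma>)) 1"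
    proof -
      have "edges G - \<gamma> \<union> \<gamma> = edges G" using \<gamma>(1) by auto
      then have "ncomp (contraction G \<gamma>) (edges (contraction G \<gamma>)) = card (verts (contraction G \<gamma>))"
        unfolding ncomp_contraction card_verts_contraction by (simp add: n\<gamma>)
      then show ?thesis
        using P_eq_Psi[OF motic_contraction[OF G \<gamma>(1)]] Psi_discrete[OF wf_contraction[OF wf]] by simp
    qed
    have split: "product_monomial (edges G) = product_monomial (edges G - \<gamma>) + product_monomial \<gamma>"
      using product_monomial_Un[of "edges G - \<gamma>" \<gamma>] fin fin\<gamma> \<gamma>(1) by (simp add: Un_absorb2 Diff_disjoint inf_commute)
    \<comment> \<open>The monomial has degree \<open>card \<gamma>\<close> =
      \<open>loops ?S + 1\<close> in \<gamma>, exactly the bound up to which the factorisation is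
      informative.\<close>
    have "Poly_Mapping.lookup (C G) (product_monomial (edges G)) =
        Poly_Mapping.lookup (C ?S * P (contraction G \<gamma>)) (product_monomial (edges G))"
      by (rule agreeD[OF factorisation_C_mm[OF G sub mm]])
        (use fin fin\<gamma> \<gamma>(1) loops in \<open>simp add: degree_in_product_monomial inf_absorb1\<close>)
    also have "\<dots> = Poly_Mapping.lookup (C ?S) (product_monomial \<gamma>)"
      unfolding PC split mult.commute[of "C ?S"] lookup_single_mult by simp
    also have "\<dots> = Poly_Mapping.lookup (Xi G) (product_monomial (edges G))"
    proof -
      have "{f. f \<in> edges G \<and> \<not> tadpole G f} = edges G" using nt by auto
      then show ?thesis unfolding CS lookup_Xi_top[OF F n] by simp
    qed
    finally show ?thesis .
  qed
qed

text \<open>The half-edges are required to sit on non-tadpole edges because this property survives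
  the removal of tadpoles, whereas a vertex touched by tadpoles alone would end up
  untouched.\<close>

lemma C_banana_tadpoles:
  assumes "motic_feynman_graph G" "ncomp G (edges G) + 1 = card (verts G)"
    and "\<And>i. i \<in> legs G \<Longrightarrow> \<exists>e\<in>edges G. \<not> tadpole G e \<and> foot G i \<in> set_uprod (ends G e)"
  shows "Poly_Mapping.lookup (C G) (product_monomial (edges G)) =
    Poly_Mapping.lookup (Xi G) (product_monomial (edges G))"
  using assms
proof (induction "card (edges G)" arbitrary: G rule: less_induct)
  case less
  note G = less.prems(1) and n = less.prems(2) and feet = less.prems(3)
  have wf: "wf_graph G" using G by (rule motic_feynman_wf)
  have fin: "finite (edges G)" using wf by (simp add: wf_graph_def)
  show ?case
  proof (cases "\<exists>f\<in>edges G. tadpole G f")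
    case False
    then have "foot G ` legs G \<subseteq> touched_verts G (edges G)"
      using feet by (fastforce simp: touched_verts_def)
    then show ?thesis using C_banana[OF G n] False by blast
  next
    case True
    then obtain f where f: "f \<in> edges G" "tadpole G f" by blast
    let ?H = "contraction G {f}"
    have ends: "ends ?H e = ends G e" for e using map_uprod_rep_tadpole[OF f(2)] by simp
    have "Poly_Mapping.lookup (C ?H) (product_monomial (edges ?H)) =
        Poly_Mapping.lookup (Xi ?H) (product_monomial (edges ?H))"
    proof (rule less.hyps)
      show "card (edges ?H) < card (edges G)" using f fin by (simp add: card_Diff1_less del: card_Diff_insert)
      show "motic_feynman_graph ?H" using f by (intro motic_contraction[OF G]) simp
      show "ncomp ?H (edges ?H) + 1 = card (verts ?H)"
        using ncomp_single[OF wf f(1)] f n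
        by (simp add: ncomp_contraction_full card_verts_contraction del: contraction_simps(1))
      fix i assume "i \<in> legs ?H"
      then obtain e where e: "e \<in> edges G" "\<not> tadpole G e" "foot G i \<in> set_uprod (ends G e)"
        using feet by auto
      have "e \<in> edges ?H" using e f by auto
      moreover have "\<not> tadpole ?H e" using e(2) unfolding tadpole_def ends .
      moreover have "foot ?H i \<in> set_uprod (ends ?H e)" unfolding ends using e(3) by (simp add: rep_tadpole[OF f(2)])
      ultimately show "\<exists>e\<in>edges ?H. \<not> tadpole ?H e \<and> foot ?H i \<in> set_uprod (ends ?H e)" by blast
    qed
    then show ?thesis
      unfolding product_monomial_remove[OF fin f(1)]
      using fin by (intro C_tadpole_step[OF G f]) (simp_all add: lookup_product_monomial)
  qed
qed

text \<open>
  If the external half-edges sit at a vertex \<open>w\<close> that no edge meets, no subgraph is mass-momentum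
  spanning, and factorisation says nothing about the top coefficient of a banana. It is recovered
  from a larger graph \<open>H\<close>, with a new vertex \<open>w'\<close> and new massless edges \<open>x\<close> from \<open>w\<close> to \<open>w'\<close>, \<open>a\<close>
  from \<open>u\<close> to \<open>w\<close> and \<open>b\<close> from \<open>u\<close> to \<open>w'\<close>. The edges of the banana together with \<open>x\<close> are
  mass-momentum spanning and motic in \<open>H\<close>, and contracting \<open>x\<close> in that subgraph gives back the banana
  next to \<open>w\<close>. On the other hand, contracting \<open>b\<close> and then \<open>x\<close> in \<open>H\<close> moves the external half-edges
  onto the banana.
\<close>

lemma C_banana_detached_legs:
  assumes G: "motic_feynman_graph G" and n: "ncomp G (edges G) + 1 = card (verts G)"
    and nt: "\<And>f. f \<in> edges G \<Longrightarrow> \<not> tadpole G f" and two: "2 \<le> card (edges G)"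
    and legs: "legs G \<noteq> {}" and feet: "\<And>i. i \<in> legs G \<Longrightarrow> foot G i = w"
    and w: "w \<notin> touched_verts G (edges G)"
  shows "Poly_Mapping.lookup (C G) (product_monomial (edges G)) =
    Poly_Mapping.lookup (Xi G) (product_monomial (edges G))"
proof -
  have FG: "feynman_graph G" using G by (simp add: motic_feynman_graph_def)
  note D = feynmanD[OF FG]
  have wfG: "wf_graph G" using FG by (rule feynman_imp_wf)
  have finE: "finite (edges G)" and finV: "finite (verts G)" using wfG by (auto simp: wf_graph_def)
  have "edges G \<noteq> {}" using two by auto
  then obtain e where e: "e \<in> edges G" by blast
  obtain u v where uv: "ends G e = Upair u v" "u \<in> verts G" "v \<in> verts G" using wfG e by (rule wf_endsE)
  have endsG: "ends G f = Upair u v" if "f \<in> edges G" for f by (rule banana_ends[OF wfG n nt e uv(1) that])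
  have "u \<noteq> v" using nt[OF e] uv by (auto simp: tadpole_def)
  have wV: "w \<in> verts G" using legs feet D(2) by auto
  have "u \<noteq> w" "v \<noteq> w" using w uv e by (auto simp: touched_verts_def)

  \<comment> \<open>A name above all vertices of G: contracting x then keeps the name w, so that the
    half-edges return to their original foot.\<close>
  define w' where "w' = Suc (Max (verts G))"
  have w': "y < w'" if "y \<in> verts G" for y using finV that by (simp add: w'_def le_imp_less_Suc)
  have "u \<noteq> w'" "v \<noteq> w'" "w \<noteq> w'" using w' uv wV by blast+
  note distinct = \<open>u \<noteq> v\<close> \<open>u \<noteq> w\<close> \<open>v \<noteq> w\<close> \<open>u \<noteq> w'\<close> \<open>v \<noteq> w'\<close> \<open>w \<noteq> w'\<close>
  define x where "x = Suc (Max (edges G))"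
  have x: "f < x" if "f \<in> edges G" for f using finE that by (simp add: x_def le_imp_less_Suc)
  define a where "a = Suc x"
  define b where "b = Suc (Suc x)"
  have fresh: "x \<notin> edges G" "a \<notin> edges G" "b \<notin> edges G"
    using x[of x] x[of a] x[of b] by (auto simp: a_def b_def)
  have labels: "x \<noteq> a" "x \<noteq> b" "a \<noteq> b" by (auto simp: a_def b_def)
  have old: "f \<noteq> x" "f \<noteq> a" "f \<noteq> b" if "f \<in> edges G" for f using that fresh by auto

  \<comment> \<open>The other vertices of G, on which no edge ends, are left out to make H connected
    on four vertices.\<close>
  define H where "H = G\<lparr>verts := {u, v, w, w'}, edges := edges G \<union> {x, a, b},
    ends := (ends G)(x := Upair w w', a := Upair u w, b := Upair u w'),
    mass := (mass G)(x := 0, a := 0, b := 0)\<rparr>"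
  have H: "verts H = {u, v, w, w'}" "edges H = edges G \<union> {x, a, b}" "legs H = legs G" "foot H = foot G" "mom H = mom G"
    by (simp_all add: H_def)
  have endsH: "ends H x = Upair w w'" "ends H a = Upair u w" "ends H b = Upair u w'"
    "f \<in> edges G \<Longrightarrow> ends H f = Upair u v" for f
    using labels old endsG by (auto simp: H_def)
  have massH: "mass H x = 0" "mass H a = 0" "mass H b = 0" "f \<in> edges G \<Longrightarrow> mass H f = mass G f" for f
    using labels old by (auto simp: H_def)
  have cardH: "card (verts H) = 4" using distinct by (simp add: H)
  have wfH: "wf_graph H" using finE endsH by (auto simp: wf_graph_def H)
  have FH: "feynman_graph H"
  proof (rule feynmanI[OF wfH])
    show "joined H (edges H) (foot H i) (foot H j)" if "i \<in> legs H" "j \<in> legs H" for i j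
      using feet that by (simp add: H)
    show "(\<Sum>i\<in>I. mom H i) \<noteq> 0" if "I \<subset> legs H" "I \<noteq> {}" for I
      using D(5)[of I] that by (simp add: H)
    show "foot H ` legs H \<subseteq> verts H" using feet by (auto simp: H)
  qed (use D(1,4) in \<open>simp_all add: H\<close>)

  have joinH: "f \<in> X \<Longrightarrow> f \<in> edges G \<Longrightarrow> joined H X u v" "x \<in> X \<Longrightarrow> joined H X w w'"
    "a \<in> X \<Longrightarrow> joined H X u w" "b \<in> X \<Longrightarrow> joined H X u w'" for X f
    using joined_edge[of _ X H] endsH by blast+
  have connected: "ncomp H X = 1" if "f \<in> X" "f \<in> edges G" "joined H X u w" "joined H X u w'" for X f
    by (rule ncomp_eq_1[of u]) (use that joinH(1) in \<open>auto simp: H\<close>)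
  have xa: "joined H X u w'" if "x \<in> X" "a \<in> X" for X
    by (rule joined_trans[OF joinH(3)[OF that(2)] joinH(2)[OF that(1)]])
  have xb: "joined H X u w" if "x \<in> X" "b \<in> X" for X
    by (rule joined_trans[OF joinH(4)[OF that(2)] joined_sym[OF joinH(2)[OF that(1)]]])
  have nH: "ncomp H (edges H) = 1"
    by (rule connected[of e]) (use e joinH(3,4) in \<open>auto simp: H\<close>)
  \<comment> \<open>Two parallel edges are what prevents a single banana edge from being a bridge,
    both in H and in \<gamma>.\<close>
  have other: "\<exists>g\<in>edges G. g \<noteq> f" for f
  proof (rule ccontr)
    assume "\<not> (\<exists>g\<in>edges G. g \<noteq> f)"
    then have "card (edges G) \<le> card {f}" by (intro card_mono) auto
    then show False using two by simp
  qed
  \<comment> \<open>H is a triangle x, a, b on u, w, w' glued at u to the parallel edges between u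
    and v; it has no bridge and is therefore motic.\<close>
  have "ncomp H (edges H - {f}) = 1" if f: "f \<in> edges H" for f
  proof -
    obtain g where g: "g \<in> edges G" "g \<noteq> f" using other by blast
    then have gX: "g \<in> edges H - {f}" by (simp add: H)
    consider "f \<noteq> a" "f \<noteq> b" | "f = a" | "f = b" by blast
    then show ?thesis
    proof cases
      case 1
      then show ?thesis using joinH(3,4)[of "edges H - {f}"] by (intro connected[OF gX g(1)]) (simp_all add: H)
    next
      case 2
      then show ?thesis using xb[of "edges H - {f}"] joinH(4)[of "edges H - {f}"] labels
        by (intro connected[OF gX g(1)]) (simp_all add: H)
    next
      case 3
      then show ?thesis using xa[of "edges H - {f}"] joinH(3)[of "edges H - {f}"] labels
        by (intro connected[OF gX g(1)]) (simp_all add: H)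
    qed
  qed
  then have MH: "motic_feynman_graph H"
    using FH nH by (simp add: motic_feynman_graph_def motic_iff[OF wfH])

  define \<gamma> where "\<gamma> = insert x (edges G)"
  have \<gamma>: "\<gamma> \<subseteq> edges H" "finite \<gamma>" "a \<notin> \<gamma>" "b \<notin> \<gamma>" "edges H - \<gamma> = {a, b}" "x \<in> \<gamma>" "x \<in> edges H"
    "a \<in> edges H" "b \<in> edges H"
    using finE fresh labels by (auto simp: \<gamma>_def H)
  have touchedE: "touched_verts H (edges G) = {u, v}"
    using endsH(4) e by (auto simp: touched_verts_def)
  have touched: "touched_verts H \<gamma> = {u, v, w, w'}"
    using touchedE endsH(1) by (auto simp: touched_verts_def \<gamma>_def)
  have mm: "mass_momentum_spanning H \<gamma>"
    unfolding mass_momentum_spanning_def touched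
    using \<gamma>(1) massH feet by (auto simp: H \<gamma>_def)
  \<comment> \<open>The edge x is a bridge of \<gamma>, but without it w is untouched and the rest
    is not m.m.; the banana edges are not bridges.\<close>
  have sub: "motic_subgraph H \<gamma>"
  proof (rule motic_subgraphI[OF wfH \<gamma>(1)])
    fix f assume f: "f \<in> \<gamma>" and mf: "mass_momentum_spanning (subgraph H \<gamma>) (\<gamma> - {f})"
    show "ncomp H (\<gamma> - {f}) = ncomp H \<gamma>"
    proof (cases "f = x")
      case True
      then have "touched_verts H (\<gamma> - {f}) = {u, v}" using touchedE fresh by (simp add: \<gamma>_def)
      then have "foot G ` legs G \<subseteq> {u, v}" using mf mm by (simp add: mass_momentum_spanning_def H)
      then show ?thesis using legs feet distinct by auto
    next
      case False
      then have fE: "f \<in> edges G" using f by (simp add: \<gamma>_def)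
      obtain g where "g \<in> edges G" "g \<noteq> f" using other by blast
      then have "joined H (\<gamma> - {f}) u v" by (intro joinH(1)[of g]) (auto simp: \<gamma>_def)
      then show ?thesis
        using ncomp_insert[OF wfH, of "\<gamma> - {f}" f u v] endsH(4)[OF fE] \<gamma>(1) f by (auto simp: insert_absorb)
    qed
  qed
  have uw: "\<not> joined H \<gamma> u w"
  proof
    assume "joined H \<gamma> u w"
    then have "w \<in> {u, v}"
      by (rule joined_invariant) (use endsH(1,4) distinct in \<open>auto simp: \<gamma>_def\<close>)
    then show False using distinct by blast
  qed
  have na: "ncomp H (insert a \<gamma>) = 1"
    by (rule connected[of e]) (use e joinH(3) xa \<gamma>(6) in \<open>auto simp: \<gamma>_def\<close>)
  have nb: "ncomp H (insert b \<gamma>) = 1"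
    by (rule connected[of e]) (use e joinH(4) xb \<gamma>(6) in \<open>auto simp: \<gamma>_def\<close>)
  have n\<gamma>: "ncomp H \<gamma> = 2"
    using ncomp_insert[OF wfH \<gamma>(1), of a u w] endsH(2) uw na \<gamma> by simp
  let ?S = "subgraph H \<gamma>"
  have MS: "motic_feynman_graph ?S" using sub motic_subgraph_iff[OF FH \<gamma>(1)] by simp
  have loopsS: "loops ?S + 1 = card (edges G)"
    using loops_subgraph[OF wfH \<gamma>(1)] n\<gamma> cardH finE fresh two by (simp add: \<gamma>_def)

  have PC: "P (contraction H \<gamma>) = Poly_Mapping.single (Poly_Mapping.single a 1) 1 +
      Poly_Mapping.single (Poly_Mapping.single b 1) 1"
  proof -
    let ?K = "contraction H \<gamma>"
    have wfK: "wf_graph ?K" using wfH by (rule wf_contraction)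
    have EK: "edges ?K = {a, b}" using \<gamma>(5) by simp
    have full: "edges ?K \<union> \<gamma> = edges H" using \<gamma>(1) by auto
    have nK: "ncomp ?K (edges ?K) = 1" unfolding ncomp_contraction full by (rule nH)
    have VK: "card (verts ?K) = 2" unfolding card_verts_contraction by (rule n\<gamma>)
    \<comment> \<open>Contracting \<gamma> leaves a and b as two parallel edges, so P of the
      quotient is the sum of their variables.\<close>
    have S: "spanning_forests 1 ?K = {{a}, {b}}"
    proof (rule set_eqI)
      fix X
      have "X \<in> spanning_forests 1 ?K \<longleftrightarrow> X \<subseteq> {a, b} \<and> card X = 1 \<and> ncomp H (X \<union> \<gamma>) = 1"
        unfolding spanning_forests_iff[OF wfK] VK EK ncomp_contraction by auto
      also have "\<dots> \<longleftrightarrow> X \<in> {{a}, {b}}"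
        using na nb by (auto simp: card_1_singleton_iff)
      finally show "X \<in> spanning_forests 1 ?K \<longleftrightarrow> X \<in> {{a}, {b}}" .
    qed
    have "Psi ?K = (\<Sum>X\<in>{{a}, {b}}. Poly_Mapping.single (product_monomial ({a, b} - X)) (1 :: 'k))"
      unfolding Psi_eq[OF wfK] nK S by (simp only: EK)
    also have "\<dots> = Poly_Mapping.single (Poly_Mapping.single a 1) 1 + Poly_Mapping.single (Poly_Mapping.single b 1) 1"
      using labels by (simp add: insert_Diff_if product_monomial_def add.commute)
    finally show ?thesis using P_eq_Psi[OF motic_contraction[OF MH \<gamma>(1)]] by simp
  qed

  let ?pm = "product_monomial (edges G)"
  \<comment> \<open>The monomial whose coefficient in C H is read in two ways. Its degree in
    \<gamma> is \<open>card (edges G)\<close> = \<open>loops ?S + 1\<close>, within reach of the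
    factorisation; it contains neither b nor x, so these edges may also be contracted.\<close>
  let ?ma = "Poly_Mapping.single a 1 + ?pm"
  have ma: "?ma = product_monomial (insert a (edges G))" using finE fresh by (simp add: product_monomial_insert)
  have lookups: "Poly_Mapping.lookup ?ma b = 0" "Poly_Mapping.lookup ?ma x = 0" "Poly_Mapping.lookup ?pm x = 0"
    using finE fresh labels by (simp_all add: lookup_add lookup_single lookup_product_monomial)

  have "Poly_Mapping.lookup (C G) ?pm = Poly_Mapping.lookup (C ?S) ?pm"
  proof -
    let ?K = "contraction ?S {x}"
    let ?G = "G\<lparr>verts := {u, v, w}\<rparr>"
    have xS: "x \<in> edges ?S" using \<gamma>(6) by simp
    have endsS: "ends ?S x = Upair w w'" using endsH by simp
    have rep: "rep ?S {x} y = (if y = w \<or> y = w' then w else y)" for y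
      unfolding rep_single[OF endsS] using w'[OF wV] by simp
    have "\<not> tadpole ?S x" using endsS distinct by (auto simp: tadpole_def)
    then have "Poly_Mapping.lookup (C ?S) ?pm = Poly_Mapping.lookup (C ?K) ?pm"
      using arg_cong[OF contraction_C[OF MS xS], of "\<lambda>p. Poly_Mapping.lookup p ?pm"] lookups
      by (simp add: lookup_set_zero)
    moreover have same: "same_on_carriers ?K ?G"
    proof -
      have "verts ?K = {u, v, w}" 
        using distinct by (simp add: touched rep[unfolded rep_subgraph] insert_commute)
      moreover have "edges ?K = edges G" using fresh by (simp add: \<gamma>_def)
      moreover have "ends ?K f = ends G f" if "f \<in> edges G" for f
      proof -
        have "ends ?K f = map_uprod (rep ?S {x}) (Upair u v)"
          unfolding contraction_simps subgraph_simps endsH(4)[OF that] ..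
        also have "\<dots> = Upair u v" using distinct by (simp only: map_uprod_simps rep) simp
        finally show ?thesis using endsG[OF that] by simp
      qed
      moreover have "mass ?K f = mass G f" if "f \<in> edges G" for f using mm massH(4)[OF that] by simp
      moreover have "foot ?K i = foot G i" if "i \<in> legs G" for i
        unfolding contraction_simps subgraph_simps rep using feet[OF that] by (simp add: H)
      moreover have "legs ?K = legs G" "mom ?K = mom G" using mm by (simp_all add: H)
      ultimately show ?thesis by (simp add: same_on_carriers_def)
    qed
    moreover have MK: "motic_feynman_graph ?K" using xS by (intro motic_contraction[OF MS]) auto
    ultimately have "Poly_Mapping.lookup (C ?S) ?pm = Poly_Mapping.lookup (C ?G) ?pm"
      using same_on_carriers_eq(2)[OF MK same] by simp
    also have "C ?G = C G"
    proof -
      \<comment> \<open>The vertices omitted from H are put back; no edge and no half-edge meets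
        them.\<close>
      let ?A = "verts G - {u, v, w}"
      have "C (?G\<lparr>verts := ?A \<union> verts ?G\<rparr>) = C ?G"
        using isolated_vertices[OF motic_same_on_carriers[OF same MK], of ?A] finV by auto
      moreover have "?A \<union> {u, v, w} = verts G" using uv wV by auto
      then have "?G\<lparr>verts := ?A \<union> verts ?G\<rparr> = G" by simp
      ultimately show ?thesis by simp
    qed
    finally show ?thesis by simp
  qed
  \<comment> \<open>Of the two summands of P on the quotient only the variable of a contributes,
    since \<open>?ma\<close> does not contain b.\<close>
  also have "\<dots> = Poly_Mapping.lookup (C ?S * P (contraction H \<gamma>)) ?ma"
    using lookup_single_mult_eq_0[of ?ma b "Poly_Mapping.single b 1" 1 "C ?S"] lookups
    by (simp add: PC distrib_left mult.commute[of "C ?S"] lookup_add lookup_single_mult)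
  also have "\<dots> = Poly_Mapping.lookup (C H) ?ma"
  proof (rule agreeD[OF factorisation_C_mm[OF MH sub mm], symmetric])
    have "\<gamma> \<inter> insert a (edges G) = edges G" using \<gamma>(3) by (auto simp: \<gamma>_def)
    then show "degree_in \<gamma> ?ma \<le> loops ?S + 1"
      unfolding ma loopsS using finE \<gamma>(2) by (simp add: degree_in_product_monomial)
  qed
  also have "\<dots> = Poly_Mapping.lookup (C (contraction H {b})) ?ma"
  proof -
    have "\<not> tadpole H b" using endsH distinct by (auto simp: tadpole_def)
    then show ?thesis
      using arg_cong[OF contraction_C[OF MH \<gamma>(9)], of "\<lambda>p. Poly_Mapping.lookup p ?ma"] lookups
      by (simp add: lookup_set_zero)
  qed
  also have "\<dots> = Poly_Mapping.lookup (Xi G) ?pm"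
  proof -
    let ?B = "contraction H {b}"
    let ?K = "contraction ?B {x}"
    have MB: "motic_feynman_graph ?B" using \<gamma>(9) by (intro motic_contraction[OF MH]) simp
    have wfB: "wf_graph ?B" using MB by (rule motic_feynman_wf)
    have xB: "x \<in> edges ?B" using \<gamma>(7) labels by simp
    have MK: "motic_feynman_graph ?K" using xB by (intro motic_contraction[OF MB]) simp
    have FK: "feynman_graph ?K" using MK by (simp add: motic_feynman_graph_def)
    have "\<not> joined H {b} w w'"
    proof
      assume "joined H {b} w w'"
      then have "w' = w" by (rule joined_invariant) (use endsH(3) distinct in auto)
      then show False using distinct by simp
    qed
    then have ntx: "\<not> tadpole ?B x" using tadpole_contraction[OF endsH(1)] by simp
    have CB: "Poly_Mapping.lookup (C ?B) ?ma = Poly_Mapping.lookup (C ?K) ?ma"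
      using arg_cong[OF contraction_C[OF MB xB], of "\<lambda>p. Poly_Mapping.lookup p ?ma"] lookups ntx
      by (simp add: lookup_set_zero)
    have EK: "edges ?K = insert a (edges G)" using fresh labels by (auto simp: H)
    have "ncomp H {b} = 3"
    proof -
      have "\<not> tadpole H b" using endsH distinct by (auto simp: tadpole_def)
      then show ?thesis using ncomp_single[OF wfH \<gamma>(9)] cardH by simp
    qed
    then have VK: "card (verts ?K) = 2"
      using ncomp_single[OF wfB xB] ntx
      by (simp only: card_verts_contraction) simp
    have full: "edges ?K \<union> {x} \<union> {b} = edges H" using EK \<gamma>(7,9) by (auto simp: H)
    have nK: "ncomp ?K (edges ?K) + 1 = card (verts ?K)"
      unfolding ncomp_contraction full VK nH by simp
    let ?r = "rep H ({x} \<union> {b})"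
    have endsK: "ends ?K f = map_uprod ?r (ends H f)" for f
      by (cases "ends H f") (simp add: rep_contraction)
    have ntK: "\<not> tadpole ?K f" and endsKf: "ends ?K f = Upair (?r u) (?r v)" if "f \<in> edges G" for f
    proof -
      show eq: "ends ?K f = Upair (?r u) (?r v)" unfolding endsK endsH(4)[OF that] by simp
      have "u = v" if "joined H ({x} \<union> {b}) v u"
        using that by (rule joined_invariant) (use endsH(1,3) distinct in auto)
      then have "?r v \<noteq> ?r u" using distinct rep_eq_iff by metis
      then show "\<not> tadpole ?K f" unfolding tadpole_def eq by auto
    qed
    have "joined H ({x} \<union> {b}) u w" by (rule xb) auto
    then have ru: "?r u = ?r w" by (simp add: rep_eq_iff)
    have footK: "foot ?K i = ?r w" if "i \<in> legs G" for i
      using feet[OF that] by (simp add: H rep_contraction)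
    have legsK: "legs ?K = legs G" by (simp add: H)
    \<comment> \<open>In \<open>?K\<close> the vertices u, w and w' coincide: a has become a tadpole
      and all half-edges sit at an end of the banana edges.\<close>
    have "Poly_Mapping.lookup (C ?K) (product_monomial (edges ?K)) =
        Poly_Mapping.lookup (Xi ?K) (product_monomial (edges ?K))"
    proof (rule C_banana_tadpoles[OF MK nK])
      fix i assume "i \<in> legs ?K"
      then have "foot ?K i \<in> set_uprod (ends ?K e)" using footK legsK endsKf[OF e] ru by simp
      then show "\<exists>f\<in>edges ?K. \<not> tadpole ?K f \<and> foot ?K i \<in> set_uprod (ends ?K f)"
        using ntK[OF e] e EK by blast
    qed
    also have "\<dots> = of_real (momentum_weight ?K {} + (\<Sum>f | f \<in> edges ?K \<and> \<not> tadpole ?K f. (mass ?K f)\<^sup>2))"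
      by (rule lookup_Xi_top[OF FK nK])
    \<comment> \<open>All half-edges still share one vertex, so moving them onto the banana creates
      no momentum term, in agreement with G, where they share w.\<close>
    also have "momentum_weight ?K {} = 0"
      using feynmanD(1,4)[OF FK] footK legsK by (intro momentum_weight_joined) auto
    also have "(\<Sum>f | f \<in> edges ?K \<and> \<not> tadpole ?K f. (mass ?K f)\<^sup>2) = (\<Sum>f\<in>edges G. (mass G f)\<^sup>2)"
    proof (rule sum.mono_neutral_cong_right)
      show "edges G \<subseteq> {f \<in> edges ?K. \<not> tadpole ?K f}" using ntK EK by blast
      show "\<forall>f\<in>{f \<in> edges ?K. \<not> tadpole ?K f} - edges G. (mass ?K f)\<^sup>2 = 0"
        using EK massH(2) by auto
      show "finite {f \<in> edges ?K. \<not> tadpole ?K f}" unfolding EK using finE by simp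
    qed (simp add: massH(4))
    also have "of_real (0 + (\<Sum>f\<in>edges G. (mass G f)\<^sup>2)) = Poly_Mapping.lookup (Xi G :: 'k epoly) ?pm"
    proof -
      have "momentum_weight G {} = 0"
        using feet by (intro momentum_weight_joined D(1,4)) auto
      moreover have "{f. f \<in> edges G \<and> \<not> tadpole G f} = edges G" using nt by auto
      ultimately show ?thesis unfolding lookup_Xi_top[OF FG n] by simp
    qed
    finally show ?thesis unfolding CB by (simp only: EK ma)
  qed
  finally show ?thesis .
qed

lemma C_eq_Xi: "motic_feynman_graph G \<Longrightarrow> C G = Xi G"
proof (induction "card (edges G)" arbitrary: G rule: less_induct)
  case less
  note G = less.prems
  have F: "feynman_graph G" using G by (simp add: motic_feynman_graph_def)
  note D = feynmanD[OF F]
  have wf: "wf_graph G" using G by (rule motic_feynman_wf)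
  have fin: "finite (edges G)" using wf by (simp add: wf_graph_def)
  have IH: "C (contraction G {e}) = Xi (contraction G {e})" if e: "e \<in> edges G" for e
  proof (rule less.hyps)
    show "card (edges (contraction G {e})) < card (edges G)"
      using e fin by (simp add: card_Diff1_less del: card_Diff_insert)
    show "motic_feynman_graph (contraction G {e})" using G e by (intro motic_contraction) auto
  qed
  show ?case
  proof (cases "card (edges G) = 1")
    case True
    then show ?thesis using single_edge[OF G] by blast
  next
    case not_single: False
    show ?thesis
    proof (rule poly_mapping_eqI, rule ccontr)
      fix m assume neq: "Poly_Mapping.lookup (C G) m \<noteq> Poly_Mapping.lookup (Xi G) m"
      have pos: "Poly_Mapping.lookup m e \<noteq> 0" if e: "e \<in> edges G" for e
        by (rule lookup_neq_set_zero[OF _ neq]) (simp add: contraction_C[OF G e] set_zero_Xi[OF F e] IH[OF e])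
      note m = lookup_neq_homogeneous[OF homogeneous_C[OF G] homogeneous_Xi[OF F] neq]
      \<comment> \<open>A discrepancy linear in a tadpole variable would descend to the quotient by
        that tadpole, where the induction hypothesis excludes it.\<close>
      have no_simple_tadpole: False if f: "f \<in> edges G" "tadpole G f" "Poly_Mapping.lookup m f = 1" for f
      proof -
        define m' where "m' = m - Poly_Mapping.single f 1"
        have m': "m = Poly_Mapping.single f 1 + m'"
          by (rule poly_mapping_eqI) (use f(3) in \<open>auto simp: m'_def lookup_add lookup_minus lookup_single when_def\<close>)
        have "Poly_Mapping.lookup m' f = 0" using f(3) by (simp add: m'_def lookup_minus)
        then show False using C_tadpole_step[OF G f(1,2), of m'] IH[OF f(1)] neq by (simp add: m')
      qed
      have deg: "card (edges G) \<le> loops G + 1" using card_le_degree_in[OF fin pos] m(2) by simp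
      consider "ncomp G (edges G) = card (verts G)" | "ncomp G (edges G) + 1 = card (verts G)"
        using deg ncomp_le_card_verts[OF wf, of "edges G"] card_verts_le[OF wf order_refl]
        unfolding loops_eq by linarith
      then show False
      proof cases
        case 1
        then have degm: "degree_in (edges G) m = card (edges G) + 1" using m(2) by (simp add: loops_eq)
        \<comment> \<open>The exponents sum to one more than the number of edges. If all were at
          least 2 there would be at most one edge; one edge is the initial condition, and with no
          edge the degree would be 0 instead of 1.\<close>
        have "\<exists>f\<in>edges G. Poly_Mapping.lookup m f = 1"
        proof (rule ccontr)
          assume "\<not> (\<exists>f\<in>edges G. Poly_Mapping.lookup m f = 1)"
          then have "2 \<le> Poly_Mapping.lookup m f" if "f \<in> edges G" for f
            using pos[OF that] that by (metis One_nat_def Suc_1 Suc_leI le_neq_implies_less less_one linorder_not_le)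
          then have "(\<Sum>f\<in>edges G. 2) \<le> degree_in (edges G) m"
            unfolding degree_in_def by (intro sum_mono)
          then have "card (edges G) = 0" using degm not_single by simp
          then have "edges G = {}" using fin by simp
          then show False using degm by (simp add: degree_in_def)
        qed
        then obtain f where f: "f \<in> edges G" "Poly_Mapping.lookup m f = 1" by blast
        have "ncomp G (edges G) \<le> ncomp G {f}" using f by (intro ncomp_antimono[OF wf]) simp
        then have "tadpole G f"
          using ncomp_single[OF wf f(1)] card_verts_pos[OF wf f(1)] 1 by (auto split: if_splits)
        then show False using no_simple_tadpole f by blast
      next
        case 2
        then have degm: "degree_in (edges G) m = card (edges G)"
          using m(2) card_verts_le[OF wf order_refl] unfolding loops_eq by linarith
        have meq: "m = product_monomial (edges G)" by (rule product_monomialI[OF fin m(1) pos degm])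
        \<comment> \<open>Every variable now occurs exactly once, so any tadpole would be one of the
          excluded kind.\<close>
        have nt: "\<not> tadpole G f" if "f \<in> edges G" for f
          using no_simple_tadpole[OF that] that fin by (auto simp: meq lookup_product_monomial)
        show False
        proof (cases "foot G ` legs G \<subseteq> touched_verts G (edges G)")
          case True
          then show False using C_banana[OF G 2 nt] neq meq by simp
        next
          case False
          then obtain j where j: "j \<in> legs G" "foot G j \<notin> touched_verts G (edges G)" by blast
          \<comment> \<open>A foot met by no edge is joined only to itself, and all half-edges lie
            in one component.\<close>
          have "foot G i = foot G j" if "i \<in> legs G" for i
            using joined_touched(2)[OF D(3)[OF that j(1)]] j(2) by blast
          moreover have "card (edges G) \<noteq> 0" using 2 fin by auto
          then have "2 \<le> card (edges G)" using not_single by linarith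
          moreover have "legs G \<noteq> {}" using j(1) by blast
          ultimately show False using C_banana_detached_legs[OF G 2 nt _ _ _ j(2)] neq meq by simp
        qed
      qed
    qed
  qed
qed

end

theorem proposition4p8:
  fixes P C :: "('d::finite) fgraph \<Rightarrow> 'k::real_field epoly"
  assumes homogeneous_P: "\<And>G. motic_feynman_graph G \<Longrightarrow> homogeneous_in (edges G) (loops G) (P G)"
    and homogeneous_C: "\<And>G. motic_feynman_graph G \<Longrightarrow> homogeneous_in (edges G) (loops G + 1) (C G)"
    and equivalence: "\<And>G H. motic_feynman_graph G \<Longrightarrow> motic_feynman_graph H \<Longrightarrow> feynman_equiv G H \<Longrightarrow>
      P G = P H \<and> C G = C H"
    and isolated_vertex: "\<And>G v. motic_feynman_graph G \<Longrightarrow> v \<notin> verts G \<Longrightarrow>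
      P (G\<lparr>verts := insert v (verts G)\<rparr>) = P G \<and> C (G\<lparr>verts := insert v (verts G)\<rparr>) = C G"
    and factorisation_P: "\<And>G \<gamma>. motic_feynman_graph G \<Longrightarrow> motic_subgraph G \<gamma> \<Longrightarrow>
      agree_to_degree \<gamma> (loops (subgraph G \<gamma>)) (P G) (P (subgraph G \<gamma>) * P (contraction G \<gamma>))"
    and factorisation_C_not_mm: "\<And>G \<gamma>. motic_feynman_graph G \<Longrightarrow> motic_subgraph G \<gamma> \<Longrightarrow>
      \<not> mass_momentum_spanning G \<gamma> \<Longrightarrow>
      agree_to_degree \<gamma> (loops (subgraph G \<gamma>)) (C G) (P (subgraph G \<gamma>) * C (contraction G \<gamma>))"
    and factorisation_C_mm: "\<And>G \<gamma>. motic_feynman_graph G \<Longrightarrow> motic_subgraph G \<gamma> \<Longrightarrow>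
      mass_momentum_spanning G \<gamma> \<Longrightarrow>
      agree_to_degree \<gamma> (loops (subgraph G \<gamma>) + 1) (C G) (C (subgraph G \<gamma>) * P (contraction G \<gamma>))"
    and contraction_P: "\<And>G e. motic_feynman_graph G \<Longrightarrow> e \<in> edges G \<Longrightarrow>
      set_zero e (P G) = (if tadpole G e then 0 else P (contraction G {e}))"
    and contraction_C: "\<And>G e. motic_feynman_graph G \<Longrightarrow> e \<in> edges G \<Longrightarrow>
      set_zero e (C G) = (if tadpole G e then 0 else C (contraction G {e}))"
    and single_edge: "\<And>G. motic_feynman_graph G \<Longrightarrow> card (edges G) = 1 \<Longrightarrow>
      P G = Psi G \<and> C G = Xi G"
    and massive_banana: "\<And>G v. motic_feynman_graph G \<Longrightarrow> banana G \<Longrightarrow> \<forall>e\<in>edges G. mass G e \<noteq> 0 \<Longrightarrow>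
      v \<in> verts G \<Longrightarrow>
      Poly_Mapping.lookup (C G) (product_monomial (edges G)) =
        of_real (momentum_into G {v} \<bullet> momentum_into G {v} + (\<Sum>e\<in>edges G. (mass G e)\<^sup>2))"
  shows "\<forall>G. motic_feynman_graph G \<longrightarrow> P G = Psi G \<and> C G = Xi G"
proof -
  interpret motic_recursion P C
    by (unfold_locales; fact assms)
  show ?thesis using P_eq_Psi C_eq_Xi by blast
qed

end
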